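(* Let $A$ be a left noetherian Artin-Schelter regular algebra of dimension $d$ over a field $k$. Let $f\in A_+$ be a homogeneous normal regular element and let $B=A/(f)$. Then for every finitely generated graded left $B$-module $M$, the $(d+1)$-st left syzygy of $M$, i.e. $\operatorname{im}(Q_{d+1}\to Q_d)$ for a minimal graded free left $B$-module resolution $\cdots\to Q_1\to Q_0$ of $M$, is isomorphic to the cokernel $\operatorname{coker}\varphi$ of some reduced twisted left matrix factorization $(\varphi,\tau)$ of $f$ over $A$.
   Context: Conventions. $A=\bigoplus_{n\ge 0}A_n$ is connected ($A_0=k$), $\mathbb{N}$-graded, locally finite-dimensional ($\dim_k A_i<\infty$); $A_+=\bigoplus_{n>0}A_n$. $A$ is Artin-Schelter regular of dimension $d$ if $\operatorname{gl.dim}(A)=d<\infty$, $\operatorname{GKdim}(A)=d$, and $\operatorname{Ext}_A^i(k,A)=0$ for $i\ne d$ while $\operatorname{Ext}^d_A(k,A)\cong k$ (up to degree shift). Modules are graded left modules and homomorphisms have degree $0$; $M(n)_i=M_{i+n}$. Regular means non-zero-divisor (on both sides); normal means $fA=Af$. The normalizing automorphism $\sigma$ of $f$ is the graded algebra automorphism of $A$ with $af=f\sigma(a)$ for all $a$. $M^\sigma$ is $M$ as a graded abelian group with action $a\cdot m=\sigma(a)m$. Put $M^{tw}=M^{\sigma}(-\deg f)$ and $\varphi^{tw}=\varphi$ on underlying groups. Left multiplication by $f$ is a degree $0$ homomorphism $\lambda_f^M:M^{tw}\to M$. A twisted left matrix factorization of $f$ over $A$ is a pair $(\varphi:F\to G,\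 \tau:G^{tw}\to F)$ of degree $0$ maps of finitely generated graded free left $A$-modules (the zero module being free) with $\varphi\tau=\lambda_f^G$ and $\tau\varphi^{tw}=\lambda_f^F$. A morphism $(\varphi,\tau)\to(\varphi',\tau')$ is a pair of degree $0$ homomorphisms $\Psi_G:G\to G'$, $\Psi_F:F\to F'$ with $\Psi_G\varphi=\varphi'\Psi_F$; it is an isomorphism if both components are. Direct sums are componentwise. A factorization is trivial if $\varphi=\lambda_f^{A(n)}$ or $\tau=\lambda_f^{A(n)}$ for some $n\in\mathbb{Z}$; $(\varphi,\tau)$ is reduced if it is not isomorphic to a factorization having a trivial direct summand. For any factorization, $f\cdot\operatorname{coker}\varphi=0$, so $\operatorname{coker}\varphi$ is a left $B$-module. A graded free $B$-resolution $(Q_\bullet,\partial_\bullet)$ is minimal if $\operatorname{im}\partial_i\subset B_+Q_{i-1}$ for all $i$; minimal graded free resolutions are unique up to isomorphism. *)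

theory Defs
  imports
    "HOL-Algebra.Embedded_Algebras"
    "HOL-Algebra.QuotRing"
    "HOL-Algebra.Module"
    "HOL-Library.Extended_Nat"
    "HOL-Library.Extended_Real"
    "HOL-Library.Liminf_Limsup"
begin

section \<open>Graded rings and graded left modules\<close>

text \<open>
  Modules are records over the (noncommutative) base ring; all gradings are indexed by the integers.
  The multiplicative fields that a module record inherits from the type of rings are never used
  and are left undefined in the constructions below.
\<close>

record 'a gring = "'a ring" +
  rgrade :: "int \<Rightarrow> 'a set"

record ('a, 'm) gmodule = "('a, 'm) module" +
  grade :: "int \<Rightarrow> 'm set"

definition direct_grading :: "('m, 'x) ring_scheme \<Rightarrow> (int \<Rightarrow> 'm set) \<Rightarrow> bool" where
  "direct_grading M g \<longleftrightarrow>
     (\<forall>i. additive_subgroup (g i) M) \<and>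
     (\<forall>m \<in> carrier M. \<exists>!c. (\<forall>i. c i \<in> g i) \<and> finite {i. c i \<noteq> \<zero>\<^bsub>M\<^esub>} \<and>
        m = (\<Oplus>\<^bsub>M\<^esub>i \<in> {i. c i \<noteq> \<zero>\<^bsub>M\<^esub>}. c i))"

locale graded_ring = ring A for A :: "'a gring" (structure) +
  assumes grading: "direct_grading A (rgrade A)"
    and one_grade: "\<one> \<in> rgrade A 0"
    and mult_grade: "\<lbrakk> a \<in> rgrade A i; b \<in> rgrade A j \<rbrakk> \<Longrightarrow> a \<otimes> b \<in> rgrade A (i + j)"

text \<open>
  The base field is identified with its image in the algebra, hence with the component of degree 0:
  \<open>K\<close> is a central subfield of \<open>A\<close>.
\<close>

locale connected_graded_algebra = graded_ring A + subfield K A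
  for K :: "'a set" and A :: "'a gring" (structure) +
  assumes central: "\<lbrakk> c \<in> K; a \<in> carrier A \<rbrakk> \<Longrightarrow> c \<otimes> a = a \<otimes> c"
    and nat_graded: "i < 0 \<Longrightarrow> rgrade A i = {\<zero>}"
    and connected: "rgrade A 0 = K"
    and locally_finite: "ring.finite_dimension A K (rgrade A i)"

locale left_module = A?: ring A + M?: abelian_group M
  for A :: "('a, 'x) ring_scheme" and M :: "('a, 'm, 'y) module_scheme" (structure) +
  assumes smult_closed: "\<lbrakk> a \<in> carrier A; x \<in> carrier M \<rbrakk> \<Longrightarrow> a \<odot>\<^bsub>M\<^esub> x \<in> carrier M"
    and smult_l_distr: "\<lbrakk> a \<in> carrier A; b \<in> carrier A; x \<in> carrier M \<rbrakk> \<Longrightarrow>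
      (a \<oplus>\<^bsub>A\<^esub> b) \<odot>\<^bsub>M\<^esub> x = a \<odot>\<^bsub>M\<^esub> x \<oplus>\<^bsub>M\<^esub> b \<odot>\<^bsub>M\<^esub> x"
    and smult_r_distr: "\<lbrakk> a \<in> carrier A; x \<in> carrier M; y \<in> carrier M \<rbrakk> \<Longrightarrow>
      a \<odot>\<^bsub>M\<^esub> (x \<oplus>\<^bsub>M\<^esub> y) = a \<odot>\<^bsub>M\<^esub> x \<oplus>\<^bsub>M\<^esub> a \<odot>\<^bsub>M\<^esub> y"
    and smult_assoc: "\<lbrakk> a \<in> carrier A; b \<in> carrier A; x \<in> carrier M \<rbrakk> \<Longrightarrow>
      (a \<otimes>\<^bsub>A\<^esub> b) \<odot>\<^bsub>M\<^esub> x = a \<odot>\<^bsub>M\<^esub> (b \<odot>\<^bsub>M\<^esub> x)"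
    and smult_one: "x \<in> carrier M \<Longrightarrow> \<one>\<^bsub>A\<^esub> \<odot>\<^bsub>M\<^esub> x = x"

locale graded_left_module = A?: graded_ring A + left_module A M
  for A :: "'a gring" and M :: "('a, 'm) gmodule" (structure) +
  assumes module_grading: "direct_grading M (grade M)"
    and smult_grade: "\<lbrakk> a \<in> rgrade A i; x \<in> grade M j \<rbrakk> \<Longrightarrow> a \<odot>\<^bsub>M\<^esub> x \<in> grade M (i + j)"

text \<open>Homomorphisms have degree 0.\<close>

definition gmod_hom :: "'a gring \<Rightarrow> ('a, 'm) gmodule \<Rightarrow> ('a, 'n) gmodule \<Rightarrow> ('m \<Rightarrow> 'n) set" where
  "gmod_hom A M N = {h \<in> hom (add_monoid M) (add_monoid N).
     (\<forall>a \<in> carrier A. \<forall>x \<in> carrier M. h (a \<odot>\<^bsub>M\<^esub> x) = a \<odot>\<^bsub>N\<^esub> h x) \<and>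
     (\<forall>i. h ` grade M i \<subseteq> grade N i)}"

definition gmod_iso :: "'a gring \<Rightarrow> ('a, 'm) gmodule \<Rightarrow> ('a, 'n) gmodule \<Rightarrow> ('m \<Rightarrow> 'n) set" where
  "gmod_iso A M N = {h \<in> gmod_hom A M N. bij_betw h (carrier M) (carrier N)}"

definition gmod_isomorphic :: "'a gring \<Rightarrow> ('a, 'm) gmodule \<Rightarrow> ('a, 'n) gmodule \<Rightarrow> bool" where
  "gmod_isomorphic A M N \<longleftrightarrow> gmod_iso A M N \<noteq> {}"

subsection \<open>Constructions\<close>

definition regular_module :: "'a gring \<Rightarrow> ('a, 'a) gmodule" where
  "regular_module A = \<lparr> carrier = carrier A, mult = undefined, one = undefined,
     zero = \<zero>\<^bsub>A\<^esub>, add = add A, smult = mult A, grade = rgrade A \<rparr>"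

definition shift :: "('a, 'm) gmodule \<Rightarrow> int \<Rightarrow> ('a, 'm) gmodule" where
  "shift M n = M \<lparr> grade := \<lambda>i. grade M (i + n) \<rparr>"

text \<open>The following two are applied to graded submodules only.\<close>

definition sub_gmodule :: "('a, 'm) gmodule \<Rightarrow> 'm set \<Rightarrow> ('a, 'm) gmodule" where
  "sub_gmodule M N = M \<lparr> carrier := N, grade := \<lambda>i. grade M i \<inter> N \<rparr>"

definition quot_gmodule :: "('a, 'm) gmodule \<Rightarrow> 'm set \<Rightarrow> ('a, 'm set) gmodule" where
  "quot_gmodule M N = \<lparr> carrier = a_rcosets\<^bsub>M\<^esub> N, mult = undefined, one = undefined,
     zero = N, add = set_add M,
     smult = (\<lambda>a X. \<Union>x \<in> X. N +>\<^bsub>M\<^esub> (a \<odot>\<^bsub>M\<^esub> x)),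
     grade = (\<lambda>i. {N +>\<^bsub>M\<^esub> x | x. x \<in> grade M i}) \<rparr>"

definition sum_gmodule :: "('a, 'm) gmodule \<Rightarrow> ('a, 'n) gmodule \<Rightarrow> ('a, 'm \<times> 'n) gmodule" where
  "sum_gmodule M N = \<lparr> carrier = carrier M \<times> carrier N, mult = undefined, one = undefined,
     zero = (\<zero>\<^bsub>M\<^esub>, \<zero>\<^bsub>N\<^esub>),
     add = (\<lambda>(x, y) (x', y'). (x \<oplus>\<^bsub>M\<^esub> x', y \<oplus>\<^bsub>N\<^esub> y')),
     smult = (\<lambda>a (x, y). (a \<odot>\<^bsub>M\<^esub> x, a \<odot>\<^bsub>N\<^esub> y)),
     grade = (\<lambda>i. grade M i \<times> grade N i) \<rparr>"

definition quot_gring :: "'a gring \<Rightarrow> 'a set \<Rightarrow> 'a set gring" where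
  "quot_gring A I = ring.extend (A Quot I)
     \<lparr> rgrade = \<lambda>i. {I +>\<^bsub>A\<^esub> a | a. a \<in> rgrade A i} \<rparr>"

text \<open>Right modules are left modules over the opposite ring.\<close>

definition op_gring :: "'a gring \<Rightarrow> 'a gring" where
  "op_gring A = A \<lparr> mult := \<lambda>a b. b \<otimes>\<^bsub>A\<^esub> a \<rparr>"

text \<open>\<open>augmentation A\<close> is the ideal of elements of positive degree.\<close>

definition augmentation :: "'a gring \<Rightarrow> 'a set" where
  "augmentation A = generate (add_monoid A) (\<Union>n \<in> {0<..}. rgrade A n)"

definition trivial_module :: "'a gring \<Rightarrow> ('a, 'a set) gmodule" where
  "trivial_module A = quot_gmodule (regular_module A) (augmentation A)"

text \<open>Finite sums of elements \<open>a \<odot> x\<close> with \<open>a \<in> I\<close> and \<open>x \<in> S\<close>, for a left ideal \<open>I\<close>.\<close>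

definition set_smult :: "('a, 'm) gmodule \<Rightarrow> 'a set \<Rightarrow> 'm set \<Rightarrow> 'm set" where
  "set_smult M I S = generate (add_monoid M) {a \<odot>\<^bsub>M\<^esub> x | a x. a \<in> I \<and> x \<in> S}"

definition finitely_generated :: "'a gring \<Rightarrow> ('a, 'm) gmodule \<Rightarrow> bool" where
  "finitely_generated A M \<longleftrightarrow>
     (\<exists>S. finite S \<and> S \<subseteq> carrier M \<and> carrier M = set_smult M (carrier A) S)"

definition left_noetherian :: "'a gring \<Rightarrow> bool" where
  "left_noetherian A \<longleftrightarrow> (\<forall>I. submodule I A (regular_module A) \<longrightarrow>
     (\<exists>S. finite S \<and> S \<subseteq> I \<and> I = set_smult (regular_module A) (carrier A) S))"

definition homogeneous_basis :: "'a gring \<Rightarrow> ('a, 'm) gmodule \<Rightarrow> 'm set \<Rightarrow> bool" where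
  "homogeneous_basis A M S \<longleftrightarrow> S \<subseteq> (\<Union>i. grade M i) \<and>
     (\<forall>m \<in> carrier M. \<exists>!c. c \<in> S \<rightarrow>\<^sub>E carrier A \<and> finite {s \<in> S. c s \<noteq> \<zero>\<^bsub>A\<^esub>} \<and>
        m = (\<Oplus>\<^bsub>M\<^esub>s \<in> {s \<in> S. c s \<noteq> \<zero>\<^bsub>A\<^esub>}. c s \<odot>\<^bsub>M\<^esub> s))"

definition graded_free :: "'a gring \<Rightarrow> ('a, 'm) gmodule \<Rightarrow> bool" where
  "graded_free A M \<longleftrightarrow> graded_left_module A M \<and> (\<exists>S. homogeneous_basis A M S)"

section \<open>Resolutions\<close>

text \<open>\<open>\<delta> i\<close> maps \<open>Q i\<close> to \<open>Q (i - 1)\<close> and is used for positive \<open>i\<close> only.\<close>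

definition graded_resolution ::
  "'a gring \<Rightarrow> (nat \<Rightarrow> ('a, 'q) gmodule) \<Rightarrow> (nat \<Rightarrow> 'q \<Rightarrow> 'q) \<Rightarrow> ('q \<Rightarrow> 'm) \<Rightarrow> ('a, 'm) gmodule \<Rightarrow> bool"
  where
  "graded_resolution A Q \<delta> \<epsilon> M \<longleftrightarrow>
     (\<forall>i. graded_left_module A (Q i)) \<and> graded_left_module A M \<and>
     \<epsilon> \<in> gmod_hom A (Q 0) M \<and> (\<forall>i. \<delta> (Suc i) \<in> gmod_hom A (Q (Suc i)) (Q i)) \<and>
     \<epsilon> ` carrier (Q 0) = carrier M \<and>
     \<delta> 1 ` carrier (Q 1) = a_kernel (Q 0) M \<epsilon> \<and>
     (\<forall>i. \<delta> (Suc (Suc i)) ` carrier (Q (Suc (Suc i))) = a_kernel (Q (Suc i)) (Q i) (\<delta> (Suc i)))"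

definition minimal_graded_free_resolution ::
  "'a gring \<Rightarrow> (nat \<Rightarrow> ('a, 'q) gmodule) \<Rightarrow> (nat \<Rightarrow> 'q \<Rightarrow> 'q) \<Rightarrow> ('q \<Rightarrow> 'm) \<Rightarrow> ('a, 'm) gmodule \<Rightarrow> bool"
  where
  "minimal_graded_free_resolution A Q \<delta> \<epsilon> M \<longleftrightarrow>
     graded_resolution A Q \<delta> \<epsilon> M \<and> (\<forall>i. graded_free A (Q i)) \<and>
     (\<forall>i. \<delta> (Suc i) ` carrier (Q (Suc i)) \<subseteq> set_smult (Q i) (augmentation A) (carrier (Q i)))"

definition syzygy :: "(nat \<Rightarrow> ('a, 'q) gmodule) \<Rightarrow> (nat \<Rightarrow> 'q \<Rightarrow> 'q) \<Rightarrow> nat \<Rightarrow> ('a, 'q) gmodule" where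
  "syzygy Q \<delta> i = sub_gmodule (Q (i - 1)) (\<delta> i ` carrier (Q i))"

section \<open>Global dimension\<close>

text \<open>
  Quantification over all modules has to be confined to one type of elements. The type below has
  \<open>2\<^bsup>\<kappa>\<^esup>\<close> elements, where \<open>\<kappa>\<close> is the (infinite) cardinality of \<open>nat \<Rightarrow> 'a\<close>. Up to isomorphism it
  carries every finitely generated \<open>A\<close>-module, in particular every cyclic one, and for every module
  that it carries it also carries a graded free cover, whose rank is at most the cardinality of the
  type. So lifting properties can be tested on it, projective resolutions exist in it, and the
  supremum of the projective dimensions is already attained on it, since by Auslander's theorem
  this supremum can be computed on cyclic modules.
\<close>

type_synonym 'a univ = "(nat \<Rightarrow> 'a) set"

definition graded_projective :: "'a gring \<Rightarrow> ('a, 'a univ) gmodule \<Rightarrow> bool" where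
  "graded_projective A P \<longleftrightarrow> graded_left_module A P \<and>
     (\<forall>(X :: ('a, 'a univ) gmodule) (Y :: ('a, 'a univ) gmodule) \<pi> h.
        graded_left_module A X \<longrightarrow> graded_left_module A Y \<longrightarrow>
        \<pi> \<in> gmod_hom A X Y \<longrightarrow> \<pi> ` carrier X = carrier Y \<longrightarrow> h \<in> gmod_hom A P Y \<longrightarrow>
        (\<exists>g \<in> gmod_hom A P X. \<forall>p \<in> carrier P. \<pi> (g p) = h p))"

definition graded_projective_resolution ::
  "'a gring \<Rightarrow> (nat \<Rightarrow> ('a, 'a univ) gmodule) \<Rightarrow> (nat \<Rightarrow> 'a univ \<Rightarrow> 'a univ) \<Rightarrow> ('a univ \<Rightarrow> 'm) \<Rightarrow>
    ('a, 'm) gmodule \<Rightarrow> bool"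
  where
  "graded_projective_resolution A P \<delta> \<epsilon> M \<longleftrightarrow>
     graded_resolution A P \<delta> \<epsilon> M \<and> (\<forall>i. graded_projective A (P i))"

text \<open>The infimum of the empty set is \<open>\<infinity>\<close>.\<close>

definition proj_dim :: "'a gring \<Rightarrow> ('a, 'a univ) gmodule \<Rightarrow> enat" where
  "proj_dim A M = Inf {enat n | n. \<exists>P \<delta> \<epsilon>. graded_projective_resolution A P \<delta> \<epsilon> M \<and>
     (\<forall>i > n. carrier (P i) = {\<zero>\<^bsub>P i\<^esub>})}"

definition gl_dim :: "'a gring \<Rightarrow> enat" where
  "gl_dim A = (SUP M \<in> {M :: ('a, 'a univ) gmodule. graded_left_module A M}. proj_dim A M)"

section \<open>Gelfand-Kirillov dimension\<close>

text \<open>\<open>word_span K A V n\<close> is \<open>K + V + V\<^sup>2 + \<dots> + V\<^sup>n\<close>.\<close>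

definition word_span :: "'a set \<Rightarrow> 'a gring \<Rightarrow> 'a set \<Rightarrow> nat \<Rightarrow> 'a set" where
  "word_span K A V n = {x. \<exists>Us. x \<in> ring.Span A K Us \<and>
     set Us \<subseteq> {foldr (mult A) w \<one>\<^bsub>A\<^esub> | w. set w \<subseteq> V \<and> length w \<le> n}}"

definition gk_dim :: "'a set \<Rightarrow> 'a gring \<Rightarrow> ereal" where
  "gk_dim K A = (SUP V \<in> {V. V \<subseteq> carrier A \<and> ring.finite_dimension A K V}.
     limsup (\<lambda>n. ereal (log (real n) (real (ring.dim A K (word_span K A V n))))))"

section \<open>Ext groups with values in the algebra\<close>

text \<open>
  The graded right module of sums of homogeneous left module homomorphisms from \<open>P\<close> to \<open>A\<close>
  of arbitrary degrees.
\<close>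

definition dual_grade :: "'a gring \<Rightarrow> ('a, 'p) gmodule \<Rightarrow> int \<Rightarrow> ('p \<Rightarrow> 'a) set" where
  "dual_grade A P n = gmod_hom A P (shift (regular_module A) n) \<inter> extensional (carrier P)"

definition dual_module :: "'a gring \<Rightarrow> ('a, 'p) gmodule \<Rightarrow> ('a, 'p \<Rightarrow> 'a) gmodule" where
  "dual_module A P = \<lparr>
     carrier = {h. \<exists>J g. finite J \<and> (\<forall>n \<in> J. g n \<in> dual_grade A P n) \<and>
        h = (\<lambda>p \<in> carrier P. \<Oplus>\<^bsub>A\<^esub>n \<in> J. g n p)},
     mult = undefined, one = undefined,
     zero = (\<lambda>p \<in> carrier P. \<zero>\<^bsub>A\<^esub>),
     add = (\<lambda>g h. \<lambda>p \<in> carrier P. g p \<oplus>\<^bsub>A\<^esub> h p),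
     smult = (\<lambda>a h. \<lambda>p \<in> carrier P. h p \<otimes>\<^bsub>A\<^esub> a),
     grade = dual_grade A P \<rparr>"

definition dual_map ::
  "(nat \<Rightarrow> ('a, 'p) gmodule) \<Rightarrow> (nat \<Rightarrow> 'p \<Rightarrow> 'p) \<Rightarrow> nat \<Rightarrow> ('p \<Rightarrow> 'a) \<Rightarrow> ('p \<Rightarrow> 'a)" where
  "dual_map P \<delta> i h = (\<lambda>p \<in> carrier (P (Suc i)). h (\<delta> (Suc i) p))"

text \<open>
  The cohomology in degree \<open>i\<close> of the dual of a complex \<open>P\<close>, a graded module over the opposite
  ring; it is the \<open>i\<close>-th Ext of \<open>M\<close> with values in \<open>A\<close> if \<open>P\<close> is a projective resolution of \<open>M\<close>.
\<close>

definition dual_cohomology ::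
  "'a gring \<Rightarrow> (nat \<Rightarrow> ('a, 'p) gmodule) \<Rightarrow> (nat \<Rightarrow> 'p \<Rightarrow> 'p) \<Rightarrow> nat \<Rightarrow> ('a, ('p \<Rightarrow> 'a) set) gmodule"
  where
  "dual_cohomology A P \<delta> i = quot_gmodule
     (sub_gmodule (dual_module A (P i))
        {h \<in> carrier (dual_module A (P i)). dual_map P \<delta> i h = \<zero>\<^bsub>dual_module A (P (Suc i))\<^esub>})
     (case i of 0 \<Rightarrow> {\<zero>\<^bsub>dual_module A (P 0)\<^esub>}
      | Suc j \<Rightarrow> dual_map P \<delta> j ` carrier (dual_module A (P j)))"

definition artin_schelter_gorenstein :: "'a gring \<Rightarrow> nat \<Rightarrow> bool" where
  "artin_schelter_gorenstein A d \<longleftrightarrow>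
     (\<exists>P \<delta> \<epsilon>. graded_projective_resolution A P \<delta> \<epsilon> (trivial_module A) \<and>
        (\<forall>i. i \<noteq> d \<longrightarrow>
           carrier (dual_cohomology A P \<delta> i) = {\<zero>\<^bsub>dual_cohomology A P \<delta> i\<^esub>}) \<and>
        (\<exists>l. gmod_isomorphic (op_gring A) (dual_cohomology A P \<delta> d)
           (shift (trivial_module (op_gring A)) l)))"

definition artin_schelter_regular :: "'a set \<Rightarrow> 'a gring \<Rightarrow> nat \<Rightarrow> bool" where
  "artin_schelter_regular K A d \<longleftrightarrow> connected_graded_algebra K A \<and>
     gl_dim A = enat d \<and> gk_dim K A = ereal (real d) \<and> artin_schelter_gorenstein A d"

section \<open>Twisted matrix factorizations\<close>

definition regular_element :: "'a gring \<Rightarrow> 'a \<Rightarrow> bool" where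
  "regular_element A f \<longleftrightarrow> f \<in> carrier A \<and>
     (\<forall>a \<in> carrier A. (f \<otimes>\<^bsub>A\<^esub> a = \<zero>\<^bsub>A\<^esub> \<longrightarrow> a = \<zero>\<^bsub>A\<^esub>) \<and> (a \<otimes>\<^bsub>A\<^esub> f = \<zero>\<^bsub>A\<^esub> \<longrightarrow> a = \<zero>\<^bsub>A\<^esub>))"

definition normal_element :: "'a gring \<Rightarrow> 'a \<Rightarrow> bool" where
  "normal_element A f \<longleftrightarrow> f \<in> carrier A \<and> f <#\<^bsub>A\<^esub> carrier A = carrier A #>\<^bsub>A\<^esub> f"

text \<open>The next two are well defined for a nonzero homogeneous, respectively normal regular, element.\<close>

definition hdeg :: "'a gring \<Rightarrow> 'a \<Rightarrow> int" where
  "hdeg A f = (THE n. f \<in> rgrade A n)"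

definition normalizing_aut :: "'a gring \<Rightarrow> 'a \<Rightarrow> 'a \<Rightarrow> 'a" where
  "normalizing_aut A f a = (THE b. b \<in> carrier A \<and> a \<otimes>\<^bsub>A\<^esub> f = f \<otimes>\<^bsub>A\<^esub> b)"

definition twist :: "'a gring \<Rightarrow> 'a \<Rightarrow> ('a, 'm) gmodule \<Rightarrow> ('a, 'm) gmodule" where
  "twist A f M =
     shift (M \<lparr> smult := \<lambda>a x. normalizing_aut A f a \<odot>\<^bsub>M\<^esub> x \<rparr>) (- hdeg A f)"

record ('a, 'm) factorization =
  fac_F :: "('a, 'm) gmodule"
  fac_G :: "('a, 'm) gmodule"
  fac_phi :: "'m \<Rightarrow> 'm"
  fac_tau :: "'m \<Rightarrow> 'm"

definition twisted_matrix_factorization :: "'a gring \<Rightarrow> 'a \<Rightarrow> ('a, 'm) factorization \<Rightarrow> bool" where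
  "twisted_matrix_factorization A f X \<longleftrightarrow>
     graded_free A (fac_F X) \<and> finitely_generated A (fac_F X) \<and>
     graded_free A (fac_G X) \<and> finitely_generated A (fac_G X) \<and>
     fac_phi X \<in> gmod_hom A (fac_F X) (fac_G X) \<and>
     fac_tau X \<in> gmod_hom A (twist A f (fac_G X)) (fac_F X) \<and>
     (\<forall>y \<in> carrier (fac_G X). fac_phi X (fac_tau X y) = f \<odot>\<^bsub>fac_G X\<^esub> y) \<and>
     (\<forall>x \<in> carrier (fac_F X). fac_tau X (fac_phi X x) = f \<odot>\<^bsub>fac_F X\<^esub> x)"

definition factorization_isomorphic ::
  "'a gring \<Rightarrow> ('a, 'm) factorization \<Rightarrow> ('a, 'n) factorization \<Rightarrow> bool" where
  "factorization_isomorphic A X Y \<longleftrightarrow>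
     (\<exists>\<Psi>G \<in> gmod_iso A (fac_G X) (fac_G Y). \<exists>\<Psi>F \<in> gmod_iso A (fac_F X) (fac_F Y).
        \<forall>x \<in> carrier (fac_F X). \<Psi>G (fac_phi X x) = fac_phi Y (\<Psi>F x))"

definition sum_factorization ::
  "('a, 'm) factorization \<Rightarrow> ('a, 'n) factorization \<Rightarrow> ('a, 'm \<times> 'n) factorization" where
  "sum_factorization X Y = \<lparr>
     fac_F = sum_gmodule (fac_F X) (fac_F Y), fac_G = sum_gmodule (fac_G X) (fac_G Y),
     fac_phi = map_prod (fac_phi X) (fac_phi Y), fac_tau = map_prod (fac_tau X) (fac_tau Y) \<rparr>"

definition trivial_factorization :: "'a gring \<Rightarrow> 'a \<Rightarrow> ('a, 'a) factorization \<Rightarrow> bool" where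
  "trivial_factorization A f X \<longleftrightarrow> twisted_matrix_factorization A f X \<and>
     (\<exists>n. let R = shift (regular_module A) n in
        (fac_F X = twist A f R \<and> fac_G X = R \<and> (\<forall>x \<in> carrier R. fac_phi X x = f \<odot>\<^bsub>R\<^esub> x)) \<or>
        (fac_F X = R \<and> fac_G X = R \<and> (\<forall>x \<in> carrier R. fac_tau X x = f \<odot>\<^bsub>R\<^esub> x)))"

text \<open>
  The type of the complement \<open>Y\<close> is no restriction: every finitely generated graded free
  \<open>A\<close>-module is isomorphic to one with elements in \<open>nat \<Rightarrow> 'a\<close>.
\<close>

definition reduced_factorization :: "'a gring \<Rightarrow> 'a \<Rightarrow> ('a, 'm) factorization \<Rightarrow> bool" where
  "reduced_factorization A f X \<longleftrightarrow> twisted_matrix_factorization A f X \<and>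
     \<not> (\<exists>(Y :: ('a, nat \<Rightarrow> 'a) factorization) T.
          twisted_matrix_factorization A f Y \<and> trivial_factorization A f T \<and>
          factorization_isomorphic A X (sum_factorization Y T))"

definition coker :: "('a, 'm) factorization \<Rightarrow> ('a, 'm set) gmodule" where
  "coker X = quot_gmodule (fac_G X) (fac_phi X ` carrier (fac_F X))"

text \<open>
  The action of a quotient ring, whose elements are cosets, on an \<open>A\<close>-module that is annihilated
  by the ideal: all elements of a coset act in the same way.
\<close>

definition induced_module :: "('a, 'm) gmodule \<Rightarrow> ('a set, 'm) gmodule" where
  "induced_module M = \<lparr> carrier = carrier M, mult = undefined, one = undefined,
     zero = \<zero>\<^bsub>M\<^esub>, add = add M,
     smult = (\<lambda>b x. THE y. \<exists>a \<in> b. y = a \<odot>\<^bsub>M\<^esub> x),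
     grade = grade M \<rparr>"

end

theory Submission
  imports Defs
begin

text \<open>
  Write \<open>Q i = G i / f G i\<close> with \<open>G i\<close> free over \<open>A\<close>, of finite rank because \<open>A\<close> is noetherian and the
  resolution is minimal, and let \<open>F i \<subseteq> G i\<close> be the preimage of the kernel of \<open>Q i \<rightarrow> Q (i - 1)\<close>, with
  \<open>M\<close> in place of \<open>Q (-1)\<close>. Then \<open>f G i \<subseteq> F i\<close>, and the inclusion of \<open>F i\<close> together with multiplication
  by \<open>f\<close> is a factorization with cokernel the \<open>i\<close>-th syzygy as soon as \<open>F i\<close> is free. The sequences
  \<open>0 \<rightarrow> F 0 \<rightarrow> G 0 \<rightarrow> M \<rightarrow> 0\<close> and \<open>0 \<rightarrow> F (i + 1) \<rightarrow> G (i + 1) \<oplus> G i \<rightarrow> F i \<rightarrow> 0\<close> show that \<open>F i\<close> is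
  the \<open>(i + 1)\<close>-st syzygy of \<open>M\<close> over \<open>A\<close>, so \<open>F d\<close> and \<open>F (d + 1)\<close> are projective, hence free, as the
  global dimension is \<open>d\<close>.

  A summand \<open>(id, f)\<close> of the factorization for \<open>i = d + 1\<close> is excluded because minimality of the
  resolution puts \<open>F (d + 1)\<close> into \<open>A\<^sub>+ G (d + 1)\<close>. A summand \<open>(f, id)\<close> gives a surjection from the
  syzygy \<open>G (d + 1) / F (d + 1) \<subseteq> Q d\<close> onto a shift of \<open>B\<close>. It extends to \<open>Q d\<close> since \<open>F d\<close> is
  projective, which contradicts minimality. Of the regularity of \<open>A\<close>, only the global dimension matters.
\<close>

section \<open>Graded abelian groups\<close>

text \<open>Multiplication by f on a left module is not linear, so the map from \<open>G i\<close>
  to \<open>F i\<close> in the second sequence needs another form. The \<open>G i\<close> consist of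
  coordinate vectors, and every coordinate is multiplied by f from the right: this is left linear
  and injective, raises degrees by deg f, and has image \<open>f G i\<close> because fA = Af.
  Division by f on the right then identifies the kernel of the cover with \<open>F (i + 1)\<close>,
  and the twist appears only in the factorization itself. The two sequences make \<open>F i\<close>
  a syzygy in one particular resolution of M, while the global dimension provides some other, short
  projective resolution P. The two are compared by maps in both directions and a homotopy on one
  side, carried from syzygy to syzygy. Where P vanishes, the homotopy is a section of the free cover
  of \<open>F i\<close>; as \<open>F i\<close> is the (i + 1)-st syzygy, this holds for i \<ge> d.
  Projectivity and global dimension are tested on modules with elements in \<open>'a univ\<close>,
  so M and the free modules have to be embedded there. The bases of the \<open>Q i\<close> are not
  finite by definition; their finiteness has to be derived degree by degree.\<close>

lemma add_hom_closed:
  "h \<in> hom (add_monoid M) (add_monoid N) \<Longrightarrow> x \<in> carrier M \<Longrightarrow> h x \<in> carrier N"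
  by (auto simp: hom_def)

lemma add_hom_add:
  "h \<in> hom (add_monoid M) (add_monoid N) \<Longrightarrow> x \<in> carrier M \<Longrightarrow> y \<in> carrier M \<Longrightarrow>
    h (x \<oplus>\<^bsub>M\<^esub> y) = h x \<oplus>\<^bsub>N\<^esub> h y"
  by (auto simp: hom_def)

lemma add_hom_zero:
  assumes "abelian_group M" "abelian_group N" "h \<in> hom (add_monoid M) (add_monoid N)"
  shows "h \<zero>\<^bsub>M\<^esub> = \<zero>\<^bsub>N\<^esub>"
proof -
  interpret group_hom "add_monoid M" "add_monoid N" h
    using assms by (simp add: abelian_group.a_group group_hom_axioms_def group_hom_def)
  show ?thesis using hom_one by simp
qed

lemma add_hom_a_inv:
  assumes "abelian_group M" "abelian_group N" "h \<in> hom (add_monoid M) (add_monoid N)"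
    and "x \<in> carrier M"
  shows "h (\<ominus>\<^bsub>M\<^esub> x) = \<ominus>\<^bsub>N\<^esub> h x"
proof -
  interpret group_hom "add_monoid M" "add_monoid N" h
    using assms by (simp add: abelian_group.a_group group_hom_axioms_def group_hom_def)
  show ?thesis using hom_inv[of x] assms(4) by (simp add: a_inv_def)
qed

lemma add_hom_minus:
  assumes "abelian_group M" "abelian_group N" "h \<in> hom (add_monoid M) (add_monoid N)"
    and "x \<in> carrier M" "y \<in> carrier M"
  shows "h (x \<ominus>\<^bsub>M\<^esub> y) = h x \<ominus>\<^bsub>N\<^esub> h y"
  using assms by (simp add: a_minus_def add_hom_add add_hom_a_inv abelian_group.a_inv_closed)

lemma add_hom_finsum:
  assumes M: "abelian_group M" and N: "abelian_group N"
    and h: "h \<in> hom (add_monoid M) (add_monoid N)"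
    and "finite J" "\<And>i. i \<in> J \<Longrightarrow> c i \<in> carrier M"
  shows "h (\<Oplus>\<^bsub>M\<^esub>i\<in>J. c i) = (\<Oplus>\<^bsub>N\<^esub>i\<in>J. h (c i))"
  using assms(4,5)
proof (induction J rule: finite_induct)
  case empty
  interpret M: abelian_group M by fact
  interpret N: abelian_group N by fact
  show ?case by (simp add: add_hom_zero[OF M N h])
next
  case (insert i J)
  interpret M: abelian_group M by fact
  interpret N: abelian_group N by fact
  have c: "c \<in> J \<rightarrow> carrier M" "c i \<in> carrier M" using insert by auto
  then have "(\<lambda>i. h (c i)) \<in> J \<rightarrow> carrier N" "h (c i) \<in> carrier N"
    using add_hom_closed[OF h] by auto
  then show ?case using insert c by (simp add: add_hom_add[OF h])
qed

context abelian_group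
begin

lemma finsum_supp:
  assumes "finite J" "\<And>i. i \<in> J \<Longrightarrow> c i \<in> carrier G" "\<And>i. i \<notin> J \<Longrightarrow> c i = \<zero>"
  shows "(\<Oplus>i\<in>{i. c i \<noteq> \<zero>}. c i) = (\<Oplus>i\<in>J. c i)"
  by (rule add.finprod_mono_neutral_cong_left) (use assms in auto)

lemma finsum_neutral:
  assumes "finite J" "L \<subseteq> J" "\<And>i. i \<in> L \<Longrightarrow> c i \<in> carrier G" "\<And>i. i \<in> J - L \<Longrightarrow> c i = \<zero>"
  shows "(\<Oplus>i\<in>L. c i) = (\<Oplus>i\<in>J. c i)"
proof (rule add.finprod_mono_neutral_cong_left)
  show "c \<in> J \<rightarrow> carrier G"
  proof
    fix i assume "i \<in> J" then show "c i \<in> carrier G"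
      using assms(3,4)[of i] by (cases "i \<in> L") auto
  qed
qed (use assms in auto)

lemma finsum_single:
  assumes "finite J" "i \<in> J" "c i \<in> carrier G" "\<And>k. k \<in> J \<Longrightarrow> k \<noteq> i \<Longrightarrow> c k = \<zero>"
  shows "(\<Oplus>k\<in>J. c k) = c i"
proof -
  have "(\<Oplus>k\<in>J. c k) = (\<Oplus>k\<in>{i}. c k)"
    by (rule finsum_neutral[symmetric]) (use assms in auto)
  then show ?thesis using assms by simp
qed

lemma finsum_zero':
  assumes "\<And>k. k \<in> J \<Longrightarrow> c k = \<zero>"
  shows "(\<Oplus>k\<in>J. c k) = \<zero>"
proof -
  have "(\<Oplus>k\<in>J. c k) = (\<Oplus>k\<in>J. \<zero>)" by (rule finsum_cong') (use assms in auto)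
  then show ?thesis by simp
qed

lemma minus_zero_iff: "x \<in> carrier G \<Longrightarrow> y \<in> carrier G \<Longrightarrow> x \<ominus> y = \<zero> \<longleftrightarrow> x = y"
  by (simp add: a_minus_def) (metis add.inv_closed add.inv_inv minus_equality r_neg)

lemma minus_zero_right: "x \<in> carrier G \<Longrightarrow> x \<ominus> \<zero> = x"
  by (simp add: a_minus_def)

lemma minus_add_cancel: "x \<in> carrier G \<Longrightarrow> y \<in> carrier G \<Longrightarrow> x \<ominus> y \<oplus> y = x"
  by (simp add: a_minus_def a_assoc l_neg)

lemma minus_eq_iff:
  "x \<in> carrier G \<Longrightarrow> y \<in> carrier G \<Longrightarrow> z \<in> carrier G \<Longrightarrow> x \<ominus> y = z \<longleftrightarrow> x = z \<oplus> y"
  by (metis a_minus_def add.inv_solve_right add.m_comm minus_add_cancel minus_closed)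

end

text \<open>\<open>direct_grading\<close> only asserts that a unique family of components exists;
  naming it makes the components available as functions of the element, which turn out to be
  additive.\<close>

definition hcomp :: "('m, 'x) ring_scheme \<Rightarrow> (int \<Rightarrow> 'm set) \<Rightarrow> 'm \<Rightarrow> int \<Rightarrow> 'm" where
  "hcomp M g m = (THE c. (\<forall>i. c i \<in> g i) \<and> finite {i. c i \<noteq> \<zero>\<^bsub>M\<^esub>} \<and>
     m = (\<Oplus>\<^bsub>M\<^esub>i \<in> {i. c i \<noteq> \<zero>\<^bsub>M\<^esub>}. c i))"

locale graded_group = abelian_group M for M :: "('m, 'x) ring_scheme" (structure) and g :: "int \<Rightarrow> 'm set" +
  assumes dg: "direct_grading M g"
begin

lemma hcomp_props:
  assumes "m \<in> carrier M"
  shows hcomp_grade: "hcomp M g m i \<in> g i"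
    and hcomp_finite: "finite {i. hcomp M g m i \<noteq> \<zero>}"
    and hcomp_sum: "(\<Oplus>i \<in> {i. hcomp M g m i \<noteq> \<zero>}. hcomp M g m i) = m"
proof -
  have "\<exists>!c. (\<forall>i. c i \<in> g i) \<and> finite {i. c i \<noteq> \<zero>} \<and> m = (\<Oplus>i \<in> {i. c i \<noteq> \<zero>}. c i)"
    using dg assms unfolding direct_grading_def by blast
  from theI'[OF this, folded hcomp_def]
  show "hcomp M g m i \<in> g i" "finite {i. hcomp M g m i \<noteq> \<zero>}"
    "(\<Oplus>i \<in> {i. hcomp M g m i \<noteq> \<zero>}. hcomp M g m i) = m" by auto
qed

lemma g_subgroup: "additive_subgroup (g i) M"
  using dg unfolding direct_grading_def by blast

lemma g_carrier: "x \<in> g i \<Longrightarrow> x \<in> carrier M"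
  using additive_subgroup.a_subset[OF g_subgroup] by blast

lemma g_zero [simp]: "\<zero> \<in> g i"
  using additive_subgroup.zero_closed[OF g_subgroup] .

lemma g_add: "x \<in> g i \<Longrightarrow> y \<in> g i \<Longrightarrow> x \<oplus> y \<in> g i"
  using additive_subgroup.a_closed[OF g_subgroup] .

lemma g_inv: "x \<in> g i \<Longrightarrow> \<ominus> x \<in> g i"
  using additive_subgroup.a_inv_closed[OF g_subgroup] g_carrier
  by (metis (no_types, lifting) abelian_group_axioms)

lemma g_finsum: "(\<And>k. k \<in> J \<Longrightarrow> c k \<in> g i) \<Longrightarrow> (\<Oplus>k\<in>J. c k) \<in> g i"
proof (induction J rule: infinite_finite_induct)
  case (insert k J)
  then have "c \<in> J \<rightarrow> carrier M" "c k \<in> carrier M" using g_carrier by blast+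
  with insert show ?case by (simp add: g_add)
qed (auto simp: finsum_infinite)

lemma hcomp_carrier [simp]: "m \<in> carrier M \<Longrightarrow> hcomp M g m i \<in> carrier M"
  using hcomp_grade g_carrier by blast

lemma hcomp_unique:
  assumes J: "finite J" and c: "\<And>i. i \<in> J \<Longrightarrow> c i \<in> g i" and m: "m = (\<Oplus>i\<in>J. c i)"
  shows "hcomp M g m i = (if i \<in> J then c i else \<zero>)"
proof -
  let ?c = "\<lambda>i. if i \<in> J then c i else \<zero>"
  have mc: "m \<in> carrier M" using m c g_carrier by (auto intro!: finsum_closed)
  have ex: "\<exists>!c. (\<forall>i. c i \<in> g i) \<and> finite {i. c i \<noteq> \<zero>} \<and> m = (\<Oplus>i \<in> {i. c i \<noteq> \<zero>}. c i)"
    using dg mc unfolding direct_grading_def by blast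
  have fin: "finite {i. ?c i \<noteq> \<zero>}" by (rule finite_subset[OF _ J]) auto
  have "(\<Oplus>i \<in> {i. ?c i \<noteq> \<zero>}. ?c i) = (\<Oplus>i\<in>J. ?c i)"
    by (rule finsum_supp) (use J c g_carrier in auto)
  also have "\<dots> = (\<Oplus>i\<in>J. c i)"
    by (rule finsum_cong') (use c g_carrier in auto)
  finally have "(\<forall>i. ?c i \<in> g i) \<and> finite {i. ?c i \<noteq> \<zero>} \<and> m = (\<Oplus>i \<in> {i. ?c i \<noteq> \<zero>}. ?c i)"
    using fin c m by auto
  then have "hcomp M g m = ?c"
    unfolding hcomp_def by (rule the1_equality[OF ex])
  then show ?thesis by simp
qed

lemma hcomp_homogeneous: "x \<in> g j \<Longrightarrow> hcomp M g x i = (if i = j then x else \<zero>)"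
  using hcomp_unique[of "{j}" "\<lambda>_. x" x i] g_carrier by auto

lemma hcomp_sum_superset:
  assumes m: "m \<in> carrier M" and J: "finite J" "\<And>i. i \<notin> J \<Longrightarrow> hcomp M g m i = \<zero>"
  shows "(\<Oplus>i\<in>J. hcomp M g m i) = m"
  using finsum_supp[of J "hcomp M g m"] J hcomp_sum[OF m] m by auto

end

text \<open>Applying \<open>h\<close> to the decomposition of \<open>x\<close> gives a decomposition
  of \<open>h x\<close>, and decompositions are unique. The shift \<open>k\<close> covers maps that
  are not of degree 0: coordinates of free modules (\<open>- e i\<close>) and right multiplication
  by f (\<open>n\<close>).\<close>

lemma hcomp_hom:
  assumes M: "graded_group M g" and N: "graded_group N g'"
    and h: "h \<in> hom (add_monoid M) (add_monoid N)"
    and gr: "\<And>i x. x \<in> g i \<Longrightarrow> h x \<in> g' (i + k)"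
    and x: "x \<in> carrier M"
  shows "hcomp N g' (h x) (i + k) = h (hcomp M g x i)"
proof -
  interpret M: graded_group M g by fact
  interpret N: graded_group N g' by fact
  let ?S = "{i. hcomp M g x i \<noteq> \<zero>\<^bsub>M\<^esub>}"
  have "h x = h (\<Oplus>\<^bsub>M\<^esub>i\<in>?S. hcomp M g x i)"
    using M.hcomp_sum[OF x] by simp
  also have "\<dots> = (\<Oplus>\<^bsub>N\<^esub>i\<in>?S. h (hcomp M g x i))"
    by (rule add_hom_finsum)
      (use h M.abelian_group_axioms N.abelian_group_axioms M.hcomp_finite x in auto)
  also have "\<dots> = (\<Oplus>\<^bsub>N\<^esub>j\<in>(\<lambda>i. i + k) ` ?S. h (hcomp M g x (j - k)))"
    by (subst N.finsum_reindex) (auto intro!: add_hom_closed[OF h] simp: x inj_on_def)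
  finally have eq: "h x = (\<Oplus>\<^bsub>N\<^esub>j\<in>(\<lambda>i. i + k) ` ?S. h (hcomp M g x (j - k)))" .
  have "hcomp N g' (h x) (i + k) =
      (if i + k \<in> (\<lambda>i. i + k) ` ?S then h (hcomp M g x (i + k - k)) else \<zero>\<^bsub>N\<^esub>)"
  proof (rule N.hcomp_unique[OF _ _ eq])
    show "finite ((\<lambda>i. i + k) ` ?S)" using M.hcomp_finite[OF x] by simp
    fix j assume "j \<in> (\<lambda>i. i + k) ` ?S"
    show "h (hcomp M g x (j - k)) \<in> g' j"
      using gr[OF M.hcomp_grade[OF x], of "j - k"] by simp
  qed
  then show ?thesis
    using add_hom_zero[OF M.abelian_group_axioms N.abelian_group_axioms h] by (auto simp: image_iff)
qed

lemma (in graded_group) hcomp_add: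
  assumes "x \<in> carrier M" "y \<in> carrier M"
  shows "hcomp M g (x \<oplus> y) i = hcomp M g x i \<oplus> hcomp M g y i"
proof -
  let ?J = "{i. hcomp M g x i \<noteq> \<zero>} \<union> {i. hcomp M g y i \<noteq> \<zero>}"
  have J: "finite ?J" using hcomp_finite assms by blast
  have "x = (\<Oplus>i\<in>?J. hcomp M g x i)" "y = (\<Oplus>i\<in>?J. hcomp M g y i)"
    by (rule hcomp_sum_superset[symmetric]; use assms J in auto)+
  then have eq: "x \<oplus> y = (\<Oplus>i\<in>?J. hcomp M g x i \<oplus> hcomp M g y i)"
    using assms by (subst finsum_addf) auto
  have "hcomp M g (x \<oplus> y) i = (if i \<in> ?J then hcomp M g x i \<oplus> hcomp M g y i else \<zero>)"
    by (rule hcomp_unique[OF J _ eq]) (use assms hcomp_grade g_add in auto)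
  then show ?thesis by auto
qed

lemma (in graded_group) hcomp_add_hom:
  "(\<lambda>x. hcomp M g x i) \<in> hom (add_monoid M) (add_monoid M)"
  by (auto simp: hom_def hcomp_add)

text \<open>An additive map that fixes degree i and kills the other degrees extracts the i-th
  summand from every decomposition. So projections give uniqueness, and only the existence of a
  decomposition remains to be shown.\<close>

lemma direct_gradingI:
  assumes "abelian_group M" and sub: "\<And>i. additive_subgroup (g i) M"
    and pr: "\<And>i. (\<lambda>x. pr x i) \<in> hom (add_monoid M) (add_monoid M)"
    and homog: "\<And>i j x. x \<in> g j \<Longrightarrow> pr x i = (if i = j then x else \<zero>\<^bsub>M\<^esub>)"
    and ex: "\<And>m. m \<in> carrier M \<Longrightarrow> \<exists>J c. finite J \<and> (\<forall>i\<in>J. c i \<in> g i) \<and> m = (\<Oplus>\<^bsub>M\<^esub>i\<in>J. c i)"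
  shows "direct_grading M g"
  unfolding direct_grading_def
proof (intro conjI allI ballI sub)
  interpret abelian_group M by fact
  have gc: "x \<in> g i \<Longrightarrow> x \<in> carrier M" for x i
    using additive_subgroup.a_subset[OF sub] by blast
  fix m assume "m \<in> carrier M"
  from ex[OF this] obtain J c where J: "finite J" "\<forall>i\<in>J. c i \<in> g i" "m = (\<Oplus>\<^bsub>M\<^esub>i\<in>J. c i)" by blast
  let ?c = "\<lambda>i. if i \<in> J then c i else \<zero>\<^bsub>M\<^esub>"
  have "(\<Oplus>\<^bsub>M\<^esub>i \<in> {i. ?c i \<noteq> \<zero>\<^bsub>M\<^esub>}. ?c i) = (\<Oplus>\<^bsub>M\<^esub>i\<in>J. ?c i)"
    by (rule finsum_supp) (use J gc in auto)
  also have "\<dots> = (\<Oplus>\<^bsub>M\<^esub>i\<in>J. c i)"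
    by (rule finsum_cong') (use J gc in auto)
  finally have m: "m = (\<Oplus>\<^bsub>M\<^esub>i \<in> {i. ?c i \<noteq> \<zero>\<^bsub>M\<^esub>}. ?c i)" using J by simp
  have fin: "finite {i. ?c i \<noteq> \<zero>\<^bsub>M\<^esub>}" by (rule finite_subset[OF _ J(1)]) auto
  show "\<exists>!c. (\<forall>i. c i \<in> g i) \<and> finite {i. c i \<noteq> \<zero>\<^bsub>M\<^esub>} \<and> m = (\<Oplus>\<^bsub>M\<^esub>i \<in> {i. c i \<noteq> \<zero>\<^bsub>M\<^esub>}. c i)"
  proof (rule ex1I[of _ ?c])
    show "(\<forall>i. ?c i \<in> g i) \<and> finite {i. ?c i \<noteq> \<zero>\<^bsub>M\<^esub>} \<and> m = (\<Oplus>\<^bsub>M\<^esub>i \<in> {i. ?c i \<noteq> \<zero>\<^bsub>M\<^esub>}. ?c i)"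
      using m fin J additive_subgroup.zero_closed[OF sub] by auto
    have c'': "c' i = pr m i" if c': "(\<forall>i. c' i \<in> g i) \<and> finite {i. c' i \<noteq> \<zero>\<^bsub>M\<^esub>} \<and>
        m = (\<Oplus>\<^bsub>M\<^esub>i \<in> {i. c' i \<noteq> \<zero>\<^bsub>M\<^esub>}. c' i)" for c' i
    proof -
      let ?S = "{i. c' i \<noteq> \<zero>\<^bsub>M\<^esub>}"
      have c'c: "c' k \<in> carrier M" for k using c' gc by blast
      have "pr m i = (\<Oplus>\<^bsub>M\<^esub>k\<in>?S. pr (c' k) i)"
        using add_hom_finsum[OF abelian_group_axioms abelian_group_axioms pr, of ?S c' i] c' gc by metis
      also have "\<dots> = (\<Oplus>\<^bsub>M\<^esub>k\<in>?S. if i = k then c' k else \<zero>\<^bsub>M\<^esub>)"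
        by (rule finsum_cong') (use c' homog c'c in auto)
      also have "\<dots> = c' i"
      proof (cases "i \<in> ?S")
        case True then show ?thesis
          by (subst finsum_single[of _ i]) (use c' gc[of "c' i" i] in auto)
      next
        case False
        then have "(\<Oplus>\<^bsub>M\<^esub>k\<in>?S. if i = k then c' k else \<zero>\<^bsub>M\<^esub>) = \<zero>\<^bsub>M\<^esub>"
          by (intro finsum_zero') auto
        with False show ?thesis by simp
      qed
      finally show ?thesis by simp
    qed
    fix c' assume "(\<forall>i. c' i \<in> g i) \<and> finite {i. c' i \<noteq> \<zero>\<^bsub>M\<^esub>} \<and>
        m = (\<Oplus>\<^bsub>M\<^esub>i \<in> {i. c' i \<noteq> \<zero>\<^bsub>M\<^esub>}. c' i)"
    note 1 = c''[OF this]
    have "?c i = pr m i" for i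
      by (rule c'') (use m fin J additive_subgroup.zero_closed[OF sub] in auto)
    with 1 show "c' = ?c" by metis
  qed
qed

section \<open>Graded modules\<close>

lemma gmod_homD:
  assumes "h \<in> gmod_hom A M N"
  shows gmod_hom_hom: "h \<in> hom (add_monoid M) (add_monoid N)"
    and gmod_hom_closed: "x \<in> carrier M \<Longrightarrow> h x \<in> carrier N"
    and gmod_hom_add: "x \<in> carrier M \<Longrightarrow> y \<in> carrier M \<Longrightarrow> h (x \<oplus>\<^bsub>M\<^esub> y) = h x \<oplus>\<^bsub>N\<^esub> h y"
    and gmod_hom_smult: "a \<in> carrier A \<Longrightarrow> x \<in> carrier M \<Longrightarrow> h (a \<odot>\<^bsub>M\<^esub> x) = a \<odot>\<^bsub>N\<^esub> h x"
    and gmod_hom_grade: "x \<in> grade M i \<Longrightarrow> h x \<in> grade N i"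
proof -
  have *: "h \<in> hom (add_monoid M) (add_monoid N)"
    "\<And>a x. a \<in> carrier A \<Longrightarrow> x \<in> carrier M \<Longrightarrow> h (a \<odot>\<^bsub>M\<^esub> x) = a \<odot>\<^bsub>N\<^esub> h x"
    "\<And>i. h ` grade M i \<subseteq> grade N i"
    using assms by (simp_all add: gmod_hom_def)
  show "h \<in> hom (add_monoid M) (add_monoid N)" by fact
  show "x \<in> carrier M \<Longrightarrow> h x \<in> carrier N" by (rule add_hom_closed[OF *(1)])
  show "x \<in> carrier M \<Longrightarrow> y \<in> carrier M \<Longrightarrow> h (x \<oplus>\<^bsub>M\<^esub> y) = h x \<oplus>\<^bsub>N\<^esub> h y"
    by (rule add_hom_add[OF *(1)])
  show "a \<in> carrier A \<Longrightarrow> x \<in> carrier M \<Longrightarrow> h (a \<odot>\<^bsub>M\<^esub> x) = a \<odot>\<^bsub>N\<^esub> h x" by (rule *(2))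
  show "x \<in> grade M i \<Longrightarrow> h x \<in> grade N i" using *(3)[of i] by blast
qed

lemma gmod_homI:
  assumes "\<And>x. x \<in> carrier M \<Longrightarrow> h x \<in> carrier N"
    and "\<And>x y. x \<in> carrier M \<Longrightarrow> y \<in> carrier M \<Longrightarrow> h (x \<oplus>\<^bsub>M\<^esub> y) = h x \<oplus>\<^bsub>N\<^esub> h y"
    and "\<And>a x. a \<in> carrier A \<Longrightarrow> x \<in> carrier M \<Longrightarrow> h (a \<odot>\<^bsub>M\<^esub> x) = a \<odot>\<^bsub>N\<^esub> h x"
    and "\<And>x i. x \<in> grade M i \<Longrightarrow> h x \<in> grade N i"
  shows "h \<in> gmod_hom A M N"
  using assms by (auto simp: gmod_hom_def hom_def)

lemma gmod_hom_comp:
  assumes "h \<in> gmod_hom A M N" "k \<in> gmod_hom A N L"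
  shows "(\<lambda>x. k (h x)) \<in> gmod_hom A M L"
  by (rule gmod_homI)
    (use assms in \<open>auto simp: gmod_homD[OF assms(1)] gmod_homD[OF assms(2)]\<close>)

lemma gmod_hom_cong:
  assumes "h \<in> gmod_hom A M N" "\<And>x. x \<in> carrier M \<Longrightarrow> h x = k x"
    and "graded_left_module A M"
  shows "k \<in> gmod_hom A M N"
proof -
  interpret graded_left_module A M by fact
  have c: "x \<in> grade M i \<Longrightarrow> x \<in> carrier M" for x i
    using module_grading additive_subgroup.a_subset unfolding direct_grading_def by blast
  show ?thesis
    by (rule gmod_homI)
      (use c gmod_homD[OF assms(1)] in \<open>simp_all add: assms(2)[symmetric] smult_closed\<close>)
qed

sublocale graded_ring \<subseteq> G: graded_group A "rgrade A"
  by unfold_locales (rule grading)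

sublocale graded_left_module \<subseteq> GM: graded_group M "grade M"
  by unfold_locales (rule module_grading)

context left_module
begin

lemma smult_hom: "a \<in> carrier A \<Longrightarrow> (\<lambda>x. a \<odot>\<^bsub>M\<^esub> x) \<in> hom (add_monoid M) (add_monoid M)"
  by (auto simp: hom_def smult_closed smult_r_distr)

lemma scalar_hom: "x \<in> carrier M \<Longrightarrow> (\<lambda>a. a \<odot>\<^bsub>M\<^esub> x) \<in> hom (add_monoid A) (add_monoid M)"
  by (auto simp: hom_def smult_closed smult_l_distr)

lemma smult_zero: "a \<in> carrier A \<Longrightarrow> a \<odot>\<^bsub>M\<^esub> \<zero>\<^bsub>M\<^esub> = \<zero>\<^bsub>M\<^esub>"
  using add_hom_zero[OF M.abelian_group_axioms M.abelian_group_axioms smult_hom] .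

lemma zero_smult: "x \<in> carrier M \<Longrightarrow> \<zero>\<^bsub>A\<^esub> \<odot>\<^bsub>M\<^esub> x = \<zero>\<^bsub>M\<^esub>"
  using add_hom_zero[OF A.abelian_group_axioms M.abelian_group_axioms scalar_hom] .

lemma smult_minus: "a \<in> carrier A \<Longrightarrow> x \<in> carrier M \<Longrightarrow> y \<in> carrier M \<Longrightarrow>
    a \<odot>\<^bsub>M\<^esub> (x \<ominus>\<^bsub>M\<^esub> y) = a \<odot>\<^bsub>M\<^esub> x \<ominus>\<^bsub>M\<^esub> a \<odot>\<^bsub>M\<^esub> y"
  using add_hom_minus[OF M.abelian_group_axioms M.abelian_group_axioms smult_hom] .

lemma smult_finsum:
  "a \<in> carrier A \<Longrightarrow> finite J \<Longrightarrow> (\<And>i. i \<in> J \<Longrightarrow> c i \<in> carrier M) \<Longrightarrow>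
    a \<odot>\<^bsub>M\<^esub> (\<Oplus>\<^bsub>M\<^esub>i\<in>J. c i) = (\<Oplus>\<^bsub>M\<^esub>i\<in>J. a \<odot>\<^bsub>M\<^esub> c i)"
  using add_hom_finsum[OF M.abelian_group_axioms M.abelian_group_axioms smult_hom] .

end

lemma gmod_hom_ident: "(\<lambda>x. x) \<in> gmod_hom A M M"
  by (rule gmod_homI) simp_all

lemma gmod_hom_diff:
  assumes M: "graded_left_module A M" and N: "graded_left_module A N"
    and h: "h \<in> gmod_hom A M N" and k: "k \<in> gmod_hom A M N"
  shows "(\<lambda>x. h x \<ominus>\<^bsub>N\<^esub> k x) \<in> gmod_hom A M N"
proof -
  interpret M: graded_left_module A M by fact
  interpret N: graded_left_module A N by fact
  note c = gmod_hom_closed[OF h] gmod_hom_closed[OF k]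
  show ?thesis
  proof (rule gmod_homI)
    fix x y assume "x \<in> carrier M" "y \<in> carrier M"
    then show "h (x \<oplus>\<^bsub>M\<^esub> y) \<ominus>\<^bsub>N\<^esub> k (x \<oplus>\<^bsub>M\<^esub> y) = h x \<ominus>\<^bsub>N\<^esub> k x \<oplus>\<^bsub>N\<^esub> (h y \<ominus>\<^bsub>N\<^esub> k y)"
      by (simp add: gmod_hom_add[OF h] gmod_hom_add[OF k] c a_minus_def N.M.minus_add N.M.a_assoc N.M.a_lcomm)
  next
    fix x i assume "x \<in> grade M i"
    then show "h x \<ominus>\<^bsub>N\<^esub> k x \<in> grade N i"
      using gmod_hom_grade[OF h] gmod_hom_grade[OF k] by (simp add: a_minus_def N.GM.g_add N.GM.g_inv)
  qed (simp_all add: c gmod_hom_smult[OF h] gmod_hom_smult[OF k] N.smult_minus)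
qed

lemma gmod_hom_hcomp:
  assumes "graded_left_module A M" "graded_left_module A N" "h \<in> gmod_hom A M N" "x \<in> carrier M"
  shows "hcomp N (grade N) (h x) i = h (hcomp M (grade M) x i)"
proof -
  interpret M: graded_left_module A M by fact
  interpret N: graded_left_module A N by fact
  show ?thesis
    using hcomp_hom[OF M.GM.graded_group_axioms N.GM.graded_group_axioms
        gmod_hom_hom[OF assms(3)], of 0 x i] gmod_hom_grade[OF assms(3)] assms(4) by simp
qed

text \<open>Maps of degree 0 commute with taking components, so the degree i component of any
  preimage is again a preimage.\<close>

lemma gmod_hom_homogeneous_preimage:
  assumes "graded_left_module A X" "graded_left_module A Y" "h \<in> gmod_hom A X Y"
    and "y \<in> grade Y i" "y \<in> h ` carrier X"
  shows "\<exists>x\<in>grade X i. h x = y"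
proof -
  interpret X: graded_left_module A X by fact
  interpret Y: graded_left_module A Y by fact
  from assms obtain x where x: "x \<in> carrier X" "y = h x" by blast
  have "h (hcomp X (grade X) x i) = y"
    using gmod_hom_hcomp[OF assms(1-3) x(1), of i] Y.GM.hcomp_homogeneous[OF assms(4)] x by simp
  then show ?thesis using X.GM.hcomp_grade[OF x(1)] by blast
qed

text \<open>Closure under homogeneous components, the assumption \<open>hc\<close>, is what
  distinguishes graded submodules: it lets the projections of \<open>M\<close> serve as projections
  of \<open>U\<close>.\<close>

lemma sub_graded_left_module:
  assumes "graded_left_module A M" and U: "additive_subgroup U M"
    and sm: "\<And>a x. a \<in> carrier A \<Longrightarrow> x \<in> U \<Longrightarrow> a \<odot>\<^bsub>M\<^esub> x \<in> U"
    and hc: "\<And>x i. x \<in> U \<Longrightarrow> hcomp M (grade M) x i \<in> U"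
  shows "graded_left_module A (sub_gmodule M U)"
proof -
  interpret M: graded_left_module A M by fact
  interpret U: additive_subgroup U M by fact
  let ?U = "sub_gmodule M U"
  have sub: "U \<subseteq> carrier M" by (rule U.a_subset)
  have simps: "carrier ?U = U" "zero ?U = \<zero>\<^bsub>M\<^esub>" "add ?U = add M" "smult ?U = smult M"
    "grade ?U = (\<lambda>i. grade M i \<inter> U)"
    by (auto simp: sub_gmodule_def)
  have ag: "abelian_group ?U"
  proof (rule abelian_groupI)
    fix x assume "x \<in> carrier ?U"
    then show "\<exists>y\<in>carrier ?U. y \<oplus>\<^bsub>?U\<^esub> x = \<zero>\<^bsub>?U\<^esub>"
      using sub U.a_inv_closed M.M.l_neg by (auto simp: simps)
  qed (use sub in \<open>auto simp: simps M.M.a_assoc subset_iff intro: M.M.a_comm\<close>)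
  interpret ab: abelian_group ?U by fact
  have id: "(\<lambda>x. x) \<in> hom (add_monoid ?U) (add_monoid M)"
    using sub by (auto simp: hom_def simps)
  have fs: "finsum ?U c J = finsum M c J" if "finite J" "\<And>i. i \<in> J \<Longrightarrow> c i \<in> U" for c :: "int \<Rightarrow> _" and J
    using add_hom_finsum[OF ag M.M.abelian_group_axioms id, of J c] that by (simp add: simps)
  have "direct_grading ?U (grade ?U)"
  proof (rule direct_gradingI[where pr = "hcomp M (grade M)"])
    show "abelian_group ?U" by fact
    show "additive_subgroup (grade ?U i) ?U" for i
    proof (rule additive_subgroupI, rule ab.add.subgroupI)
      fix x assume "x \<in> grade ?U i"
      then have "\<ominus>\<^bsub>M\<^esub> x \<in> grade ?U i" "x \<in> U" by (auto simp: simps M.GM.g_inv)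
      moreover have "\<ominus>\<^bsub>?U\<^esub> x = \<ominus>\<^bsub>M\<^esub> x"
        using add_hom_a_inv[OF ag M.M.abelian_group_axioms id, of x] \<open>x \<in> U\<close> by (simp add: simps)
      ultimately show "\<ominus>\<^bsub>?U\<^esub> x \<in> grade ?U i" by simp
    next
      have "\<zero>\<^bsub>M\<^esub> \<in> grade ?U i" by (simp add: simps)
      then show "grade ?U i \<noteq> {}" by blast
    qed (auto simp: simps M.GM.g_add)
    show "(\<lambda>x. hcomp M (grade M) x i) \<in> hom (add_monoid ?U) (add_monoid ?U)" for i
      using hc sub by (auto simp: hom_def simps M.GM.hcomp_add subset_iff)
    show "hcomp M (grade M) x i = (if i = j then x else \<zero>\<^bsub>?U\<^esub>)" if "x \<in> grade ?U j" for i j x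
      using that by (auto simp: simps M.GM.hcomp_homogeneous)
    fix m assume "m \<in> carrier ?U"
    then have m: "m \<in> U" "m \<in> carrier M" using sub by (auto simp: simps)
    show "\<exists>J c. finite J \<and> (\<forall>i\<in>J. c i \<in> grade ?U i) \<and> m = finsum ?U c J"
      by (rule exI[of _ "{i. hcomp M (grade M) m i \<noteq> \<zero>\<^bsub>M\<^esub>}"], rule exI[of _ "hcomp M (grade M) m"])
        (use m hc in \<open>auto simp: M.GM.hcomp_finite fs M.GM.hcomp_sum simps M.GM.hcomp_grade\<close>)
  qed
  then show ?thesis
  proof (intro graded_left_module.intro left_module.intro left_module_axioms.intro
      graded_left_module_axioms.intro)
    fix a i x k assume "a \<in> rgrade A i" "x \<in> grade ?U k"
    then show "a \<odot>\<^bsub>?U\<^esub> x \<in> grade ?U (i + k)"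
      using sm[OF M.G.g_carrier] by (auto simp: simps M.smult_grade)
  qed (use M.A.graded_ring_axioms M.A.ring_axioms ag sub in \<open>auto simp: simps sm M.smult_l_distr
    M.smult_r_distr M.smult_assoc M.smult_one subset_iff\<close>)
qed

text \<open>Transport of structure along an injection. It carries modules over other types to
  \<open>'a univ\<close>, where projectivity and global dimension can be applied.\<close>

definition copy_gmodule :: "('m \<Rightarrow> 'n) \<Rightarrow> ('a, 'm) gmodule \<Rightarrow> ('a, 'n) gmodule" where
  "copy_gmodule j M = \<lparr> carrier = j ` carrier M, mult = undefined, one = undefined,
     zero = j \<zero>\<^bsub>M\<^esub>,
     add = (\<lambda>x y. j (the_inv_into (carrier M) j x \<oplus>\<^bsub>M\<^esub> the_inv_into (carrier M) j y)),
     smult = (\<lambda>a x. j (a \<odot>\<^bsub>M\<^esub> the_inv_into (carrier M) j x)),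
     grade = (\<lambda>i. j ` grade M i) \<rparr>"

lemma copy_gmodule:
  assumes "graded_left_module A M" and j: "inj_on j (carrier M)"
  shows copy_graded_left_module: "graded_left_module A (copy_gmodule j M)"
    and copy_hom: "j \<in> gmod_hom A M (copy_gmodule j M)"
    and copy_inv_hom: "the_inv_into (carrier M) j \<in> gmod_hom A (copy_gmodule j M) M"
proof -
  interpret M: graded_left_module A M by fact
  let ?C = "copy_gmodule j M" and ?k = "the_inv_into (carrier M) j"
  have simps: "carrier ?C = j ` carrier M" "zero ?C = j \<zero>\<^bsub>M\<^esub>"
    "add ?C = (\<lambda>x y. j (?k x \<oplus>\<^bsub>M\<^esub> ?k y))" "smult ?C = (\<lambda>a x. j (a \<odot>\<^bsub>M\<^esub> ?k x))"
    "grade ?C = (\<lambda>i. j ` grade M i)"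
    by (auto simp: copy_gmodule_def)
  have kj [simp]: "?k (j x) = x" if "x \<in> carrier M" for x
    using the_inv_into_f_f[OF j that] .
  have gc: "x \<in> grade M i \<Longrightarrow> x \<in> carrier M" for x i by (rule M.GM.g_carrier)
  have ag: "abelian_group ?C"
  proof (rule abelian_groupI)
    fix x assume "x \<in> carrier ?C"
    then obtain y where "x = j y" "y \<in> carrier M" by (auto simp: simps)
    then have "j (\<ominus>\<^bsub>M\<^esub> y) \<in> carrier ?C" "j (\<ominus>\<^bsub>M\<^esub> y) \<oplus>\<^bsub>?C\<^esub> x = \<zero>\<^bsub>?C\<^esub>"
      by (simp_all add: simps M.M.l_neg)
    then show "\<exists>y\<in>carrier ?C. y \<oplus>\<^bsub>?C\<^esub> x = \<zero>\<^bsub>?C\<^esub>" by blast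
  next
    fix x y assume "x \<in> carrier ?C" "y \<in> carrier ?C"
    then show "x \<oplus>\<^bsub>?C\<^esub> y = y \<oplus>\<^bsub>?C\<^esub> x"
      by (auto simp: simps intro!: arg_cong[of _ _ j] M.M.a_comm)
  qed (auto simp: simps M.M.a_assoc)
  interpret ab: abelian_group ?C by fact
  show jh: "j \<in> gmod_hom A M ?C"
    by (rule gmod_homI) (auto simp: simps)
  show kh: "?k \<in> gmod_hom A ?C M"
    by (rule gmod_homI) (auto simp: simps gc M.smult_closed)
  have fs: "finsum ?C (\<lambda>i. j (c i)) J = j (finsum M c J)" if "finite J" "\<And>i. i \<in> J \<Longrightarrow> c i \<in> carrier M" for c :: "int \<Rightarrow> _" and J
    by (rule add_hom_finsum[OF M.M.abelian_group_axioms ag gmod_hom_hom[OF jh], symmetric]) (use that in auto)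
  have "direct_grading ?C (grade ?C)"
  proof (rule direct_gradingI[where pr = "\<lambda>x i. j (hcomp M (grade M) (?k x) i)"])
    show "abelian_group ?C" by fact
    show "additive_subgroup (grade ?C i) ?C" for i
    proof (rule additive_subgroupI, rule ab.add.subgroupI)
      fix x assume "x \<in> grade ?C i"
      then obtain y where y: "x = j y" "y \<in> grade M i" by (auto simp: simps)
      then have "\<ominus>\<^bsub>?C\<^esub> x = j (\<ominus>\<^bsub>M\<^esub> y)"
        using add_hom_a_inv[OF M.M.abelian_group_axioms ag gmod_hom_hom[OF jh], of y] gc by simp
      then show "\<ominus>\<^bsub>?C\<^esub> x \<in> grade ?C i" using y M.GM.g_inv by (auto simp: simps)
    next
      have "j \<zero>\<^bsub>M\<^esub> \<in> grade ?C i" by (simp add: simps)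
      then show "grade ?C i \<noteq> {}" by blast
    qed (use gc in \<open>auto simp: simps M.GM.g_add\<close>)
    show "(\<lambda>x. j (hcomp M (grade M) (?k x) i)) \<in> hom (add_monoid ?C) (add_monoid ?C)" for i
      by (auto simp: hom_def simps M.GM.hcomp_add)
    show "j (hcomp M (grade M) (?k x) i) = (if i = l then x else \<zero>\<^bsub>?C\<^esub>)" if "x \<in> grade ?C l" for i l x
      using that gc by (auto simp: simps M.GM.hcomp_homogeneous)
    fix m assume "m \<in> carrier ?C"
    then obtain y where y: "m = j y" "y \<in> carrier M" by (auto simp: simps)
    show "\<exists>J c. finite J \<and> (\<forall>i\<in>J. c i \<in> grade ?C i) \<and> m = finsum ?C c J"
      by (rule exI[of _ "{i. hcomp M (grade M) y i \<noteq> \<zero>\<^bsub>M\<^esub>}"],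
          rule exI[of _ "\<lambda>i. j (hcomp M (grade M) y i)"])
        (use y in \<open>auto simp: M.GM.hcomp_finite fs M.GM.hcomp_sum simps M.GM.hcomp_grade\<close>)
  qed
  then show "graded_left_module A ?C"
  proof (intro graded_left_module.intro left_module.intro left_module_axioms.intro
      graded_left_module_axioms.intro)
    fix a i x k assume a: "a \<in> rgrade A i" and "x \<in> grade ?C k"
    then obtain y where "x = j y" "y \<in> grade M k" by (auto simp: simps)
    with gc[OF this(2)] show "a \<odot>\<^bsub>?C\<^esub> x \<in> grade ?C (i + k)"
      using M.smult_grade[OF a] by (auto simp: simps)
  qed (use M.A.graded_ring_axioms M.A.ring_axioms ag in \<open>auto simp: simps M.smult_closed M.smult_l_distr
    M.smult_r_distr M.smult_assoc M.smult_one\<close>)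
qed

text \<open>\<open>graded_projective\<close> quantifies only over test modules with elements in
  \<open>'a univ\<close>. The injections move \<open>X\<close> and \<open>Y\<close> there, and the
  lift found for the copies is moved back.\<close>

lemma graded_projective_lift:
  fixes X :: "('a, 'x) gmodule" and Y :: "('a, 'y) gmodule"
    and jx :: "'x \<Rightarrow> 'a univ" and jy :: "'y \<Rightarrow> 'a univ"
  assumes P: "graded_projective A P"
    and X: "graded_left_module A X" and Y: "graded_left_module A Y"
    and \<pi>: "\<pi> \<in> gmod_hom A X Y" "\<pi> ` carrier X = carrier Y" and h: "h \<in> gmod_hom A P Y"
    and jx: "inj_on jx (carrier X)" and jy: "inj_on jy (carrier Y)"
  shows "\<exists>g \<in> gmod_hom A P X. \<forall>p \<in> carrier P. \<pi> (g p) = h p"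
proof -
  let ?X = "copy_gmodule jx X" and ?Y = "copy_gmodule jy Y"
  let ?kx = "the_inv_into (carrier X) jx" and ?ky = "the_inv_into (carrier Y) jy"
  have cX: "carrier ?X = jx ` carrier X" and cY: "carrier ?Y = jy ` carrier Y"
    by (auto simp: copy_gmodule_def)
  have kx: "?kx (jx x) = x" if "x \<in> carrier X" for x using the_inv_into_f_f[OF jx that] .
  have ky: "?ky (jy x) = x" if "x \<in> carrier Y" for x using the_inv_into_f_f[OF jy that] .
  have p1: "(\<lambda>x. jy (\<pi> (?kx x))) \<in> gmod_hom A ?X ?Y"
    using gmod_hom_comp[OF gmod_hom_comp[OF copy_inv_hom[OF X jx] \<pi>(1)] copy_hom[OF Y jy]] .
  have p2: "(\<lambda>x. jy (\<pi> (?kx x))) ` carrier ?X = carrier ?Y"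
    unfolding \<pi>(2)[symmetric] cX cY by (simp add: kx image_image)
  have p3: "(\<lambda>p. jy (h p)) \<in> gmod_hom A P ?Y"
    using gmod_hom_comp[OF h copy_hom[OF Y jy]] .
  obtain g where g: "g \<in> gmod_hom A P ?X" "\<forall>p\<in>carrier P. jy (\<pi> (?kx (g p))) = jy (h p)"
    using P copy_graded_left_module[OF X jx] copy_graded_left_module[OF Y jy] p1 p2 p3
    unfolding graded_projective_def by blast
  have "(\<lambda>p. ?kx (g p)) \<in> gmod_hom A P X"
    using gmod_hom_comp[OF g(1) copy_inv_hom[OF X jx]] .
  moreover have "\<pi> (?kx (g p)) = h p" if "p \<in> carrier P" for p
  proof -
    have "?kx (g p) \<in> carrier X"
      using gmod_hom_closed[OF copy_inv_hom[OF X jx]] gmod_hom_closed[OF g(1) that] by blast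
    then have "\<pi> (?kx (g p)) \<in> carrier Y" using gmod_hom_closed[OF \<pi>(1)] by blast
    then show ?thesis
      using g(2) that ky gmod_hom_closed[OF h that] by metis
  qed
  ultimately show ?thesis by (intro bexI[of _ "\<lambda>p. ?kx (g p)"]) auto
qed

section \<open>Graded free modules\<close>

text \<open>Vectors are functions vanishing outside \<open>J\<close>, so free modules of all ranks
  share one type and a subset of \<open>J\<close> gives a submodule on the nose. Finite support is
  not demanded; the intended case is finite \<open>J\<close>. The i-th unit vector has degree
  \<open>e i\<close>, whence \<open>k - e i\<close>.\<close>

definition free_gmod :: "'a gring \<Rightarrow> 'i set \<Rightarrow> ('i \<Rightarrow> int) \<Rightarrow> ('a, 'i \<Rightarrow> 'a) gmodule" where
  "free_gmod A J e = \<lparr> carrier = {x. (\<forall>i\<in>J. x i \<in> carrier A) \<and> (\<forall>i. i \<notin> J \<longrightarrow> x i = \<zero>\<^bsub>A\<^esub>)},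
     mult = undefined, one = undefined, zero = (\<lambda>_. \<zero>\<^bsub>A\<^esub>),
     add = (\<lambda>x y i. x i \<oplus>\<^bsub>A\<^esub> y i), smult = (\<lambda>a x i. a \<otimes>\<^bsub>A\<^esub> x i),
     grade = (\<lambda>k. {x. (\<forall>i\<in>J. x i \<in> rgrade A (k - e i)) \<and> (\<forall>i. i \<notin> J \<longrightarrow> x i = \<zero>\<^bsub>A\<^esub>)}) \<rparr>"

definition fbasis :: "'a gring \<Rightarrow> 'i \<Rightarrow> 'i \<Rightarrow> 'a" where
  "fbasis A i = (\<lambda>k. if k = i then \<one>\<^bsub>A\<^esub> else \<zero>\<^bsub>A\<^esub>)"

definition lincomb :: "('a, 'm) gmodule \<Rightarrow> 'i set \<Rightarrow> ('i \<Rightarrow> 'm) \<Rightarrow> ('i \<Rightarrow> 'a) \<Rightarrow> 'm" where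
  "lincomb M J v z = (\<Oplus>\<^bsub>M\<^esub>i\<in>J. z i \<odot>\<^bsub>M\<^esub> v i)"

context graded_ring
begin

lemma free_simps:
  "x \<in> carrier (free_gmod A J e) \<longleftrightarrow> (\<forall>i\<in>J. x i \<in> carrier A) \<and> (\<forall>i. i \<notin> J \<longrightarrow> x i = \<zero>)"
  "\<zero>\<^bsub>free_gmod A J e\<^esub> = (\<lambda>_. \<zero>)"
  "x \<oplus>\<^bsub>free_gmod A J e\<^esub> y = (\<lambda>i. x i \<oplus> y i)"
  "a \<odot>\<^bsub>free_gmod A J e\<^esub> x = (\<lambda>i. a \<otimes> x i)"
  "x \<in> grade (free_gmod A J e) k \<longleftrightarrow> (\<forall>i\<in>J. x i \<in> rgrade A (k - e i)) \<and> (\<forall>i. i \<notin> J \<longrightarrow> x i = \<zero>)"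
  by (simp_all add: free_gmod_def)

lemma free_coord_closed: "x \<in> carrier (free_gmod A J e) \<Longrightarrow> x i \<in> carrier A"
  by (cases "i \<in> J") (auto simp: free_simps)

lemma free_ext:
  assumes "x \<in> carrier (free_gmod A J e)" "y \<in> carrier (free_gmod A J e)" "\<And>i. i \<in> J \<Longrightarrow> x i = y i"
  shows "x = y"
  using assms by (fastforce simp: free_simps)

lemma free_coord_hom: "(\<lambda>x. x i) \<in> hom (add_monoid (free_gmod A J e)) (add_monoid A)"
  using free_coord_closed by (auto simp: hom_def free_simps(3))

lemma free_abelian_group: "abelian_group (free_gmod A J e)"
proof (rule abelian_groupI)
  fix x assume x: "x \<in> carrier (free_gmod A J e)"
  then have "(\<lambda>i. \<ominus> x i) \<in> carrier (free_gmod A J e)" by (auto simp: free_simps)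
  moreover have "(\<lambda>i. \<ominus> x i) \<oplus>\<^bsub>free_gmod A J e\<^esub> x = \<zero>\<^bsub>free_gmod A J e\<^esub>"
    using free_coord_closed[OF x] by (auto simp: free_simps(2,3) l_neg)
  ultimately show "\<exists>y\<in>carrier (free_gmod A J e). y \<oplus>\<^bsub>free_gmod A J e\<^esub> x = \<zero>\<^bsub>free_gmod A J e\<^esub>" by blast
next
  fix x y assume "x \<in> carrier (free_gmod A J e)" "y \<in> carrier (free_gmod A J e)"
  then show "x \<oplus>\<^bsub>free_gmod A J e\<^esub> y = y \<oplus>\<^bsub>free_gmod A J e\<^esub> x"
    by (simp add: free_simps(3) a_comm free_coord_closed)
next
  fix x y z assume "x \<in> carrier (free_gmod A J e)" "y \<in> carrier (free_gmod A J e)"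
    "z \<in> carrier (free_gmod A J e)"
  then show "x \<oplus>\<^bsub>free_gmod A J e\<^esub> y \<oplus>\<^bsub>free_gmod A J e\<^esub> z =
      x \<oplus>\<^bsub>free_gmod A J e\<^esub> (y \<oplus>\<^bsub>free_gmod A J e\<^esub> z)"
    by (simp add: free_simps(3) a_assoc free_coord_closed)
next
  fix x assume x: "x \<in> carrier (free_gmod A J e)"
  then show "\<zero>\<^bsub>free_gmod A J e\<^esub> \<oplus>\<^bsub>free_gmod A J e\<^esub> x = x"
    by (simp add: free_simps(2,3) free_coord_closed)
qed (auto simp: free_simps)

lemma free_a_inv: 
  assumes x: "x \<in> carrier (free_gmod A J e)" shows "(\<ominus>\<^bsub>free_gmod A J e\<^esub> x) i = \<ominus> x i"
  using add_hom_a_inv[OF free_abelian_group abelian_group_axioms free_coord_hom x] .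

lemma free_minus:
  assumes "x \<in> carrier (free_gmod A J e)" "y \<in> carrier (free_gmod A J e)"
  shows "(x \<ominus>\<^bsub>free_gmod A J e\<^esub> y) i = x i \<ominus> y i"
  using add_hom_minus[OF free_abelian_group abelian_group_axioms free_coord_hom assms] .

lemma free_finsum_coord:
  assumes "finite S" "\<And>k. k \<in> S \<Longrightarrow> c k \<in> carrier (free_gmod A J e)"
  shows "(\<Oplus>\<^bsub>free_gmod A J e\<^esub>k\<in>S. c k) i = (\<Oplus>k\<in>S. c k i)"
  using add_hom_finsum[OF free_abelian_group abelian_group_axioms free_coord_hom assms] .

lemma free_left_module: "left_module A (free_gmod A J e)"
proof (intro left_module.intro left_module_axioms.intro free_abelian_group ring_axioms)
  show "a \<odot>\<^bsub>free_gmod A J e\<^esub> x \<in> carrier (free_gmod A J e)"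
    if "a \<in> carrier A" "x \<in> carrier (free_gmod A J e)" for a x
    using that by (auto simp: free_simps)
  show "\<one> \<odot>\<^bsub>free_gmod A J e\<^esub> x = x" if "x \<in> carrier (free_gmod A J e)" for x
    using free_coord_closed[OF that] by (simp add: free_simps)
qed (auto simp: free_simps(3,4) l_distr r_distr m_assoc free_coord_closed)

lemma free_graded:
  assumes J: "finite J"
  shows "graded_left_module A (free_gmod A J e)"
proof (intro graded_left_module.intro graded_left_module_axioms.intro free_left_module graded_ring_axioms)
  let ?F = "free_gmod A J e"
  let ?pr = "\<lambda>x k i. hcomp A (rgrade A) (x i) (k - e i)"
  interpret F: abelian_group ?F by (rule free_abelian_group)
  have hz: "hcomp A (rgrade A) \<zero> k = \<zero>" for k using G.hcomp_homogeneous[OF G.g_zero] by simp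
  have prc: "?pr x k \<in> grade ?F k" if "x \<in> carrier ?F" for x k
    using that by (auto simp: free_simps G.hcomp_grade hz)
  have gc: "x \<in> carrier ?F" if "x \<in> grade ?F k" for x k
    using that G.g_carrier by (auto simp: free_simps)
  show "direct_grading ?F (grade ?F)"
  proof (rule direct_gradingI[where pr = ?pr])
    show "abelian_group ?F" by (rule free_abelian_group)
    show "additive_subgroup (grade ?F k) ?F" for k
    proof (rule additive_subgroupI, rule F.add.subgroupI)
      fix x assume x: "x \<in> grade ?F k"
      then show "\<ominus>\<^bsub>?F\<^esub> x \<in> grade ?F k"
        by (auto simp: free_simps(5) free_a_inv[OF gc[OF x]] G.g_inv)
    next
      have "\<zero>\<^bsub>?F\<^esub> \<in> grade ?F k" by (simp add: free_simps)
      then show "grade ?F k \<noteq> {}" by blast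
    next
      show "grade ?F k \<subseteq> carrier ?F" using gc by blast
    qed (auto simp: free_simps G.g_add)
    show "(\<lambda>x. ?pr x k) \<in> hom (add_monoid ?F) (add_monoid ?F)" for k
    proof -
      have "?pr (x \<oplus>\<^bsub>?F\<^esub> y) k = ?pr x k \<oplus>\<^bsub>?F\<^esub> ?pr y k" if "x \<in> carrier ?F" "y \<in> carrier ?F" for x y
        using free_coord_closed[OF that(1)] free_coord_closed[OF that(2)]
        by (simp add: free_simps(3) G.hcomp_add)
      then show ?thesis using gc[OF prc] by (auto simp: hom_def)
    qed
    show "?pr x k = (if k = l then x else \<zero>\<^bsub>?F\<^esub>)" if "x \<in> grade ?F l" for k l x
    proof
      fix i show "?pr x k i = (if k = l then x else \<zero>\<^bsub>?F\<^esub>) i"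
        using that by (cases "i \<in> J") (auto simp: free_simps hz G.hcomp_homogeneous)
    qed
    fix x assume x: "x \<in> carrier ?F"
    let ?S = "\<Union>i\<in>J. (\<lambda>k. k + e i) ` {k. hcomp A (rgrade A) (x i) k \<noteq> \<zero>}"
    have S: "finite ?S" using J G.hcomp_finite[OF free_coord_closed[OF x]] by auto
    have "x = (\<Oplus>\<^bsub>?F\<^esub>k\<in>?S. ?pr x k)"
    proof
      fix i
      have "(\<Oplus>\<^bsub>?F\<^esub>k\<in>?S. ?pr x k) i = (\<Oplus>k\<in>?S. ?pr x k i)"
        by (rule free_finsum_coord[OF S]) (use prc[OF x] gc in blast)
      also have "\<dots> = x i"
      proof (cases "i \<in> J")
        case True
        have "(\<Oplus>k\<in>?S. ?pr x k i) = (\<Oplus>k\<in>(\<lambda>k. k - e i) ` ?S. hcomp A (rgrade A) (x i) k)"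
          by (subst finsum_reindex) (auto simp: free_coord_closed[OF x] inj_on_def)
        also have "\<dots> = x i"
        proof (rule G.hcomp_sum_superset[OF free_coord_closed[OF x]])
          show "finite ((\<lambda>k. k - e i) ` ?S)" using S by simp
          fix k assume k: "k \<notin> (\<lambda>k. k - e i) ` ?S"
          show "hcomp A (rgrade A) (x i) k = \<zero>"
          proof (rule ccontr)
            assume "hcomp A (rgrade A) (x i) k \<noteq> \<zero>"
            then have "k + e i \<in> ?S" using True by blast
            then have "k + e i - e i \<in> (\<lambda>k. k - e i) ` ?S" by (rule imageI)
            with k show False by simp
          qed
        qed
        finally show ?thesis .
      next
        case False
        then have "x i = \<zero>" using x by (simp add: free_simps)
        then show ?thesis by (simp add: hz)
      qed
      finally show "x i = (\<Oplus>\<^bsub>?F\<^esub>k\<in>?S. ?pr x k) i" by simp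
    qed
    then show "\<exists>S c. finite S \<and> (\<forall>k\<in>S. c k \<in> grade ?F k) \<and> x = (\<Oplus>\<^bsub>?F\<^esub>k\<in>S. c k)"
      by (intro exI[of _ ?S] exI[of _ "?pr x"] conjI S ballI prc[OF x])
  qed
  show "a \<odot>\<^bsub>?F\<^esub> x \<in> grade ?F (k + l)" if "a \<in> rgrade A k" "x \<in> grade ?F l" for a k x l
  proof -
    have "a \<otimes> x i \<in> rgrade A (k + l - e i)" if "i \<in> J" for i
      using mult_grade[of a k "x i" "l - e i"] \<open>a \<in> rgrade A k\<close> \<open>x \<in> grade ?F l\<close> that
      by (simp add: free_simps algebra_simps)
    then show ?thesis using that G.g_carrier by (auto simp: free_simps)
  qed
qed

lemma fbasis_grade: "i \<in> J \<Longrightarrow> fbasis A i \<in> grade (free_gmod A J e) (e i)"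
  by (auto simp: free_simps fbasis_def one_grade)

lemma fbasis_carrier: "i \<in> J \<Longrightarrow> fbasis A i \<in> carrier (free_gmod A J e)"
  by (auto simp: free_simps fbasis_def)

lemma free_expand:
  assumes J: "finite J" and x: "x \<in> carrier (free_gmod A J e)"
  shows "x = lincomb (free_gmod A J e) J (fbasis A) x"
proof -
  let ?F = "free_gmod A J e"
  interpret F: left_module A ?F by (rule free_left_module)
  have c: "x i \<odot>\<^bsub>?F\<^esub> fbasis A i \<in> carrier ?F" if "i \<in> J" for i
    by (rule F.smult_closed[OF free_coord_closed[OF x] fbasis_carrier[OF that]])
  show ?thesis unfolding lincomb_def
  proof (rule free_ext[OF x])
    show "(\<Oplus>\<^bsub>?F\<^esub>i\<in>J. x i \<odot>\<^bsub>?F\<^esub> fbasis A i) \<in> carrier ?F"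
      using c by (intro F.M.finsum_closed) auto
    fix i assume i: "i \<in> J"
    have "(\<Oplus>\<^bsub>?F\<^esub>i\<in>J. x i \<odot>\<^bsub>?F\<^esub> fbasis A i) i = (\<Oplus>k\<in>J. x k \<otimes> fbasis A k i)"
      using free_finsum_coord[OF J, of "\<lambda>k. x k \<odot>\<^bsub>?F\<^esub> fbasis A k" J e i] c by (simp add: free_simps(4))
    also have "\<dots> = x i \<otimes> fbasis A i i"
      by (rule finsum_single[OF J i])
        (auto simp: fbasis_def free_coord_closed[OF x])
    finally show "x i = (\<Oplus>\<^bsub>?F\<^esub>i\<in>J. x i \<odot>\<^bsub>?F\<^esub> fbasis A i) i"
      by (simp add: fbasis_def free_coord_closed[OF x])
  qed
qed

text \<open>Stated for linear maps without a condition on degrees, because the functionals to which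
  it is applied later are not assumed to be of degree 0.\<close>

lemma hom_free_eq_lincomb:
  assumes J: "finite J" and N: "abelian_group N"
    and h: "h \<in> hom (add_monoid (free_gmod A J e)) (add_monoid N)"
    and sm: "\<And>a x. a \<in> carrier A \<Longrightarrow> x \<in> carrier (free_gmod A J e) \<Longrightarrow>
      h (a \<odot>\<^bsub>free_gmod A J e\<^esub> x) = a \<odot>\<^bsub>N\<^esub> h x"
    and x: "x \<in> carrier (free_gmod A J e)"
  shows "h x = lincomb N J (\<lambda>i. h (fbasis A i)) x"
proof -
  let ?F = "free_gmod A J e"
  interpret N: abelian_group N by fact
  interpret F: left_module A ?F by (rule free_left_module)
  have b: "x i \<odot>\<^bsub>?F\<^esub> fbasis A i \<in> carrier ?F" if "i \<in> J" for i
    by (rule F.smult_closed[OF free_coord_closed[OF x] fbasis_carrier[OF that]])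
  have hs: "h (x i \<odot>\<^bsub>?F\<^esub> fbasis A i) = x i \<odot>\<^bsub>N\<^esub> h (fbasis A i)" if "i \<in> J" for i
    by (rule sm[OF free_coord_closed[OF x] fbasis_carrier[OF that]])
  have "h x = h (\<Oplus>\<^bsub>?F\<^esub>i\<in>J. x i \<odot>\<^bsub>?F\<^esub> fbasis A i)"
    using free_expand[OF J x] by (simp add: lincomb_def)
  also have "\<dots> = (\<Oplus>\<^bsub>N\<^esub>i\<in>J. h (x i \<odot>\<^bsub>?F\<^esub> fbasis A i))"
    by (rule add_hom_finsum[OF free_abelian_group N h J b])
  also have "\<dots> = (\<Oplus>\<^bsub>N\<^esub>i\<in>J. x i \<odot>\<^bsub>N\<^esub> h (fbasis A i))"
    by (rule N.finsum_cong') (use hs add_hom_closed[OF h b] in auto)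
  finally show ?thesis by (simp add: lincomb_def)
qed

lemma gmod_hom_free_eq_lincomb:
  assumes "finite J" "abelian_group N" "h \<in> gmod_hom A (free_gmod A J e) N"
    "x \<in> carrier (free_gmod A J e)"
  shows "h x = lincomb N J (\<lambda>i. h (fbasis A i)) x"
  by (rule hom_free_eq_lincomb[OF assms(1,2) gmod_hom_hom[OF assms(3)] gmod_hom_smult[OF assms(3)] assms(4)])

lemma lincomb_hom:
  assumes J: "finite J" and M: "graded_left_module A M" and v: "\<And>i. i \<in> J \<Longrightarrow> v i \<in> grade M (e i)"
  shows "lincomb M J v \<in> gmod_hom A (free_gmod A J e) M"
proof (rule gmod_homI)
  let ?F = "free_gmod A J e"
  interpret M: graded_left_module A M by fact
  have vc: "v i \<in> carrier M" if "i \<in> J" for i using v[OF that] M.GM.g_carrier by blast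
  have c: "x i \<odot>\<^bsub>M\<^esub> v i \<in> carrier M" if "x \<in> carrier ?F" "i \<in> J" for x i
    by (rule M.smult_closed[OF free_coord_closed[OF that(1)] vc[OF that(2)]])
  show "lincomb M J v x \<in> carrier M" if "x \<in> carrier ?F" for x
    unfolding lincomb_def by (rule M.M.finsum_closed) (use c that in blast)
  show "lincomb M J v (x \<oplus>\<^bsub>?F\<^esub> y) = lincomb M J v x \<oplus>\<^bsub>M\<^esub> lincomb M J v y"
    if xy: "x \<in> carrier ?F" "y \<in> carrier ?F" for x y
  proof -
    have "lincomb M J v (x \<oplus>\<^bsub>?F\<^esub> y) = (\<Oplus>\<^bsub>M\<^esub>i\<in>J. x i \<odot>\<^bsub>M\<^esub> v i \<oplus>\<^bsub>M\<^esub> y i \<odot>\<^bsub>M\<^esub> v i)"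
      unfolding lincomb_def
      by (rule M.M.finsum_cong')
        (use c xy vc in \<open>auto simp: free_simps(3) M.smult_l_distr free_coord_closed\<close>)
    also have "\<dots> = lincomb M J v x \<oplus>\<^bsub>M\<^esub> lincomb M J v y"
      unfolding lincomb_def by (rule M.M.finsum_addf) (use c xy in auto)
    finally show ?thesis .
  qed
  show "lincomb M J v (a \<odot>\<^bsub>?F\<^esub> x) = a \<odot>\<^bsub>M\<^esub> lincomb M J v x" if a: "a \<in> carrier A" and x: "x \<in> carrier ?F" for a x
  proof -
    have "lincomb M J v (a \<odot>\<^bsub>?F\<^esub> x) = (\<Oplus>\<^bsub>M\<^esub>i\<in>J. a \<odot>\<^bsub>M\<^esub> (x i \<odot>\<^bsub>M\<^esub> v i))"
      unfolding lincomb_def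
      by (rule M.M.finsum_cong')
        (use c x a vc in \<open>auto simp: free_simps(4) M.smult_assoc free_coord_closed M.smult_closed\<close>)
    then show ?thesis
      unfolding lincomb_def using M.smult_finsum[OF a J, of "\<lambda>i. x i \<odot>\<^bsub>M\<^esub> v i"] c[OF x] by simp
  qed
  show "lincomb M J v x \<in> grade M k" if "x \<in> grade ?F k" for x k
    unfolding lincomb_def
  proof (rule M.GM.g_finsum)
    fix i assume i: "i \<in> J"
    then show "x i \<odot>\<^bsub>M\<^esub> v i \<in> grade M k"
      using M.smult_grade[of "x i" "k - e i" "v i" "e i"] v[OF i] that by (simp add: free_simps)
  qed
qed

lemma lincomb_fbasis:
  assumes J: "finite J" and M: "left_module A M" and v: "\<And>i. i \<in> J \<Longrightarrow> v i \<in> carrier M" and i: "i \<in> J"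
  shows "lincomb M J v (fbasis A i) = v i"
proof -
  interpret M: left_module A M by fact
  have "lincomb M J v (fbasis A i) = fbasis A i i \<odot>\<^bsub>M\<^esub> v i"
    unfolding lincomb_def
    by (rule M.M.finsum_single[OF J i]) (auto simp: fbasis_def M.smult_one M.zero_smult v i)
  then show ?thesis by (simp add: fbasis_def M.smult_one v i)
qed

text \<open>\<open>\<pi>\<close> need not be onto: it is enough that the images of the unit vectors
  have preimages, since these can then be chosen homogeneous of the right degree. The types of
  \<open>X\<close> and \<open>Y\<close> are arbitrary, in contrast to the lifting property in
  \<open>graded_projective\<close>.\<close>

lemma free_lift:
  assumes J: "finite J" and X: "graded_left_module A X" and Y: "graded_left_module A Y"
    and h: "h \<in> gmod_hom A (free_gmod A J e) Y" and \<pi>: "\<pi> \<in> gmod_hom A X Y"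
    and im: "\<And>i. i \<in> J \<Longrightarrow> h (fbasis A i) \<in> \<pi> ` carrier X"
  shows "\<exists>g\<in>gmod_hom A (free_gmod A J e) X. \<forall>z\<in>carrier (free_gmod A J e). \<pi> (g z) = h z"
proof -
  interpret X: graded_left_module A X by fact
  interpret Y: graded_left_module A Y by fact
  have "\<forall>i\<in>J. \<exists>x\<in>grade X (e i). \<pi> x = h (fbasis A i)"
    using gmod_hom_homogeneous_preimage[OF X Y \<pi> gmod_hom_grade[OF h fbasis_grade] im] by blast
  then obtain v where v: "\<And>i. i \<in> J \<Longrightarrow> v i \<in> grade X (e i)" "\<And>i. i \<in> J \<Longrightarrow> \<pi> (v i) = h (fbasis A i)"
    by metis
  have g: "lincomb X J v \<in> gmod_hom A (free_gmod A J e) X"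
    by (rule lincomb_hom[OF J X v(1)])
  have pg: "(\<lambda>z. \<pi> (lincomb X J v z)) \<in> gmod_hom A (free_gmod A J e) Y"
    by (rule gmod_hom_comp[OF g \<pi>])
  have "\<pi> (lincomb X J v z) = h z" if z: "z \<in> carrier (free_gmod A J e)" for z
  proof -
    have "\<pi> (lincomb X J v z) = lincomb Y J (\<lambda>i. \<pi> (lincomb X J v (fbasis A i))) z"
      by (rule gmod_hom_free_eq_lincomb[OF J Y.M.abelian_group_axioms pg z])
    also have "\<dots> = lincomb Y J (\<lambda>i. h (fbasis A i)) z"
      unfolding lincomb_def
    proof (rule Y.M.finsum_cong')
      show "\<And>i. i \<in> J \<Longrightarrow> z i \<odot>\<^bsub>Y\<^esub> \<pi> (\<Oplus>\<^bsub>X\<^esub>k\<in>J. fbasis A i k \<odot>\<^bsub>X\<^esub> v k) = z i \<odot>\<^bsub>Y\<^esub> h (fbasis A i)"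
        using lincomb_fbasis[OF J X.left_module_axioms X.GM.g_carrier[OF v(1)]] v(2)
        by (simp add: lincomb_def)
      show "(\<lambda>i. z i \<odot>\<^bsub>Y\<^esub> h (fbasis A i)) \<in> J \<rightarrow> carrier Y"
        using Y.smult_closed[OF free_coord_closed[OF z] gmod_hom_closed[OF h fbasis_carrier]] by blast
    qed simp
    also have "\<dots> = h z"
      by (rule gmod_hom_free_eq_lincomb[OF J Y.M.abelian_group_axioms h z, symmetric])
    finally show ?thesis .
  qed
  with g show ?thesis by blast
qed

end

section \<open>Comparison with projective resolutions\<close>

text \<open>Injectivity makes the pointwise preimage unique and therefore linear in
  \<open>x\<close>; it respects degrees because a homogeneous element of the image has a homogeneous
  preimage.\<close>

lemma gmod_hom_factor:
  assumes K: "graded_left_module A K" and L: "graded_left_module A L" and X: "graded_left_module A X"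
    and \<iota>: "\<iota> \<in> gmod_hom A K L" "inj_on \<iota> (carrier K)" and h: "h \<in> gmod_hom A X L"
    and im: "\<And>x. x \<in> carrier X \<Longrightarrow> h x \<in> \<iota> ` carrier K"
  shows "\<exists>g\<in>gmod_hom A X K. \<forall>x\<in>carrier X. \<iota> (g x) = h x"
proof -
  interpret K: graded_left_module A K by fact
  interpret X: graded_left_module A X by fact
  let ?k = "the_inv_into (carrier K) \<iota>"
  define g where "g x = ?k (h x)" for x
  have \<iota>g: "\<iota> (g x) = h x" and gc: "g x \<in> carrier K" if "x \<in> carrier X" for x
    using f_the_inv_into_f[OF \<iota>(2) im[OF that]] the_inv_into_into[OF \<iota>(2) im[OF that] subset_refl]
    by (auto simp: g_def)
  have eq: "g x = y" if "x \<in> carrier X" "y \<in> carrier K" "\<iota> y = h x" for x y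
    using inj_onD[OF \<iota>(2), of "g x" y] \<iota>g gc that by simp
  have "g \<in> gmod_hom A X K"
  proof (rule gmod_homI)
    fix x y assume xy: "x \<in> carrier X" "y \<in> carrier X"
    show "g (x \<oplus>\<^bsub>X\<^esub> y) = g x \<oplus>\<^bsub>K\<^esub> g y"
      by (rule eq) (use xy gc \<iota>g in \<open>auto simp: gmod_hom_add[OF \<iota>(1)] gmod_hom_add[OF h]\<close>)
  next
    fix a x assume "a \<in> carrier A" "x \<in> carrier X"
    then show "g (a \<odot>\<^bsub>X\<^esub> x) = a \<odot>\<^bsub>K\<^esub> g x"
      by (intro eq) (use gc \<iota>g in \<open>auto simp: gmod_hom_smult[OF \<iota>(1)] gmod_hom_smult[OF h]
        X.smult_closed K.smult_closed\<close>)
  next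
    fix x i assume x: "x \<in> grade X i"
    then have xc: "x \<in> carrier X" by (rule X.GM.g_carrier)
    obtain y where y: "y \<in> grade K i" "\<iota> y = h x"
      using gmod_hom_homogeneous_preimage[OF K L \<iota>(1) gmod_hom_grade[OF h x] im[OF xc]] by blast
    with eq[OF xc K.GM.g_carrier] show "g x \<in> grade K i" by metis
  qed (rule gc)
  with \<iota>g show ?thesis by blast
qed

text \<open>\<open>N\<close> is compared with the syzygy \<open>\<delta> ` P \<subseteq> T\<close> of a projective resolution: \<open>\<alpha>\<close> maps \<open>N\<close> to the
  syzygy, \<open>\<gamma>\<close> induces a map back, and the composite differs from the identity by a map that factors
  through the free cover \<open>\<pi> : L \<rightarrow> N\<close>. This relation passes to kernels of covers, and if \<open>P = 0\<close>
  it says that \<open>\<pi>\<close> splits.\<close>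

definition stable_retract ::
  "'a gring \<Rightarrow> ('a, 'n) gmodule \<Rightarrow> ('a, 'l) gmodule \<Rightarrow> ('l \<Rightarrow> 'n) \<Rightarrow> ('a, 't) gmodule \<Rightarrow>
    ('a, 'p) gmodule \<Rightarrow> ('p \<Rightarrow> 't) \<Rightarrow> bool" where
  "stable_retract A N L \<pi> T P \<delta> \<longleftrightarrow> (\<exists>\<alpha>\<in>gmod_hom A N T. \<exists>\<gamma>\<in>gmod_hom A P N. \<exists>\<sigma>\<in>gmod_hom A N L.
     (\<forall>y\<in>carrier N. \<alpha> y \<in> \<delta> ` carrier P) \<and> (\<forall>p\<in>carrier P. \<delta> p = \<zero>\<^bsub>T\<^esub> \<longrightarrow> \<gamma> p = \<zero>\<^bsub>N\<^esub>) \<and>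
     (\<forall>y\<in>carrier N. \<forall>p\<in>carrier P. \<delta> p = \<alpha> y \<longrightarrow> y \<ominus>\<^bsub>N\<^esub> \<gamma> p = \<pi> (\<sigma> y)))"

text \<open>\<open>\<alpha>\<close> and \<open>\<gamma>\<close> lift to maps \<open>a\<close> from
  \<open>L\<close> to \<open>P\<close> and \<open>b\<close> from \<open>P\<close> to
  \<open>L\<close> between the covers, and these restrict to the kernels: \<open>a \<iota>\<close>
  and the factorization of \<open>b \<delta>'\<close> through \<open>K\<close> are the new pair. The
  new homotopy comes from \<open>id - b a - \<sigma> \<pi>\<close>, which maps \<open>L\<close> into
  \<open>K\<close> by the old relation and lifts to \<open>L'\<close> because \<open>L\<close> is
  free.\<close>

lemma (in graded_ring) stable_retract_step:
  fixes N :: "('a, 'n) gmodule" and K :: "('a, 'k) gmodule" and T :: "('a, 't) gmodule"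
    and P P' :: "('a, 'a univ) gmodule" and J :: "'i set" and J' :: "'j set"
    and e :: "'i \<Rightarrow> int" and e' :: "'j \<Rightarrow> int"
    and jL :: "('i \<Rightarrow> 'a) \<Rightarrow> 'a univ" and jN :: "'n \<Rightarrow> 'a univ"
  defines "L \<equiv> free_gmod A J e" and "L' \<equiv> free_gmod A J' e'"
  assumes J: "finite J"
    and N: "graded_left_module A N" and K: "graded_left_module A K" and T: "graded_left_module A T"
    and \<pi>: "\<pi> \<in> gmod_hom A L N" "\<pi> ` carrier L = carrier N"
    and \<iota>: "\<iota> \<in> gmod_hom A K L" "inj_on \<iota> (carrier K)"
      "\<iota> ` carrier K = {x \<in> carrier L. \<pi> x = \<zero>\<^bsub>N\<^esub>}"
    and J': "finite J'" and \<pi>': "\<pi>' \<in> gmod_hom A L' K" "\<pi>' ` carrier L' = carrier K"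
    and P: "graded_projective A P" and P': "graded_left_module A P'"
    and \<delta>: "\<delta> \<in> gmod_hom A P T" and \<delta>': "\<delta>' \<in> gmod_hom A P' P"
      "\<delta>' ` carrier P' = {p \<in> carrier P. \<delta> p = \<zero>\<^bsub>T\<^esub>}"
    and jL: "inj_on jL (carrier L)" and jN: "inj_on jN (carrier N)"
    and st: "stable_retract A N L \<pi> T P \<delta>"
  shows "stable_retract A K L' \<pi>' P P' \<delta>'"
proof -
  interpret N: graded_left_module A N by fact
  interpret K: graded_left_module A K by fact
  interpret T: graded_left_module A T by fact
  have L: "graded_left_module A L" and L': "graded_left_module A L'"
    unfolding L_def L'_def using J J' by (auto intro: free_graded)
  interpret L: graded_left_module A L by fact
  have Pm: "graded_left_module A P" using P by (simp add: graded_projective_def)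
  interpret P: graded_left_module A P by fact
  interpret P': graded_left_module A P' by fact
  obtain \<alpha> \<gamma> \<sigma> where \<alpha>: "\<alpha> \<in> gmod_hom A N T" "\<And>y. y \<in> carrier N \<Longrightarrow> \<alpha> y \<in> \<delta> ` carrier P"
    and \<gamma>: "\<gamma> \<in> gmod_hom A P N" "\<And>p. p \<in> carrier P \<Longrightarrow> \<delta> p = \<zero>\<^bsub>T\<^esub> \<Longrightarrow> \<gamma> p = \<zero>\<^bsub>N\<^esub>"
    and \<sigma>: "\<sigma> \<in> gmod_hom A N L"
      "\<And>y p. y \<in> carrier N \<Longrightarrow> p \<in> carrier P \<Longrightarrow> \<delta> p = \<alpha> y \<Longrightarrow> y \<ominus>\<^bsub>N\<^esub> \<gamma> p = \<pi> (\<sigma> y)"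
    using st unfolding stable_retract_def by blast
  have \<alpha>\<pi>: "(\<lambda>x. \<alpha> (\<pi> x)) \<in> gmod_hom A L T" by (rule gmod_hom_comp[OF \<pi>(1) \<alpha>(1)])
  have \<alpha>\<pi>i: "\<alpha> (\<pi> (fbasis A i)) \<in> \<delta> ` carrier P" if "i \<in> J" for i
    using \<alpha>(2)[OF gmod_hom_closed[OF \<pi>(1)]] fbasis_carrier[OF that, of e] unfolding L_def by simp
  obtain a where a: "a \<in> gmod_hom A L P" "\<And>x. x \<in> carrier L \<Longrightarrow> \<delta> (a x) = \<alpha> (\<pi> x)"
    using free_lift[OF J Pm T \<alpha>\<pi>[unfolded L_def] \<delta> \<alpha>\<pi>i] unfolding L_def by blast
  \<comment> \<open>The only lift that starts at \<open>P\<close>, hence the place where its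
    projectivity and the embeddings of \<open>L\<close> and \<open>N\<close> into
    \<open>'a univ\<close> are used. The lifts that start at \<open>L\<close> use its basis.\<close>
  obtain b where b: "b \<in> gmod_hom A P L" "\<And>p. p \<in> carrier P \<Longrightarrow> \<pi> (b p) = \<gamma> p"
    using graded_projective_lift[OF P L N \<pi> \<gamma>(1) jL jN] by blast
  have \<pi>\<iota>: "\<pi> (\<iota> y) = \<zero>\<^bsub>N\<^esub>" if "y \<in> carrier K" for y using \<iota>(3) that by blast
  have \<iota>c: "\<iota> y \<in> carrier L" if "y \<in> carrier K" for y by (rule gmod_hom_closed[OF \<iota>(1) that])
  have \<delta>\<delta>': "\<delta> (\<delta>' p) = \<zero>\<^bsub>T\<^esub>" if "p \<in> carrier P'" for p using \<delta>'(2) that by blast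
  have \<delta>'c: "\<delta>' p \<in> carrier P" if "p \<in> carrier P'" for p by (rule gmod_hom_closed[OF \<delta>'(1) that])
  let ?\<alpha>' = "\<lambda>y. a (\<iota> y)"
  have \<alpha>': "?\<alpha>' \<in> gmod_hom A K P" by (rule gmod_hom_comp[OF \<iota>(1) a(1)])
  have \<alpha>'im: "?\<alpha>' y \<in> \<delta>' ` carrier P'" if y: "y \<in> carrier K" for y
  proof -
    have "\<delta> (?\<alpha>' y) = \<zero>\<^bsub>T\<^esub>"
      using a(2)[OF \<iota>c[OF y]] \<pi>\<iota>[OF y]
        add_hom_zero[OF N.M.abelian_group_axioms T.M.abelian_group_axioms gmod_hom_hom[OF \<alpha>(1)]] by simp
    then show ?thesis unfolding \<delta>'(2) using gmod_hom_closed[OF \<alpha>' y] by simp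
  qed
  have b\<delta>': "(\<lambda>p. b (\<delta>' p)) \<in> gmod_hom A P' L" by (rule gmod_hom_comp[OF \<delta>'(1) b(1)])
  have b\<delta>'im: "b (\<delta>' p) \<in> \<iota> ` carrier K" if p: "p \<in> carrier P'" for p
    unfolding \<iota>(3) using b(2)[OF \<delta>'c[OF p]] \<gamma>(2)[OF \<delta>'c[OF p] \<delta>\<delta>'[OF p]] gmod_hom_closed[OF b\<delta>' p]
    by simp
  obtain \<gamma>' where \<gamma>': "\<gamma>' \<in> gmod_hom A P' K" "\<And>p. p \<in> carrier P' \<Longrightarrow> \<iota> (\<gamma>' p) = b (\<delta>' p)"
    using gmod_hom_factor[OF K L P' \<iota>(1,2) b\<delta>' b\<delta>'im] by blast
  have \<iota>0: "\<iota> \<zero>\<^bsub>K\<^esub> = \<zero>\<^bsub>L\<^esub>"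
    by (rule add_hom_zero[OF K.M.abelian_group_axioms L.M.abelian_group_axioms gmod_hom_hom[OF \<iota>(1)]])
  have b0: "b \<zero>\<^bsub>P\<^esub> = \<zero>\<^bsub>L\<^esub>"
    by (rule add_hom_zero[OF P.M.abelian_group_axioms L.M.abelian_group_axioms gmod_hom_hom[OF b(1)]])
  have \<sigma>0: "\<sigma> \<zero>\<^bsub>N\<^esub> = \<zero>\<^bsub>L\<^esub>"
    by (rule add_hom_zero[OF N.M.abelian_group_axioms L.M.abelian_group_axioms gmod_hom_hom[OF \<sigma>(1)]])
  have \<gamma>'0: "\<gamma>' p = \<zero>\<^bsub>K\<^esub>" if p: "p \<in> carrier P'" "\<delta>' p = \<zero>\<^bsub>P\<^esub>" for p
    using inj_onD[OF \<iota>(2), of "\<gamma>' p" "\<zero>\<^bsub>K\<^esub>"] \<gamma>'(2)[OF p(1)] p(2) \<iota>0 b0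
      gmod_hom_closed[OF \<gamma>'(1) p(1)] by simp
  \<comment> \<open>On \<open>K\<close> the last term vanishes, so there \<open>s\<close> is
    \<open>id - b a\<close>, which corresponds to the defect of the new pair. Subtracting
    \<open>\<sigma> \<pi>\<close> makes the map take values in \<open>K\<close> on all of
    \<open>L\<close>, so that freeness of \<open>L\<close> can be used to lift it along
    \<open>\<pi>'\<close>.\<close>
  define s where "s x = x \<ominus>\<^bsub>L\<^esub> b (a x) \<ominus>\<^bsub>L\<^esub> \<sigma> (\<pi> x)" for x
  have ba: "(\<lambda>x. b (a x)) \<in> gmod_hom A L L" by (rule gmod_hom_comp[OF a(1) b(1)])
  have \<sigma>\<pi>: "(\<lambda>x. \<sigma> (\<pi> x)) \<in> gmod_hom A L L" by (rule gmod_hom_comp[OF \<pi>(1) \<sigma>(1)])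
  have bac: "b (a x) \<in> carrier L" and \<sigma>\<pi>c: "\<sigma> (\<pi> x) \<in> carrier L" if "x \<in> carrier L" for x
    using gmod_hom_closed[OF ba that] gmod_hom_closed[OF \<sigma>\<pi> that] .
  have s: "s \<in> gmod_hom A L L"
    unfolding s_def[abs_def] by (rule gmod_hom_diff[OF L L gmod_hom_diff[OF L L gmod_hom_ident ba] \<sigma>\<pi>])
  have s_im: "s x \<in> \<iota> ` carrier K" if x: "x \<in> carrier L" for x
  proof -
    have ax: "a x \<in> carrier P" by (rule gmod_hom_closed[OF a(1) x])
    have \<pi>x: "\<pi> x \<in> carrier N" by (rule gmod_hom_closed[OF \<pi>(1) x])
    have \<gamma>x: "\<gamma> (a x) \<in> carrier N" by (rule gmod_hom_closed[OF \<gamma>(1) ax])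
    have "\<pi> (s x) = \<pi> x \<ominus>\<^bsub>N\<^esub> \<pi> (b (a x)) \<ominus>\<^bsub>N\<^esub> \<pi> (\<sigma> (\<pi> x))"
      unfolding s_def using bac[OF x] \<sigma>\<pi>c[OF x] x
      by (simp add: add_hom_minus[OF L.M.abelian_group_axioms N.M.abelian_group_axioms gmod_hom_hom[OF \<pi>(1)]])
    also have "\<dots> = \<pi> x \<ominus>\<^bsub>N\<^esub> \<gamma> (a x) \<ominus>\<^bsub>N\<^esub> (\<pi> x \<ominus>\<^bsub>N\<^esub> \<gamma> (a x))"
      using b(2)[OF ax] \<sigma>(2)[OF \<pi>x ax a(2)[OF x]] by simp
    also have "\<dots> = \<zero>\<^bsub>N\<^esub>" using \<pi>x \<gamma>x by (simp add: N.M.minus_zero_iff)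
    finally show ?thesis unfolding \<iota>(3) using gmod_hom_closed[OF s x] by simp
  qed
  obtain s' where s': "s' \<in> gmod_hom A L K" "\<And>x. x \<in> carrier L \<Longrightarrow> \<iota> (s' x) = s x"
    using gmod_hom_factor[OF K L L \<iota>(1,2) s s_im] by blast
  have "s' (fbasis A i) \<in> \<pi>' ` carrier L'" if "i \<in> J" for i
    unfolding \<pi>'(2) using gmod_hom_closed[OF s'(1)] fbasis_carrier[OF that, of e] unfolding L_def by simp
  then obtain t where t: "t \<in> gmod_hom A L L'" "\<And>x. x \<in> carrier L \<Longrightarrow> \<pi>' (t x) = s' x"
    using free_lift[OF J L' K s'(1)[unfolded L_def] \<pi>'(1)] unfolding L_def by blast
  have \<sigma>': "(\<lambda>y. t (\<iota> y)) \<in> gmod_hom A K L'" by (rule gmod_hom_comp[OF \<iota>(1) t(1)])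
  have eq: "y \<ominus>\<^bsub>K\<^esub> \<gamma>' p = \<pi>' (t (\<iota> y))" if y: "y \<in> carrier K" and p: "p \<in> carrier P'" "\<delta>' p = a (\<iota> y)" for y p
  proof -
    have gp: "\<gamma>' p \<in> carrier K" by (rule gmod_hom_closed[OF \<gamma>'(1) p(1)])
    have "\<iota> (s' (\<iota> y)) = \<iota> y \<ominus>\<^bsub>L\<^esub> b (a (\<iota> y)) \<ominus>\<^bsub>L\<^esub> \<zero>\<^bsub>L\<^esub>"
      using s'(2)[OF \<iota>c[OF y]] \<pi>\<iota>[OF y] \<sigma>0 by (simp add: s_def)
    also have "\<dots> = \<iota> y \<ominus>\<^bsub>L\<^esub> b (a (\<iota> y))"
      using \<iota>c[OF y] bac[OF \<iota>c[OF y]] by (simp add: L.M.minus_zero_right)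
    also have "\<dots> = \<iota> (y \<ominus>\<^bsub>K\<^esub> \<gamma>' p)"
      using \<gamma>'(2)[OF p(1)] p(2)
      by (simp add: add_hom_minus[OF K.M.abelian_group_axioms L.M.abelian_group_axioms gmod_hom_hom[OF \<iota>(1)] y gp])
    finally have "s' (\<iota> y) = y \<ominus>\<^bsub>K\<^esub> \<gamma>' p"
      by (rule inj_onD[OF \<iota>(2)]) (use gmod_hom_closed[OF s'(1) \<iota>c[OF y]] y gp in auto)
    then show ?thesis using t(2)[OF \<iota>c[OF y]] by simp
  qed
  show ?thesis
    unfolding stable_retract_def
    by (rule bexI[OF _ \<alpha>'], rule bexI[OF _ \<gamma>'(1)], rule bexI[OF _ \<sigma>'])
      (use \<alpha>'im \<gamma>'0 eq in auto)
qed

lemma stable_retract_split: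
  assumes N: "graded_left_module A N" and st: "stable_retract A N L \<pi> T P \<delta>" and P: "carrier P = {\<zero>\<^bsub>P\<^esub>}"
    and Pm: "graded_left_module A P"
  shows "\<exists>\<sigma>\<in>gmod_hom A N L. \<forall>y\<in>carrier N. \<pi> (\<sigma> y) = y"
proof -
  interpret N: graded_left_module A N by fact
  interpret P: graded_left_module A P by fact
  obtain \<alpha> \<gamma> \<sigma> where \<alpha>: "\<alpha> \<in> gmod_hom A N T" "\<And>y. y \<in> carrier N \<Longrightarrow> \<alpha> y \<in> \<delta> ` carrier P"
    and \<gamma>: "\<gamma> \<in> gmod_hom A P N"
    and \<sigma>: "\<sigma> \<in> gmod_hom A N L"
      "\<And>y p. y \<in> carrier N \<Longrightarrow> p \<in> carrier P \<Longrightarrow> \<delta> p = \<alpha> y \<Longrightarrow> y \<ominus>\<^bsub>N\<^esub> \<gamma> p = \<pi> (\<sigma> y)"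
    using st unfolding stable_retract_def by blast
  have \<gamma>0: "\<gamma> \<zero>\<^bsub>P\<^esub> = \<zero>\<^bsub>N\<^esub>"
    by (rule add_hom_zero[OF P.M.abelian_group_axioms N.M.abelian_group_axioms gmod_hom_hom[OF \<gamma>]])
  have "\<pi> (\<sigma> y) = y" if y: "y \<in> carrier N" for y
  proof -
    have "\<delta> \<zero>\<^bsub>P\<^esub> = \<alpha> y" using \<alpha>(2)[OF y] P by auto
    from \<sigma>(2)[OF y _ this] y show ?thesis by (simp add: \<gamma>0 N.M.minus_zero_right)
  qed
  with \<sigma>(1) show ?thesis by blast
qed

text \<open>The induction starts with \<open>st\<close> at \<open>N 0\<close> because all
  \<open>N k\<close> share one type, as do their covers; the step from the resolved module itself to
  \<open>N 0\<close> involves other types and is made separately. \<open>N k\<close> is compared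
  with the image of \<open>P (Suc k)\<close> in \<open>P k\<close>, so it is the vanishing of
  \<open>P (Suc k)\<close> that gives a section.\<close>

lemma (in graded_ring) eventually_split:
  fixes N :: "nat \<Rightarrow> ('a, 'n) gmodule" and J :: "nat \<Rightarrow> 'i set"
    and P :: "nat \<Rightarrow> ('a, 'a univ) gmodule"
    and jL :: "('i \<Rightarrow> 'a) \<Rightarrow> 'a univ" and jN :: "'n \<Rightarrow> 'a univ"
  assumes J: "\<And>k. finite (J k)"
    and N: "\<And>k. graded_left_module A (N k)"
    and \<pi>: "\<And>k. \<pi> k \<in> gmod_hom A (free_gmod A (J k) (e k)) (N k)"
      "\<And>k. \<pi> k ` carrier (free_gmod A (J k) (e k)) = carrier (N k)"
    and \<iota>: "\<And>k. \<iota> k \<in> gmod_hom A (N (Suc k)) (free_gmod A (J k) (e k))"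
      "\<And>k. inj_on (\<iota> k) (carrier (N (Suc k)))"
      "\<And>k. \<iota> k ` carrier (N (Suc k)) = {x \<in> carrier (free_gmod A (J k) (e k)). \<pi> k x = \<zero>\<^bsub>N k\<^esub>}"
    and P: "\<And>k. graded_projective A (P k)"
    and \<delta>: "\<And>k. \<delta> (Suc k) \<in> gmod_hom A (P (Suc k)) (P k)"
      "\<And>k. \<delta> (Suc (Suc k)) ` carrier (P (Suc (Suc k))) =
        {p \<in> carrier (P (Suc k)). \<delta> (Suc k) p = \<zero>\<^bsub>P k\<^esub>}"
    and jL: "inj jL" and jN: "inj jN"
    and st: "stable_retract A (N 0) (free_gmod A (J 0) (e 0)) (\<pi> 0) (P 0) (P (Suc 0)) (\<delta> (Suc 0))"
    and fin: "carrier (P (Suc k)) = {\<zero>\<^bsub>P (Suc k)\<^esub>}"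
  shows "\<exists>\<sigma>\<in>gmod_hom A (N k) (free_gmod A (J k) (e k)). \<forall>y\<in>carrier (N k). \<pi> k (\<sigma> y) = y"
proof -
  have Pm: "graded_left_module A (P k)" for k using P[of k] by (simp add: graded_projective_def)
  have "stable_retract A (N k) (free_gmod A (J k) (e k)) (\<pi> k) (P k) (P (Suc k)) (\<delta> (Suc k))" for k
  proof (induction k)
    case (Suc k)
    show ?case
      by (rule stable_retract_step[OF J N N Pm \<pi> \<iota> J \<pi> P Pm \<delta>(1) \<delta> inj_on_subset[OF jL subset_UNIV]
        inj_on_subset[OF jN subset_UNIV] Suc])
  qed (rule st)
  from stable_retract_split[OF N this fin Pm] show ?thesis .
qed

section \<open>Submodules given by generators, and additive maps compared on homogeneous
  elements\<close>

lemma set_smult_subset: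
  assumes "left_module A M" "submodule V A M" "S \<subseteq> V" "I \<subseteq> carrier A"
  shows "set_smult M I S \<subseteq> V"
proof -
  interpret M: left_module A M by fact
  interpret V: submodule V A M by fact
  show ?thesis unfolding set_smult_def
    by (rule M.M.add.generate_subgroup_incl) (use assms V.subgroup_axioms in auto)
qed

lemma set_smult_subgroup:
  assumes "left_module A M" "S \<subseteq> carrier M" "I \<subseteq> carrier A"
  shows "additive_subgroup (set_smult M I S) M"
proof -
  interpret M: left_module A M by fact
  show ?thesis unfolding set_smult_def
    by (rule additive_subgroupI, rule M.M.add.generate_is_subgroup)
      (use assms M.smult_closed in auto)
qed

lemma additive_subgroup_finsum:
  assumes "abelian_group M" "additive_subgroup H M" "\<And>i. i \<in> J \<Longrightarrow> c i \<in> H"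
  shows "(\<Oplus>\<^bsub>M\<^esub>i\<in>J. c i) \<in> H"
  using assms(3)
proof (induction J rule: infinite_finite_induct)
  case (infinite J)
  interpret abelian_group M by fact
  interpret H: additive_subgroup H M by fact
  from infinite show ?case by (simp add: finsum_infinite)
next
  case empty
  interpret abelian_group M by fact
  interpret H: additive_subgroup H M by fact
  show ?case by simp
next
  case (insert k J)
  interpret abelian_group M by fact
  interpret H: additive_subgroup H M by fact
  have "c \<in> J \<rightarrow> carrier M" "c k \<in> carrier M" using insert H.a_subset by auto
  with insert show ?case by simp
qed

lemma add_hom_eq_on_homogeneous:
  assumes M: "graded_group M g" and N: "abelian_group N"
    and h: "h \<in> hom (add_monoid M) (add_monoid N)" "k \<in> hom (add_monoid M) (add_monoid N)"
    and eq: "\<And>i x. x \<in> g i \<Longrightarrow> h x = k x" and x: "x \<in> carrier M"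
  shows "h x = k x"
proof -
  interpret M: graded_group M g by fact
  interpret N: abelian_group N by fact
  let ?S = "{i. hcomp M g x i \<noteq> \<zero>\<^bsub>M\<^esub>}"
  note fin = M.hcomp_finite[OF x] and c = M.hcomp_carrier[OF x]
  have "h x = h (\<Oplus>\<^bsub>M\<^esub>i\<in>?S. hcomp M g x i)" by (simp only: M.hcomp_sum[OF x])
  also have "\<dots> = (\<Oplus>\<^bsub>N\<^esub>i\<in>?S. h (hcomp M g x i))"
    by (rule add_hom_finsum[OF M.abelian_group_axioms N h(1) fin c])
  also have "\<dots> = (\<Oplus>\<^bsub>N\<^esub>i\<in>?S. k (hcomp M g x i))"
    by (rule N.finsum_cong') (use eq[OF M.hcomp_grade[OF x]] add_hom_closed[OF h(2) c] in auto)
  also have "\<dots> = k (\<Oplus>\<^bsub>M\<^esub>i\<in>?S. hcomp M g x i)"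
    by (rule add_hom_finsum[OF M.abelian_group_axioms N h(2) fin c, symmetric])
  also have "\<dots> = k x" by (simp only: M.hcomp_sum[OF x])
  finally show ?thesis .
qed

section \<open>Modules over connected graded algebras\<close>

text \<open>This is \<open>A\<^sub>+\<close>, described by the degree 0 component rather than by
  generators as in \<open>augmentation\<close>, which makes membership a matter of
  computation.\<close>

definition pos_part :: "'a gring \<Rightarrow> 'a set" where
  "pos_part A = {a \<in> carrier A. hcomp A (rgrade A) a 0 = \<zero>\<^bsub>A\<^esub>}"

context connected_graded_algebra
begin

abbreviation "deg0 a \<equiv> hcomp A (rgrade A) a 0"

text \<open>In nonnegative degrees i + j = 0 forces i = j = 0, so for homogeneous factors the claim
  is a comparison of degrees; additivity in each factor extends it. It makes
  \<open>pos_part A\<close> a two-sided ideal.\<close>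

lemma deg0_mult:
  assumes a: "a \<in> carrier A" and b: "b \<in> carrier A"
  shows "deg0 (a \<otimes> b) = deg0 a \<otimes> deg0 b"
proof -
  have hom1: "(\<lambda>b. deg0 (a \<otimes> b)) \<in> hom (add_monoid A) (add_monoid A)" if "a \<in> carrier A" for a
    using that by (auto simp: hom_def r_distr G.hcomp_add)
  have hom2: "(\<lambda>b. deg0 a \<otimes> deg0 b) \<in> hom (add_monoid A) (add_monoid A)" if "a \<in> carrier A" for a
    using that by (auto simp: hom_def r_distr G.hcomp_add)
  have hom3: "(\<lambda>a. deg0 (a \<otimes> b)) \<in> hom (add_monoid A) (add_monoid A)"
    using b by (auto simp: hom_def l_distr G.hcomp_add)
  have hom4: "(\<lambda>a. deg0 a \<otimes> deg0 b) \<in> hom (add_monoid A) (add_monoid A)"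
    using b by (auto simp: hom_def l_distr G.hcomp_add)
  have base: "deg0 (x \<otimes> y) = deg0 x \<otimes> deg0 y" if x: "x \<in> rgrade A i" and y: "y \<in> rgrade A j" for x y i j
  proof -
    have xy: "x \<in> carrier A" "y \<in> carrier A" using G.g_carrier[OF x] G.g_carrier[OF y] .
    consider "i = 0 \<and> j = 0" | "i < 0" | "j < 0" | "i + j \<noteq> 0 \<and> i \<ge> 0 \<and> j \<ge> 0" by linarith
    then show ?thesis
    proof cases
      case 1
      then show ?thesis
        using G.hcomp_homogeneous[OF mult_grade[OF x y], of 0] G.hcomp_homogeneous[OF x, of 0]
          G.hcomp_homogeneous[OF y, of 0] by simp
    next
      case 2
      then have "x = \<zero>" using nat_graded x by auto
      then show ?thesis using G.hcomp_homogeneous[OF G.g_zero] xy by simp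
    next
      case 3
      then have "y = \<zero>" using nat_graded y by auto
      then show ?thesis using G.hcomp_homogeneous[OF G.g_zero] xy by simp
    next
      case 4
      then have "i \<noteq> 0 \<or> j \<noteq> 0" by auto
      then have "deg0 x = \<zero> \<or> deg0 y = \<zero>"
        using G.hcomp_homogeneous[OF x, of 0] G.hcomp_homogeneous[OF y, of 0] by auto
      then show ?thesis
        using G.hcomp_homogeneous[OF mult_grade[OF x y], of 0] 4 xy by auto
    qed
  qed
  show ?thesis
  proof (rule add_hom_eq_on_homogeneous[OF G.graded_group_axioms abelian_group_axioms hom3 hom4 _ a])
    fix i x assume x: "x \<in> rgrade A i"
    show "deg0 (x \<otimes> b) = deg0 x \<otimes> deg0 b"
      by (rule add_hom_eq_on_homogeneous[OF G.graded_group_axioms abelian_group_axioms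
            hom1[OF G.g_carrier[OF x]] hom2[OF G.g_carrier[OF x]] base[OF x] b])
  qed
qed

lemma pos_carrier: "a \<in> pos_part A \<Longrightarrow> a \<in> carrier A" by (simp add: pos_part_def)

lemma pos_mult_left: "a \<in> carrier A \<Longrightarrow> b \<in> pos_part A \<Longrightarrow> a \<otimes> b \<in> pos_part A"
  by (simp add: pos_part_def deg0_mult)

lemma pos_mult_right: "a \<in> carrier A \<Longrightarrow> b \<in> pos_part A \<Longrightarrow> b \<otimes> a \<in> pos_part A"
  by (simp add: pos_part_def deg0_mult)

lemma pos_additive_subgroup: "additive_subgroup (pos_part A) A"
proof (rule additive_subgroupI, rule add.subgroupI)
  show "pos_part A \<noteq> {}"
    using G.hcomp_homogeneous[OF G.g_zero, of 0] by (auto simp: pos_part_def)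
  show "\<ominus> x \<in> pos_part A" if "x \<in> pos_part A" for x
    using that add_hom_a_inv[OF abelian_group_axioms abelian_group_axioms G.hcomp_add_hom, of x 0]
    by (simp add: pos_part_def)
qed (auto simp: pos_part_def G.hcomp_add)

lemma pos_finsum: "(\<And>i. i \<in> J \<Longrightarrow> c i \<in> pos_part A) \<Longrightarrow> (\<Oplus>i\<in>J. c i) \<in> pos_part A"
  by (rule additive_subgroup_finsum[OF abelian_group_axioms pos_additive_subgroup])

lemma one_not_pos: "\<one> \<notin> pos_part A"
proof
  assume "\<one> \<in> pos_part A"
  then have "deg0 \<one> = \<zero>" unfolding pos_part_def by blast
  then show False
    unfolding G.hcomp_homogeneous[OF one_grade, of 0] using sub_one_not_zero by simp
qed

lemma homogeneous_pos: "x \<in> rgrade A n \<Longrightarrow> n \<noteq> 0 \<Longrightarrow> x \<in> pos_part A"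
  using G.hcomp_homogeneous[of x n 0] G.g_carrier[of x n] by (simp add: pos_part_def)

lemma pos_homogeneous_degree: "x \<in> rgrade A n \<Longrightarrow> x \<in> pos_part A \<Longrightarrow> x \<noteq> \<zero> \<Longrightarrow> n > 0"
  using G.hcomp_homogeneous[of x n 0] nat_graded[of n] by (cases "n < 0"; cases "n = 0") (auto simp: pos_part_def)

text \<open>Connectedness enters here: the degree 0 component lies in the field \<open>K\<close>, so
  it is invertible once it is nonzero, and its inverse again has degree 0.\<close>

lemma deg0_inverse:
  assumes "a \<in> carrier A" "deg0 a \<noteq> \<zero>"
  obtains b where "b \<in> rgrade A 0" "b \<in> carrier A" "b \<otimes> deg0 a = \<one>"
proof -
  have "deg0 a \<in> K - {\<zero>}" using G.hcomp_grade[OF assms(1), of 0] assms(2) connected by auto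
  from subfield_m_inv[OF subfield_axioms this] have "inv (deg0 a) \<in> rgrade A 0" "inv (deg0 a) \<otimes> deg0 a = \<one>"
    using connected by auto
  then show thesis using that G.g_carrier by blast
qed

section \<open>Finite graded free modules over a connected algebra: bases, minimal covers, freeness
  of direct summands\<close>

lemma fbasis_inj: "inj (fbasis A)"
  by (auto simp: inj_def fbasis_def fun_eq_iff split: if_splits)

lemma free_mono:
  assumes "J \<subseteq> J0"
  shows "carrier (free_gmod A J e) \<subseteq> carrier (free_gmod A J0 e)"
    and "grade (free_gmod A J e) k \<subseteq> grade (free_gmod A J0 e) k"
proof -
  show "carrier (free_gmod A J e) \<subseteq> carrier (free_gmod A J0 e)"
  proof
    fix x assume x: "x \<in> carrier (free_gmod A J e)"
    have "x i = \<zero>" if "i \<notin> J0" for i using x that assms by (auto simp: free_simps)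
    with free_coord_closed[OF x] show "x \<in> carrier (free_gmod A J0 e)" by (simp add: free_simps)
  qed
  show "grade (free_gmod A J e) k \<subseteq> grade (free_gmod A J0 e) k"
  proof
    fix x assume x: "x \<in> grade (free_gmod A J e) k"
    then have "x i \<in> rgrade A (k - e i)" for i by (cases "i \<in> J") (simp_all add: free_simps)
    moreover have "x i = \<zero>" if "i \<notin> J0" for i using x that assms by (auto simp: free_simps)
    ultimately show "x \<in> grade (free_gmod A J0 e) k" by (simp add: free_simps)
  qed
qed

lemma free_coord_hcomp:
  assumes "finite J" "x \<in> carrier (free_gmod A J e)" "i \<in> J"
  shows "hcomp (free_gmod A J e) (grade (free_gmod A J e)) x k i = hcomp A (rgrade A) (x i) (k - e i)"
proof -
  interpret F: graded_left_module A "free_gmod A J e" by (rule free_graded[OF assms(1)])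
  show ?thesis
    using hcomp_hom[OF F.GM.graded_group_axioms G.graded_group_axioms free_coord_hom, of i "- e i" x k] assms
    by (simp add: free_simps(5))
qed

text \<open>\<open>homogeneous_basis\<close> speaks of a set, not of a family. So the images of the
  unit vectors have to be distinct for coefficients indexed by \<open>J\<close> to agree with
  coefficients indexed by basis elements.\<close>

lemma free_iso_imp_graded_free:
  assumes J: "finite J" and F: "graded_left_module A F"
    and g: "g \<in> gmod_hom A (free_gmod A J e) F" and bij: "bij_betw g (carrier (free_gmod A J e)) (carrier F)"
  shows "graded_free A F" "finitely_generated A F"
proof -
  interpret F: graded_left_module A F by fact
  let ?L = "free_gmod A J e"
  let ?v = "\<lambda>i. g (fbasis A i)"
  let ?S = "?v ` J"
  have inj: "inj_on g (carrier ?L)" and surj: "g ` carrier ?L = carrier F"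
    using bij by (auto simp: bij_betw_def)
  have vinj: "inj_on ?v J"
  proof (rule inj_onI)
    fix i k assume "i \<in> J" "k \<in> J" "?v i = ?v k"
    then have "fbasis A i = fbasis A k" using inj_onD[OF inj] fbasis_carrier by metis
    then show "i = k" by (rule injD[OF fbasis_inj])
  qed
  have vg: "?v i \<in> grade F (e i)" if "i \<in> J" for i by (rule gmod_hom_grade[OF g fbasis_grade[OF that]])
  have vc: "?v i \<in> carrier F" if "i \<in> J" for i by (rule F.GM.g_carrier[OF vg[OF that]])
  have S: "finite ?S" "?S \<subseteq> carrier F" using J vc by auto
  define cf where "cf c i = (if i \<in> J then c (?v i) else \<zero>)" for c and i
  have cfL: "cf c \<in> carrier ?L" if "c \<in> ?S \<rightarrow>\<^sub>E carrier A" for c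
    using that by (auto simp: free_simps cf_def)
  have sum: "(\<Oplus>\<^bsub>F\<^esub>s\<in>{s \<in> ?S. c s \<noteq> \<zero>}. c s \<odot>\<^bsub>F\<^esub> s) = g (cf c)" if c: "c \<in> ?S \<rightarrow>\<^sub>E carrier A" for c
  proof -
    have cc: "c s \<in> carrier A" if "s \<in> ?S" for s using c that by auto
    have "(\<Oplus>\<^bsub>F\<^esub>s\<in>{s \<in> ?S. c s \<noteq> \<zero>}. c s \<odot>\<^bsub>F\<^esub> s) = (\<Oplus>\<^bsub>F\<^esub>s\<in>?S. c s \<odot>\<^bsub>F\<^esub> s)"
    proof (rule F.M.finsum_neutral[OF S(1)])
      show "c s \<odot>\<^bsub>F\<^esub> s \<in> carrier F" if "s \<in> {s \<in> ?S. c s \<noteq> \<zero>}" for s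
        using F.smult_closed[OF cc, of s s] that S(2) by blast
      show "c s \<odot>\<^bsub>F\<^esub> s = \<zero>\<^bsub>F\<^esub>" if "s \<in> ?S - {s \<in> ?S. c s \<noteq> \<zero>}" for s
        using F.zero_smult[of s] that S(2) by auto
    qed auto
    also have "\<dots> = (\<Oplus>\<^bsub>F\<^esub>i\<in>J. c (?v i) \<odot>\<^bsub>F\<^esub> ?v i)"
      by (rule F.M.finsum_reindex[OF _ vinj]) (use cc S(2) F.smult_closed in auto)
    also have "\<dots> = lincomb F J ?v (cf c)"
      unfolding lincomb_def
      by (rule F.M.finsum_cong') (use cc vc F.smult_closed in \<open>auto simp: cf_def\<close>)
    also have "\<dots> = g (cf c)"
      by (rule gmod_hom_free_eq_lincomb[OF J F.M.abelian_group_axioms g cfL[OF c], symmetric])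
    finally show ?thesis .
  qed
  have "homogeneous_basis A F ?S"
    unfolding homogeneous_basis_def
  proof (intro conjI ballI)
    show "?S \<subseteq> (\<Union>i. grade F i)" using vg by blast
    fix m assume "m \<in> carrier F"
    then obtain x where x: "x \<in> carrier ?L" "m = g x" using surj by blast
    define c where "c = (\<lambda>s\<in>?S. x (the_inv_into J ?v s))"
    have c: "c \<in> ?S \<rightarrow>\<^sub>E carrier A" using free_coord_closed[OF x(1)] by (auto simp: c_def)
    have cv: "c (?v i) = x i" if "i \<in> J" for i
      using that the_inv_into_f_f[OF vinj that] by (simp add: c_def)
    have cfc: "cf c = x" by (rule free_ext[OF cfL[OF c] x(1)]) (simp add: cf_def cv)
    show "\<exists>!c. c \<in> ?S \<rightarrow>\<^sub>E carrier A \<and> finite {s \<in> ?S. c s \<noteq> \<zero>} \<and>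
        m = (\<Oplus>\<^bsub>F\<^esub>s\<in>{s \<in> ?S. c s \<noteq> \<zero>}. c s \<odot>\<^bsub>F\<^esub> s)"
    proof (rule ex1I[of _ c])
      show "c \<in> ?S \<rightarrow>\<^sub>E carrier A \<and> finite {s \<in> ?S. c s \<noteq> \<zero>} \<and>
        m = (\<Oplus>\<^bsub>F\<^esub>s\<in>{s \<in> ?S. c s \<noteq> \<zero>}. c s \<odot>\<^bsub>F\<^esub> s)"
        using c sum[OF c] cfc x(2) S(1) by simp
    next
      fix c' assume c': "c' \<in> ?S \<rightarrow>\<^sub>E carrier A \<and> finite {s \<in> ?S. c' s \<noteq> \<zero>} \<and>
        m = (\<Oplus>\<^bsub>F\<^esub>s\<in>{s \<in> ?S. c' s \<noteq> \<zero>}. c' s \<odot>\<^bsub>F\<^esub> s)"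
      then have c'S: "c' \<in> ?S \<rightarrow>\<^sub>E carrier A" by blast
      have "g (cf c') = g x" using sum[OF c'S] c' x(2) by simp
      then have "cf c' = x" using inj_onD[OF inj _ cfL[OF c'S] x(1)] by simp
      then have eq: "cf c' i = cf c i" for i using cfc by simp
      show "c' = c"
      proof (rule PiE_ext[OF c'S c])
        fix s assume "s \<in> ?S"
        then obtain i where "i \<in> J" "s = ?v i" by blast
        then show "c' s = c s" using eq[of i] by (simp add: cf_def)
      qed
    qed
  qed
  then show "graded_free A F" using F unfolding graded_free_def by blast
  show "finitely_generated A F"
    unfolding finitely_generated_def
  proof (intro exI[of _ ?S] conjI S equalityI)
    interpret U: additive_subgroup "set_smult F (carrier A) ?S" F
      by (rule set_smult_subgroup[OF F.left_module_axioms S(2) subset_refl])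
    show "set_smult F (carrier A) ?S \<subseteq> carrier F" by (rule U.a_subset)
    show "carrier F \<subseteq> set_smult F (carrier A) ?S"
    proof
      fix m assume "m \<in> carrier F"
      then obtain x where x: "x \<in> carrier ?L" "m = g x" using surj by blast
      have "m = lincomb F J ?v x"
        using gmod_hom_free_eq_lincomb[OF J F.M.abelian_group_axioms g x(1)] x(2) by simp
      also have "\<dots> \<in> set_smult F (carrier A) ?S"
        unfolding lincomb_def
      proof (rule additive_subgroup_finsum[OF F.M.abelian_group_axioms U.is_additive_subgroup])
        fix i assume "i \<in> J"
        then show "x i \<odot>\<^bsub>F\<^esub> ?v i \<in> set_smult F (carrier A) ?S"
          unfolding set_smult_def using free_coord_closed[OF x(1)]
          by (intro generate.incl) blast
      qed
      finally show "m \<in> set_smult F (carrier A) ?S" .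
    qed
  qed
qed

text \<open>Among the subsets of \<open>J0\<close> whose unit vectors still generate
  \<open>F\<close>, one of least cardinality works: a relation with a coordinate outside
  \<open>A\<^sub>+\<close> would express one generator by the others.\<close>

lemma split_surjection_imp_minimal_cover:
  assumes J0: "finite J0" and F: "graded_left_module A F"
    and \<pi>: "\<pi> \<in> gmod_hom A (free_gmod A J0 e) F" "\<pi> ` carrier (free_gmod A J0 e) = carrier F"
  shows "\<exists>J\<subseteq>J0. \<pi> ` carrier (free_gmod A J e) = carrier F \<and>
    (\<forall>x\<in>carrier (free_gmod A J e). \<pi> x = \<zero>\<^bsub>F\<^esub> \<longrightarrow> (\<forall>i\<in>J. x i \<in> pos_part A))"
proof -
  interpret F: graded_left_module A F by fact
  let ?P = "\<lambda>J. J \<subseteq> J0 \<and> \<pi> ` carrier (free_gmod A J e) = carrier F"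
  have "?P J0" using \<pi> by simp
  from ex_has_least_nat[of ?P, OF this, of card]
  obtain J where J: "J \<subseteq> J0" "\<pi> ` carrier (free_gmod A J e) = carrier F"
    and min: "\<And>J'. ?P J' \<Longrightarrow> card J \<le> card J'" by blast
  have fJ: "finite J" using J(1) J0 finite_subset by blast
  let ?L = "free_gmod A J e"
  interpret L: graded_left_module A ?L by (rule free_graded[OF fJ])
  note sub = free_mono(1)[OF J(1)] and subg = free_mono(2)[OF J(1)]
  have \<pi>L: "\<pi> \<in> gmod_hom A ?L F"
  proof (rule gmod_homI)
    fix x y assume xy: "x \<in> carrier ?L" "y \<in> carrier ?L"
    show "\<pi> (x \<oplus>\<^bsub>?L\<^esub> y) = \<pi> x \<oplus>\<^bsub>F\<^esub> \<pi> y"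
      using gmod_hom_add[OF \<pi>(1) subsetD[OF sub xy(1)] subsetD[OF sub xy(2)]] by (simp add: free_simps)
  next
    fix a x assume a: "a \<in> carrier A" and x: "x \<in> carrier ?L"
    show "\<pi> (a \<odot>\<^bsub>?L\<^esub> x) = a \<odot>\<^bsub>F\<^esub> \<pi> x"
      using gmod_hom_smult[OF \<pi>(1) a subsetD[OF sub x]] by (simp add: free_simps)
  next
    fix x k assume x: "x \<in> grade ?L k"
    show "\<pi> x \<in> grade F k" by (rule gmod_hom_grade[OF \<pi>(1) subsetD[OF subg x]])
  next
    fix x assume x: "x \<in> carrier ?L"
    show "\<pi> x \<in> carrier F" by (rule gmod_hom_closed[OF \<pi>(1) subsetD[OF sub x]])
  qed
  have "x i \<in> pos_part A" if x: "x \<in> carrier ?L" "\<pi> x = \<zero>\<^bsub>F\<^esub>" and i: "i \<in> J" for x i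
  proof (rule ccontr)
    assume "x i \<notin> pos_part A"
    then have nz: "deg0 (x i) \<noteq> \<zero>" using free_coord_closed[OF x(1)] by (simp add: pos_part_def)
    obtain r where r: "r \<in> carrier A" "r \<otimes> deg0 (x i) = \<one>"
      using deg0_inverse[OF free_coord_closed[OF x(1)] nz] by blast
    \<comment> \<open>Passing to degree \<open>e i\<close> turns the i-th coordinate of the relation
      into the degree 0 component of \<open>x i\<close>, a unit, without leaving the kernel.\<close>
    let ?c = "hcomp ?L (grade ?L) x (e i)"
    have c: "?c \<in> carrier ?L" using x by simp
    have ci: "?c i = deg0 (x i)" using free_coord_hcomp[OF fJ x(1) i, of "e i"] by simp
    have \<pi>c: "\<pi> ?c = \<zero>\<^bsub>F\<^esub>"
      using gmod_hom_hcomp[OF L.graded_left_module_axioms F \<pi>L x(1), of "e i"] x(2)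
        F.GM.hcomp_homogeneous[OF F.GM.g_zero] by simp
    have "?P (J - {i})"
    proof (intro conjI equalityI)
      show "J - {i} \<subseteq> J0" using J(1) by blast
      have subL: "carrier (free_gmod A (J - {i}) e) \<subseteq> carrier ?L" by (rule free_mono) blast
      show "\<pi> ` carrier (free_gmod A (J - {i}) e) \<subseteq> carrier F"
        using gmod_hom_closed[OF \<pi>L] subL by blast
      show "carrier F \<subseteq> \<pi> ` carrier (free_gmod A (J - {i}) e)"
      proof
        fix y assume "y \<in> carrier F"
        then obtain z where z: "z \<in> carrier ?L" "y = \<pi> z" using J(2) by blast
        \<comment> \<open>Chosen so that subtracting \<open>?a\<close> times \<open>?c\<close>
          clears the i-th coordinate of \<open>z\<close>; since \<open>?c\<close> is in the kernel,
          the image under \<open>\<pi>\<close> stays \<open>y\<close>.\<close>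
        let ?a = "z i \<otimes> r"
        have a: "?a \<in> carrier A" using r free_coord_closed[OF z(1)] by simp
        have ac: "?a \<odot>\<^bsub>?L\<^esub> ?c \<in> carrier ?L" by (rule L.smult_closed[OF a c])
        let ?z = "z \<ominus>\<^bsub>?L\<^esub> ?a \<odot>\<^bsub>?L\<^esub> ?c"
        have zc: "?z \<in> carrier ?L" using z(1) ac by simp
        have "?z i = z i \<ominus> ?a \<otimes> ?c i" using free_minus[OF z(1) ac, of i] by (simp add: free_simps(4))
        also have "?a \<otimes> ?c i = z i"
          unfolding ci using r free_coord_closed[OF z(1)] G.hcomp_carrier[OF free_coord_closed[OF x(1)]]
          by (simp add: m_assoc)
        finally have "?z i = \<zero>" using free_coord_closed[OF z(1)] by (simp add: minus_zero_iff)
        then have z': "?z \<in> carrier (free_gmod A (J - {i}) e)"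
          using zc by (auto simp: free_simps(1))
        have "\<pi> ?z = \<pi> z \<ominus>\<^bsub>F\<^esub> ?a \<odot>\<^bsub>F\<^esub> \<pi> ?c"
          using add_hom_minus[OF L.M.abelian_group_axioms F.M.abelian_group_axioms gmod_hom_hom[OF \<pi>L] z(1) ac]
            gmod_hom_smult[OF \<pi>L a c] by simp
        also have "\<dots> = y"
          using \<pi>c F.smult_zero[OF a] gmod_hom_closed[OF \<pi>L z(1)] z(2) by (simp add: F.M.minus_zero_right)
        finally show "y \<in> \<pi> ` carrier (free_gmod A (J - {i}) e)" using z' by (rule image_eqI[OF sym])
      qed
    qed
    from min[OF this] show False using card_Diff1_less[OF fJ i] by linarith
  qed
  with J show ?thesis by blast
qed

text \<open>Direct summands of finite graded free modules are free. The cover is shrunk to a minimal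
  one, whose kernel has all coordinates in \<open>A\<^sub>+\<close>; it still splits, and this
  forces the kernel to vanish.\<close>

lemma split_surjection_imp_graded_free:
  assumes J0: "finite J0" and F: "graded_left_module A F"
    and \<pi>: "\<pi> \<in> gmod_hom A (free_gmod A J0 e) F"
    and \<sigma>: "\<sigma> \<in> gmod_hom A F (free_gmod A J0 e)" "\<And>y. y \<in> carrier F \<Longrightarrow> \<pi> (\<sigma> y) = y"
  shows "graded_free A F" "finitely_generated A F"
proof -
  interpret F: graded_left_module A F by fact
  have surj: "\<pi> ` carrier (free_gmod A J0 e) = carrier F"
    using gmod_hom_closed[OF \<pi>] gmod_hom_closed[OF \<sigma>(1)] \<sigma>(2) by force
  obtain J where J: "J \<subseteq> J0" "\<pi> ` carrier (free_gmod A J e) = carrier F"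
    and pos': "\<forall>x\<in>carrier (free_gmod A J e). \<pi> x = \<zero>\<^bsub>F\<^esub> \<longrightarrow> (\<forall>i\<in>J. x i \<in> pos_part A)"
    using split_surjection_imp_minimal_cover[OF J0 F \<pi> surj] by (elim exE conjE)
  have pos: "x i \<in> pos_part A" if "x \<in> carrier (free_gmod A J e)" "\<pi> x = \<zero>\<^bsub>F\<^esub>" "i \<in> J" for x i
    using pos' that by simp
  have fJ: "finite J" using J(1) J0 finite_subset by blast
  let ?L = "free_gmod A J e"
  have L: "graded_left_module A ?L" by (rule free_graded[OF fJ])
  interpret L: graded_left_module A ?L by fact
  have "lincomb F J (\<lambda>i. \<pi> (fbasis A i)) \<in> gmod_hom A ?L F"
    by (rule lincomb_hom[OF fJ F]) (use gmod_hom_grade[OF \<pi> fbasis_grade] J(1) in blast)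
  moreover have "lincomb F J (\<lambda>i. \<pi> (fbasis A i)) x = \<pi> x" if x: "x \<in> carrier ?L" for x
  proof -
    have x0: "x \<in> carrier (free_gmod A J0 e)" using x free_mono(1)[OF J(1)] by blast
    have c: "x i \<odot>\<^bsub>F\<^esub> \<pi> (fbasis A i) \<in> carrier F" if "i \<in> J0" for i
      by (rule F.smult_closed[OF free_coord_closed[OF x] gmod_hom_closed[OF \<pi> fbasis_carrier[OF that]]])
    have "lincomb F J (\<lambda>i. \<pi> (fbasis A i)) x = lincomb F J0 (\<lambda>i. \<pi> (fbasis A i)) x"
      unfolding lincomb_def
    proof (rule F.M.finsum_neutral[OF J0 J(1)])
      show "x i \<odot>\<^bsub>F\<^esub> \<pi> (fbasis A i) \<in> carrier F" if "i \<in> J" for i using c J(1) that by blast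
      show "x i \<odot>\<^bsub>F\<^esub> \<pi> (fbasis A i) = \<zero>\<^bsub>F\<^esub>" if "i \<in> J0 - J" for i
        using that x F.zero_smult[OF gmod_hom_closed[OF \<pi> fbasis_carrier]] by (simp add: free_simps)
    qed
    then show ?thesis using gmod_hom_free_eq_lincomb[OF J0 F.M.abelian_group_axioms \<pi> x0] by simp
  qed
  ultimately have \<pi>L: "\<pi> \<in> gmod_hom A ?L F" by (rule gmod_hom_cong[OF _ _ L])
  have "\<pi> (fbasis A i) \<in> \<pi> ` carrier ?L" if "i \<in> J0" for i
    unfolding J(2) by (rule gmod_hom_closed[OF \<pi> fbasis_carrier[OF that]])
  \<comment> \<open>The given section takes values in the larger free module. \<open>t\<close> maps
    that module to \<open>?L\<close> compatibly with \<open>\<pi>\<close>, so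
    \<open>t \<sigma>\<close> is a section of the smaller cover.\<close>
  then obtain t where t: "t \<in> gmod_hom A (free_gmod A J0 e) ?L"
      "\<And>x. x \<in> carrier (free_gmod A J0 e) \<Longrightarrow> \<pi> (t x) = \<pi> x"
    using free_lift[OF J0 L F \<pi> \<pi>L] by blast
  define s where "s y = t (\<sigma> y)" for y
  have s: "s \<in> gmod_hom A F ?L" unfolding s_def by (rule gmod_hom_comp[OF \<sigma>(1) t(1)])
  have \<pi>s: "\<pi> (s y) = y" if "y \<in> carrier F" for y
    unfolding s_def using t(2)[OF gmod_hom_closed[OF \<sigma>(1) that]] \<sigma>(2)[OF that] by simp
  \<comment> \<open>The projection of \<open>?L\<close> onto the kernel of \<open>\<pi>\<close>
    along the image of \<open>s\<close>.\<close>
  define h where "h x = x \<ominus>\<^bsub>?L\<^esub> s (\<pi> x)" for x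
  have s\<pi>: "(\<lambda>x. s (\<pi> x)) \<in> gmod_hom A ?L ?L" by (rule gmod_hom_comp[OF \<pi>L s])
  have h: "h \<in> gmod_hom A ?L ?L"
    unfolding h_def[abs_def] by (rule gmod_hom_diff[OF L L gmod_hom_ident s\<pi>])
  have s0: "s \<zero>\<^bsub>F\<^esub> = \<zero>\<^bsub>?L\<^esub>"
    by (rule add_hom_zero[OF F.M.abelian_group_axioms L.M.abelian_group_axioms gmod_hom_hom[OF s]])
  have \<pi>h: "\<pi> (h x) = \<zero>\<^bsub>F\<^esub>" if x: "x \<in> carrier ?L" for x
  proof -
    have "\<pi> (h x) = \<pi> x \<ominus>\<^bsub>F\<^esub> \<pi> (s (\<pi> x))"
      unfolding h_def by (rule add_hom_minus[OF L.M.abelian_group_axioms F.M.abelian_group_axioms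
        gmod_hom_hom[OF \<pi>L] x gmod_hom_closed[OF s\<pi> x]])
    then show ?thesis using \<pi>s gmod_hom_closed[OF \<pi>L x] by (simp add: F.M.minus_zero_iff)
  qed
  \<comment> \<open>A lower bound for the degrees of the generators, which makes induction on the
    degree possible: a kernel element of degree k is a combination of the kernel elements
    \<open>h (fbasis A i)\<close> with coefficients of positive degree, so only those with
    \<open>e i < k\<close> occur.\<close>
  obtain m where m: "\<And>i. i \<in> J \<Longrightarrow> m \<le> e i"
    using fJ by (metis Min_le finite_imageI imageI)
  \<comment> \<open>Nakayama: the kernel \<open>C\<close> is a direct summand contained in \<open>A\<^sub>+ L\<close>, so \<open>C = A\<^sub>+ C\<close>.\<close>
  have hom0: "x = \<zero>\<^bsub>?L\<^esub>" if "x \<in> grade ?L k" "\<pi> x = \<zero>\<^bsub>F\<^esub>" for x k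
    using that
  proof (induction "nat (k - m)" arbitrary: k x rule: less_induct)
    case less
    have x: "x \<in> carrier ?L" by (rule L.GM.g_carrier[OF less.prems(1)])
    have "x = h x" using x less.prems(2) by (simp add: h_def s0 L.M.minus_zero_right)
    also have "\<dots> = lincomb ?L J (\<lambda>i. h (fbasis A i)) x"
      by (rule gmod_hom_free_eq_lincomb[OF fJ L.M.abelian_group_axioms h x])
    also have "\<dots> = \<zero>\<^bsub>?L\<^esub>"
      unfolding lincomb_def
    proof (rule L.M.finsum_zero')
      fix i assume i: "i \<in> J"
      have hc: "h (fbasis A i) \<in> carrier ?L" by (rule gmod_hom_closed[OF h fbasis_carrier[OF i]])
      show "x i \<odot>\<^bsub>?L\<^esub> h (fbasis A i) = \<zero>\<^bsub>?L\<^esub>"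
      proof (cases "x i = \<zero>")
        case True
        then show ?thesis using L.zero_smult[OF hc] by simp
      next
        case False
        have "x i \<in> rgrade A (k - e i)" using less.prems(1) i by (simp add: free_simps)
        from pos_homogeneous_degree[OF this pos[OF x less.prems(2) i] False]
        have "nat (e i - m) < nat (k - m)" using m[OF i] by linarith
        from less.hyps[OF this gmod_hom_grade[OF h fbasis_grade[OF i]] \<pi>h[OF fbasis_carrier[OF i]]]
        show ?thesis using L.smult_zero[OF free_coord_closed[OF x]] by simp
      qed
    qed
    finally show ?case .
  qed
  have inj0: "x = \<zero>\<^bsub>?L\<^esub>" if x: "x \<in> carrier ?L" "\<pi> x = \<zero>\<^bsub>F\<^esub>" for x
  proof -
    have "hcomp ?L (grade ?L) x k = \<zero>\<^bsub>?L\<^esub>" for k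
      by (rule hom0[OF L.GM.hcomp_grade[OF x(1)]])
        (use gmod_hom_hcomp[OF L F \<pi>L x(1), of k] x(2) F.GM.hcomp_homogeneous[OF F.GM.g_zero] in simp)
    then show ?thesis using L.GM.hcomp_sum[OF x(1)] by simp
  qed
  have "inj_on \<pi> (carrier ?L)"
  proof (rule inj_onI)
    fix x y assume xy: "x \<in> carrier ?L" "y \<in> carrier ?L" "\<pi> x = \<pi> y"
    then have "\<pi> (x \<ominus>\<^bsub>?L\<^esub> y) = \<zero>\<^bsub>F\<^esub>"
      using add_hom_minus[OF L.M.abelian_group_axioms F.M.abelian_group_axioms gmod_hom_hom[OF \<pi>L] xy(1,2)]
        gmod_hom_closed[OF \<pi>L xy(2)] by (simp add: F.M.minus_zero_iff)
    from inj0[OF _ this] xy show "x = y" by (simp add: L.M.minus_zero_iff)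
  qed
  then have "bij_betw \<pi> (carrier ?L) (carrier F)" using J(2) by (simp add: bij_betw_def)
  from free_iso_imp_graded_free[OF fJ F \<pi>L this]
  show "graded_free A F" "finitely_generated A F" .
qed

end

section \<open>Submodules of free modules over noetherian rings\<close>

text \<open>Submodules are taken without grading, like the left ideals in
  \<open>left_noetherian\<close>. The carrier of \<open>free_gmod\<close> does not depend on the
  degrees, so 0 stands for any choice of them. Closure under negation follows from the scalar
  -1.\<close>

definition coord_submodule :: "'a gring \<Rightarrow> 'i set \<Rightarrow> ('i \<Rightarrow> 'a) set \<Rightarrow> bool" where
  "coord_submodule A J U \<longleftrightarrow> U \<subseteq> carrier (free_gmod A J (\<lambda>_. 0)) \<and> (\<lambda>_. \<zero>\<^bsub>A\<^esub>) \<in> U \<and>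
     (\<forall>x\<in>U. \<forall>y\<in>U. (\<lambda>i. x i \<oplus>\<^bsub>A\<^esub> y i) \<in> U) \<and> (\<forall>a\<in>carrier A. \<forall>x\<in>U. (\<lambda>i. a \<otimes>\<^bsub>A\<^esub> x i) \<in> U)"

context graded_ring
begin

lemma regular_left_module: "left_module A (regular_module A)"
proof (intro left_module.intro left_module_axioms.intro ring_axioms)
  show "abelian_group (regular_module A)"
    by (rule abelian_groupI) (auto simp: regular_module_def a_assoc intro: a_comm intro!: bexI[of _ "\<ominus> _"] l_neg)
qed (auto simp: regular_module_def l_distr r_distr m_assoc)

lemma regular_simps:
  "carrier (regular_module A) = carrier A" "zero (regular_module A) = \<zero>"
  "add (regular_module A) = add A" "smult (regular_module A) = mult A" "grade (regular_module A) = rgrade A"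
  by (auto simp: regular_module_def)

lemma regular_id_hom: "(\<lambda>x. x) \<in> hom (add_monoid A) (add_monoid (regular_module A))"
  by (simp add: hom_def regular_simps)

lemma regular_abelian_group: "abelian_group (regular_module A)"
proof -
  interpret R: left_module A "regular_module A" by (rule regular_left_module)
  show ?thesis by (rule R.M.abelian_group_axioms)
qed

lemma regular_finsum:
  "finite J \<Longrightarrow> (\<And>i. i \<in> J \<Longrightarrow> c i \<in> carrier A) \<Longrightarrow> finsum (regular_module A) c J = finsum A c J"
  by (rule add_hom_finsum[OF abelian_group_axioms regular_abelian_group regular_id_hom, symmetric])

lemma regular_a_inv: "x \<in> carrier A \<Longrightarrow> \<ominus>\<^bsub>regular_module A\<^esub> x = \<ominus> x"
  by (rule add_hom_a_inv[OF abelian_group_axioms regular_abelian_group regular_id_hom, symmetric])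

lemma coord_submoduleD:
  assumes "coord_submodule A J U"
  shows "x \<in> U \<Longrightarrow> x i \<in> carrier A" "x \<in> U \<Longrightarrow> i \<notin> J \<Longrightarrow> x i = \<zero>" "(\<lambda>_. \<zero>) \<in> U"
    "x \<in> U \<Longrightarrow> y \<in> U \<Longrightarrow> (\<lambda>i. x i \<oplus> y i) \<in> U" "a \<in> carrier A \<Longrightarrow> x \<in> U \<Longrightarrow> (\<lambda>i. a \<otimes> x i) \<in> U"
proof -
  have sub: "x \<in> U \<Longrightarrow> x \<in> carrier (free_gmod A J (\<lambda>_. 0))" for x
    using assms unfolding coord_submodule_def by blast
  show "x \<in> U \<Longrightarrow> x i \<in> carrier A" by (rule free_coord_closed[OF sub])
  show "x \<in> U \<Longrightarrow> i \<notin> J \<Longrightarrow> x i = \<zero>" using sub[of x] by (simp add: free_simps)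
qed (use assms in \<open>simp_all add: coord_submodule_def\<close>)

lemma coord_submodule_minus:
  assumes "coord_submodule A J U" "x \<in> U" "y \<in> U"
  shows "(\<lambda>i. x i \<ominus> y i) \<in> U"
proof -
  have "(\<lambda>i. \<ominus> \<one> \<otimes> y i) \<in> U" by (rule coord_submoduleD(5)[OF assms(1) _ assms(3)]) simp
  then have "(\<lambda>i. \<ominus> y i) \<in> U" using coord_submoduleD(1)[OF assms(1,3)] by (simp add: l_minus)
  from coord_submoduleD(4)[OF assms(1,2) this] show ?thesis by (simp add: a_minus_def)
qed

text \<open>Finite generation is phrased by the universal property, which avoids finite sums.\<close>

lemma noetherian_coord_submodule:
  assumes noeth: "left_noetherian A" and J: "finite J" and U: "coord_submodule A J U"
  shows "\<exists>S. finite S \<and> S \<subseteq> U \<and> (\<forall>V. coord_submodule A J V \<longrightarrow> S \<subseteq> V \<longrightarrow> U \<subseteq> V)"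
  using J U
proof (induction J arbitrary: U rule: finite_induct)
  case empty
  have "x = (\<lambda>_. \<zero>)" if "x \<in> U" for x
    using coord_submoduleD(2)[OF empty that] by auto
  then have "U \<subseteq> V" if "coord_submodule A {} V" for V
    using coord_submoduleD(3)[OF that] by blast
  then show ?case by (intro exI[of _ "{}"]) simp
next
  case (insert j J)
  note U = insert.prems
  interpret R: left_module A "regular_module A" by (rule regular_left_module)
  \<comment> \<open>Reduction of the rank by one: the j-th coordinates of \<open>U\<close> form a
    left ideal, finitely generated by assumption, and the vectors of \<open>U\<close> with j-th
    coordinate 0 form a submodule for the smaller index set.\<close>
  let ?I = "(\<lambda>u. u j) ` U"
  have "submodule ?I A (regular_module A)"
  proof (intro submodule.intro submodule_axioms.intro R.M.add.subgroupI)
    show "?I \<noteq> {}" using coord_submoduleD(3)[OF U] by blast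
    show "\<ominus>\<^bsub>regular_module A\<^esub> x \<in> ?I" if x: "x \<in> ?I" for x
    proof -
      obtain u where u: "u \<in> U" "x = u j" using x by blast
      have "(\<lambda>i. \<zero> \<ominus> u i) \<in> U" by (rule coord_submodule_minus[OF U coord_submoduleD(3)[OF U] u(1)])
      then have "\<zero> \<ominus> x \<in> ?I" using u(2) by (intro image_eqI[of _ _ "\<lambda>i. \<zero> \<ominus> u i"]) simp_all
      moreover have "x \<in> carrier A" using coord_submoduleD(1)[OF U u(1)] u(2) by simp
      then have "\<ominus>\<^bsub>regular_module A\<^esub> x = \<zero> \<ominus> x"
        by (simp add: regular_a_inv a_minus_def)
      ultimately show ?thesis by simp
    qed
    show "?I \<subseteq> carrier (regular_module A)"
      using coord_submoduleD(1)[OF U] by (auto simp: regular_simps)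
    show "x \<oplus>\<^bsub>regular_module A\<^esub> y \<in> ?I" if "x \<in> ?I" "y \<in> ?I" for x y
    proof -
      obtain u v where "u \<in> U" "x = u j" "v \<in> U" "y = v j" using \<open>x \<in> ?I\<close> \<open>y \<in> ?I\<close> by blast
      then show ?thesis
        using coord_submoduleD(4)[OF U, of u v] by (intro image_eqI[of _ _ "\<lambda>i. u i \<oplus> v i"]) (simp_all add: regular_simps)
    qed
    show "a \<odot>\<^bsub>regular_module A\<^esub> x \<in> ?I" if "a \<in> carrier A" "x \<in> ?I" for a x
    proof -
      obtain u where "u \<in> U" "x = u j" using \<open>x \<in> ?I\<close> by blast
      then show ?thesis
        using coord_submoduleD(5)[OF U \<open>a \<in> carrier A\<close>, of u]
        by (intro image_eqI[of _ _ "\<lambda>i. a \<otimes> u i"]) (simp_all add: regular_simps)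
    qed
  qed
  with noeth obtain SI where SI: "finite SI" "SI \<subseteq> ?I" "?I = set_smult (regular_module A) (carrier A) SI"
    unfolding left_noetherian_def by meson
  have "\<exists>u. u \<in> U \<and> u j = s" if "s \<in> SI" for s using subsetD[OF SI(2) that] by auto
  then have "\<forall>s\<in>SI. \<exists>u. u \<in> U \<and> u j = s" by simp
  from bchoice[OF this] obtain w where w': "\<forall>s\<in>SI. w s \<in> U \<and> w s j = s" ..
  have w: "w s \<in> U" "w s j = s" if "s \<in> SI" for s using w' that by simp_all
  have cut: "coord_submodule A J {v \<in> V. v j = \<zero>}" if V: "coord_submodule A (insert j J) V" for V
    unfolding coord_submodule_def
  proof (intro conjI ballI subsetI)
    fix v assume v: "v \<in> {v \<in> V. v j = \<zero>}"
    then have "v i = \<zero>" if "i \<notin> J" for i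
      using that coord_submoduleD(2)[OF V, of v i] by (cases "i = j") auto
    with v show "v \<in> carrier (free_gmod A J (\<lambda>_. 0))"
      using coord_submoduleD(1)[OF V, of v] by (auto simp: free_simps)
  qed (use coord_submoduleD(3-5)[OF V] in auto)
  from insert.IH[OF cut[OF U]] obtain S' where S': "finite S'" "S' \<subseteq> {u \<in> U. u j = \<zero>}"
    "\<And>V. coord_submodule A J V \<Longrightarrow> S' \<subseteq> V \<Longrightarrow> {u \<in> U. u j = \<zero>} \<subseteq> V" by blast
  show ?case
  proof (intro exI[of _ "w ` SI \<union> S'"] conjI allI impI)
    show "finite (w ` SI \<union> S')" using SI(1) S'(1) by simp
    show "w ` SI \<union> S' \<subseteq> U" using w(1) S'(2) by blast
    fix V assume V: "coord_submodule A (insert j J) V" and SV: "w ` SI \<union> S' \<subseteq> V"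
    have U'V: "u \<in> V" if "u \<in> U" "u j = \<zero>" for u
      using S'(3)[OF cut[OF V]] S'(2) SV that by blast
    \<comment> \<open>The vector with prescribed j-th coordinate is found in \<open>U\<close> and
      \<open>V\<close> at once. Its difference from a given \<open>u\<close> then lies in
      \<open>U\<close> and has j-th coordinate 0, so that the induction hypothesis puts it into
      \<open>V\<close>.\<close>
    have ex: "\<exists>v. v \<in> V \<and> v \<in> U \<and> v j = b" if "b \<in> set_smult (regular_module A) (carrier A) SI" for b
      using that unfolding set_smult_def
    proof (induction b rule: generate.induct)
      case one
      then show ?case using coord_submoduleD(3)[OF V] coord_submoduleD(3)[OF U]
        by (intro exI[of _ "\<lambda>_. \<zero>"]) (simp add: regular_simps)
    next
      case (incl b)
      then obtain a s where as: "a \<in> carrier A" "s \<in> SI" "b = a \<otimes> s" by (auto simp: regular_simps)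
      then show ?case
        using coord_submoduleD(5)[OF V as(1), of "w s"] coord_submoduleD(5)[OF U as(1), of "w s"] w[OF as(2)] SV
        by (intro exI[of _ "\<lambda>i. a \<otimes> w s i"]) auto
    next
      case (inv b)
      then obtain a s where as: "a \<in> carrier A" "s \<in> SI" "b = a \<otimes> s" by (auto simp: regular_simps)
      have sc: "s \<in> carrier A" using SI(2) as(2) coord_submoduleD(1)[OF U] by blast
      have "inv\<^bsub>add_monoid (regular_module A)\<^esub> b = \<ominus> b"
        using regular_a_inv[of b] as sc by (simp add: a_inv_def)
      also have "\<dots> = (\<ominus> a) \<otimes> s" using as sc by (simp add: l_minus)
      finally show ?case
        using coord_submoduleD(5)[OF V _, of "\<ominus> a" "w s"] coord_submoduleD(5)[OF U, of "\<ominus> a" "w s"] w[OF as(2)] SV as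
        by (intro exI[of _ "\<lambda>i. \<ominus> a \<otimes> w s i"]) auto
    next
      case (eng b1 b2)
      then obtain v1 v2 where "v1 \<in> V" "v1 \<in> U" "v1 j = b1" "v2 \<in> V" "v2 \<in> U" "v2 j = b2" by blast
      then show ?case
        using coord_submoduleD(4)[OF V, of v1 v2] coord_submoduleD(4)[OF U, of v1 v2]
        by (intro exI[of _ "\<lambda>i. v1 i \<oplus> v2 i"]) (simp add: regular_simps)
    qed
    show "U \<subseteq> V"
    proof
      fix u assume u: "u \<in> U"
      then have "u j \<in> set_smult (regular_module A) (carrier A) SI" using SI(3) by blast
      from ex[OF this] obtain v where v: "v \<in> V" "v \<in> U" "v j = u j" by (elim exE conjE)
      note uc = coord_submoduleD(1)[OF U u] and vc = coord_submoduleD(1)[OF U v(2)]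
      have "(\<lambda>i. u i \<ominus> v i) \<in> V"
        by (rule U'V[OF coord_submodule_minus[OF U u v(2)]]) (simp add: v(3) uc minus_zero_iff)
      from coord_submoduleD(4)[OF V this v(1)] show "u \<in> V"
        by (simp add: minus_add_cancel uc vc)
    qed
  qed
qed

end

section \<open>Reduced factorizations\<close>

locale normal_regular = connected_graded_algebra K A for K and A :: "'a gring" (structure) +
  fixes f :: 'a and n :: int
  assumes n_pos: "n > 0" and f_grade: "f \<in> rgrade A n"
    and normal: "normal_element A f" and regular: "regular_element A f"
begin

lemma f_closed [simp]: "f \<in> carrier A" using f_grade by (rule G.g_carrier)

lemma f_pos: "f \<in> pos_part A" using homogeneous_pos[OF f_grade] n_pos by simp

lemma f_left_zero: "a \<in> carrier A \<Longrightarrow> f \<otimes> a = \<zero> \<Longrightarrow> a = \<zero>"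
  using regular unfolding regular_element_def by blast

lemma f_right_zero: "a \<in> carrier A \<Longrightarrow> a \<otimes> f = \<zero> \<Longrightarrow> a = \<zero>"
  using regular unfolding regular_element_def by blast

lemma f_left_cancel:
  assumes "a \<in> carrier A" "b \<in> carrier A" "f \<otimes> a = f \<otimes> b" shows "a = b"
proof -
  have "f \<otimes> (a \<ominus> b) = \<zero>" using assms by (simp add: a_minus_def r_distr r_minus r_neg)
  then have "a \<ominus> b = \<zero>" by (rule f_left_zero[OF minus_closed[OF assms(1,2)]])
  then show ?thesis using assms(1,2) by (simp only: minus_zero_iff)
qed

lemma f_right_cancel:
  assumes "a \<in> carrier A" "b \<in> carrier A" "a \<otimes> f = b \<otimes> f" shows "a = b"
proof -
  have "(a \<ominus> b) \<otimes> f = \<zero>" using assms by (simp add: a_minus_def l_distr l_minus r_neg)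
  then have "a \<ominus> b = \<zero>" by (rule f_right_zero[OF minus_closed[OF assms(1,2)]])
  then show ?thesis using assms(1,2) by (simp only: minus_zero_iff)
qed

lemma f_ne_zero: "f \<noteq> \<zero>"
proof
  assume f0: "f = \<zero>"
  have "\<one> = \<zero>" by (rule f_left_zero) (simp_all add: f0)
  then show False using sub_one_not_zero by simp
qed

lemma normal_left: "a \<in> carrier A \<Longrightarrow> \<exists>b\<in>carrier A. f \<otimes> a = b \<otimes> f"
  using normal unfolding normal_element_def l_coset_def r_coset_def by blast

lemma normal_right: "a \<in> carrier A \<Longrightarrow> \<exists>b\<in>carrier A. a \<otimes> f = f \<otimes> b"
  using normal unfolding normal_element_def l_coset_def r_coset_def by blast

lemma normalizing_aut:
  assumes "a \<in> carrier A"
  shows "normalizing_aut A f a \<in> carrier A" "a \<otimes> f = f \<otimes> normalizing_aut A f a"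
proof -
  obtain b where b: "b \<in> carrier A" "a \<otimes> f = f \<otimes> b" using normal_right[OF assms] by blast
  have "\<exists>!b. b \<in> carrier A \<and> a \<otimes> f = f \<otimes> b"
    by (rule ex1I[of _ b]) (use b f_left_cancel in auto)
  from theI'[OF this, folded normalizing_aut_def]
  show "normalizing_aut A f a \<in> carrier A" "a \<otimes> f = f \<otimes> normalizing_aut A f a" by auto
qed

lemma hdeg_f: "hdeg A f = n"
  unfolding hdeg_def
proof (rule the_equality)
  show "f \<in> rgrade A n" by (rule f_grade)
  fix m assume "f \<in> rgrade A m"
  then show "m = n"
    using G.hcomp_homogeneous[OF f_grade, of m] G.hcomp_homogeneous[of f m m] f_ne_zero
    by (auto split: if_splits)
qed

section \<open>The two-sided ideal generated by f, and linear functionals modulo it\<close>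

abbreviation "I \<equiv> Idl {f}"

lemma I_ideal: "ideal I A" by (rule genideal_ideal) simp

text \<open>Normality makes fA closed under multiplication from the left, so it is already a
  two-sided ideal. Both this description and \<open>I_right\<close> are needed: division by f takes
  place on the right, while the values of functionals arise as left multiples of f.\<close>

lemma I_left: "x \<in> I \<longleftrightarrow> (\<exists>a\<in>carrier A. x = f \<otimes> a)"
proof
  interpret I: ideal I A by (rule I_ideal)
  have f: "f \<in> I" by (rule genideal_self') simp
  show "x \<in> I" if "\<exists>a\<in>carrier A. x = f \<otimes> a" using that I.I_r_closed[OF f] by blast
  have "ideal {x. \<exists>a\<in>carrier A. x = f \<otimes> a} A"
  proof (rule idealI[OF ring_axioms], rule add.subgroupI)
    show "{x. \<exists>a\<in>carrier A. x = f \<otimes> a} \<subseteq> carrier A" by auto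
    show "{x. \<exists>a\<in>carrier A. x = f \<otimes> a} \<noteq> {}" by auto
    show "\<ominus> x \<in> {x. \<exists>a\<in>carrier A. x = f \<otimes> a}" if "x \<in> {x. \<exists>a\<in>carrier A. x = f \<otimes> a}" for x
      using that by (auto simp: r_minus intro!: bexI[of _ "\<ominus> _"])
    show "x \<oplus> y \<in> {x. \<exists>a\<in>carrier A. x = f \<otimes> a}"
      if "x \<in> {x. \<exists>a\<in>carrier A. x = f \<otimes> a}" "y \<in> {x. \<exists>a\<in>carrier A. x = f \<otimes> a}" for x y
      using that by (auto simp: r_distr[symmetric])
    fix a x assume "a \<in> {x. \<exists>a\<in>carrier A. x = f \<otimes> a}" and x: "x \<in> carrier A"
    then obtain b where b: "b \<in> carrier A" "a = f \<otimes> b" by blast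
    then show "a \<otimes> x \<in> {x. \<exists>a\<in>carrier A. x = f \<otimes> a}"
      using x m_assoc[of f b x] by auto
    obtain c where c: "c \<in> carrier A" "x \<otimes> f = f \<otimes> c" using normal_right[OF x] by blast
    have "x \<otimes> a = f \<otimes> (c \<otimes> b)" using b c x by (metis f_closed m_assoc)
    then show "x \<otimes> a \<in> {x. \<exists>a\<in>carrier A. x = f \<otimes> a}" using b c by blast
  qed
  moreover have "f \<in> {x. \<exists>a\<in>carrier A. x = f \<otimes> a}"
    by (auto intro!: bexI[of _ \<one>])
  ultimately have "I \<subseteq> {x. \<exists>a\<in>carrier A. x = f \<otimes> a}" by (intro genideal_minimal) auto
  then show "\<exists>a\<in>carrier A. x = f \<otimes> a" if "x \<in> I" using that by blast
qed

lemma I_right: "x \<in> I \<longleftrightarrow> (\<exists>a\<in>carrier A. x = a \<otimes> f)"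
  unfolding I_left using normal_left normal_right by metis

lemma I_pos: "x \<in> I \<Longrightarrow> x \<in> pos_part A"
  using pos_mult_right f_pos by (auto simp: I_left)

text \<open>For a vector x of the free module G on \<open>J\<close> this says that x lies in fG, as
  \<open>I\<close> = fA = Af.\<close>

definition ideal_coords :: "'i set \<Rightarrow> ('i \<Rightarrow> 'a) \<Rightarrow> bool" where
  "ideal_coords J x \<longleftrightarrow> (\<forall>i\<in>J. x i \<in> I)"

lemma lincomb_regular_pos:
  assumes J: "finite J" and x: "\<And>i. i \<in> J \<Longrightarrow> x i \<in> pos_part A" and c: "\<And>i. i \<in> J \<Longrightarrow> c i \<in> carrier A"
  shows "lincomb (regular_module A) J c x \<in> pos_part A"
proof -
  have "x i \<otimes> c i \<in> pos_part A" if "i \<in> J" for i by (rule pos_mult_right[OF c[OF that] x[OF that]])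
  moreover from this have "lincomb (regular_module A) J c x = (\<Oplus>i\<in>J. x i \<otimes> c i)"
    unfolding lincomb_def regular_simps by (intro regular_finsum J pos_carrier)
  ultimately show ?thesis by (simp only:) (rule pos_finsum)
qed

text \<open>The value is a combination of the coordinates with coefficients on the right, and
  \<open>A\<^sub>+\<close> is a right ideal. This is the obstruction to trivial summands of the form
  (id, f).\<close>

lemma linear_functional_pos:
  assumes J: "finite J" and q: "q \<in> hom (add_monoid (free_gmod A J e)) (add_monoid A)"
    and sm: "\<And>a x. a \<in> carrier A \<Longrightarrow> x \<in> carrier (free_gmod A J e) \<Longrightarrow>
      q (a \<odot>\<^bsub>free_gmod A J e\<^esub> x) = a \<otimes> q x"
    and x: "x \<in> carrier (free_gmod A J e)" "\<And>i. i \<in> J \<Longrightarrow> x i \<in> pos_part A"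
  shows "q x \<in> pos_part A"
proof -
  have q': "q \<in> hom (add_monoid (free_gmod A J e)) (add_monoid (regular_module A))"
    using q by (simp add: hom_def regular_simps)
  have "q x = lincomb (regular_module A) J (\<lambda>i. q (fbasis A i)) x"
    by (rule hom_free_eq_lincomb[OF J regular_abelian_group q' _ x(1)]) (simp add: sm regular_simps)
  also have "\<dots> \<in> pos_part A"
    by (rule lincomb_regular_pos[OF J x(2)]) (use add_hom_closed[OF q fbasis_carrier] in auto)
  finally show ?thesis .
qed

text \<open>This excludes trivial summands \<open>(f, id)\<close>.
  A functional \<open>q\<close> on \<open>G1\<close> with \<open>q F1 \<subseteq> I\<close> is a map from \<open>G1/F1\<close>, a submodule of
  \<open>G0/fG0\<close>, to \<open>A/I\<close>. The section \<open>s\<close> gives an extension \<open>\<theta> = q s\<close> of it to \<open>F0\<close>, and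
  \<open>f \<theta>(z) = \<theta>(f z)\<close> expresses \<open>\<theta>(z)\<close> by the coordinates of \<open>z\<close>, which have positive degree.\<close>

lemma functional_pos:
  fixes e1 :: "'j \<Rightarrow> int" and e0 :: "'i \<Rightarrow> int"
  assumes J1: "finite J1" and J0: "finite J0"
  defines "G1 \<equiv> free_gmod A J1 e1" and "G0 \<equiv> free_gmod A J0 e0"
  assumes h: "h \<in> gmod_hom A G1 G0"
    and F1: "F1 = {x \<in> carrier G1. ideal_coords J0 (h x)}"
    and F0: "graded_left_module A (sub_gmodule G0 F0)" "F0 \<subseteq> carrier G0"
    and F0h: "\<And>x. x \<in> carrier G1 \<Longrightarrow> h x \<in> F0"
    and F0f: "\<And>y. y \<in> carrier G0 \<Longrightarrow> ideal_coords J0 y \<Longrightarrow> y \<in> F0"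
    and s: "s \<in> gmod_hom A (sub_gmodule G0 F0) G1"
      "\<And>z. z \<in> F0 \<Longrightarrow> ideal_coords J0 (h (s z) \<ominus>\<^bsub>G0\<^esub> z)"
    and F0pos: "\<And>z i. z \<in> F0 \<Longrightarrow> i \<in> J0 \<Longrightarrow> z i \<in> pos_part A"
    and q: "q \<in> hom (add_monoid G1) (add_monoid A)"
      "\<And>a x. a \<in> carrier A \<Longrightarrow> x \<in> carrier G1 \<Longrightarrow> q (a \<odot>\<^bsub>G1\<^esub> x) = a \<otimes> q x"
      "\<And>x. x \<in> F1 \<Longrightarrow> q x \<in> I"
    and u: "u \<in> carrier G1"
  shows "q u \<in> pos_part A"
proof -
  interpret G1: graded_left_module A G1 unfolding G1_def by (rule free_graded[OF J1])
  interpret G0: graded_left_module A G0 unfolding G0_def by (rule free_graded[OF J0])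
  let ?F = "sub_gmodule G0 F0"
  interpret F: graded_left_module A ?F by (rule F0(1))
  interpret I: ideal I A by (rule I_ideal)
  have Fs: "carrier ?F = F0" "add ?F = add G0" "smult ?F = smult G0" by (simp_all add: sub_gmodule_def)
  have sc: "s z \<in> carrier G1" if "z \<in> F0" for z using gmod_hom_closed[OF s(1)] that by (simp add: Fs)
  have hc: "h x \<in> carrier G0" if "x \<in> carrier G1" for x by (rule gmod_hom_closed[OF h that])
  have qc: "q x \<in> carrier A" if "x \<in> carrier G1" for x by (rule add_hom_closed[OF q(1) that])
  let ?z = "h u"
  have z: "?z \<in> F0" by (rule F0h[OF u])
  have zG: "?z \<in> carrier G0" by (rule hc[OF u])
  have zc: "?z i \<in> carrier A" for i by (rule free_coord_closed[OF zG[unfolded G0_def]])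
  \<comment> \<open>\<open>h (s ?z)\<close> agrees with \<open>?z = h u\<close> modulo
    \<open>f G0\<close>. So replacing \<open>u\<close> by \<open>s ?z\<close> changes the value of
    \<open>q\<close> only by an element of \<open>I\<close>, hence of
    \<open>A\<^sub>+\<close>.\<close>
  have d: "s ?z \<ominus>\<^bsub>G1\<^esub> u \<in> F1"
    unfolding F1 using s(2)[OF z] sc[OF z] u
    by (simp add: add_hom_minus[OF G1.M.abelian_group_axioms G0.M.abelian_group_axioms gmod_hom_hom[OF h]])
  have "q (s ?z \<ominus>\<^bsub>G1\<^esub> u) = q (s ?z) \<ominus> q u"
    by (rule add_hom_minus[OF G1.M.abelian_group_axioms abelian_group_axioms q(1) sc[OF z] u])
  with I_pos[OF q(3)[OF d]] have dpos: "q (s ?z) \<ominus> q u \<in> pos_part A" by simp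
  \<comment> \<open>A left linear parametrization of \<open>f G0\<close> by \<open>G0\<close>. The
    map \<open>\<theta>\<close> lives on \<open>F0\<close>, for which no basis is at hand; composed
    with \<open>r\<close> it becomes a functional \<open>H\<close> on \<open>G0\<close>, determined
    by its values on unit vectors.\<close>
  define r where "r y = (\<lambda>i. y i \<otimes> f)" for y :: "'i \<Rightarrow> 'a"
  have rF: "r y \<in> F0" if "y \<in> carrier G0" for y
  proof (rule F0f)
    show "r y \<in> carrier G0" using that by (auto simp: r_def G0_def free_simps)
    show "ideal_coords J0 (r y)"
      unfolding ideal_coords_def I_right r_def using free_coord_closed[OF that[unfolded G0_def]] by auto
  qed
  define H where "H y = q (s (r y))" for y
  have H: "H \<in> hom (add_monoid G0) (add_monoid (regular_module A))"
  proof -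
    have "H (x \<oplus>\<^bsub>G0\<^esub> y) = H x \<oplus> H y" if xy: "x \<in> carrier G0" "y \<in> carrier G0" for x y
    proof -
      have "x i \<in> carrier A" "y i \<in> carrier A" for i
        using free_coord_closed[OF xy(1)[unfolded G0_def]] free_coord_closed[OF xy(2)[unfolded G0_def]] .
      then have "r (x \<oplus>\<^bsub>G0\<^esub> y) = r x \<oplus>\<^bsub>?F\<^esub> r y"
        unfolding Fs by (simp add: r_def G0_def free_simps(3) l_distr)
      then have "s (r (x \<oplus>\<^bsub>G0\<^esub> y)) = s (r x) \<oplus>\<^bsub>G1\<^esub> s (r y)"
        using gmod_hom_add[OF s(1), of "r x" "r y"] rF xy by (simp add: Fs)
      then show ?thesis
        unfolding H_def using add_hom_add[OF q(1) sc[OF rF[OF xy(1)]] sc[OF rF[OF xy(2)]]] by simp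
    qed
    then show ?thesis using qc[OF sc[OF rF]] by (auto simp: hom_def regular_simps H_def)
  qed
  have Hsm: "H (a \<odot>\<^bsub>G0\<^esub> y) = a \<odot>\<^bsub>regular_module A\<^esub> H y" if ay: "a \<in> carrier A" "y \<in> carrier G0" for a y
  proof -
    have "y i \<in> carrier A" for i using free_coord_closed[OF ay(2)[unfolded G0_def]] .
    then have "r (a \<odot>\<^bsub>G0\<^esub> y) = a \<odot>\<^bsub>?F\<^esub> r y"
      unfolding Fs using ay(1) by (simp add: r_def G0_def free_simps(4) m_assoc)
    then have "s (r (a \<odot>\<^bsub>G0\<^esub> y)) = a \<odot>\<^bsub>G1\<^esub> s (r y)"
      using gmod_hom_smult[OF s(1) ay(1), of "r y"] rF[OF ay(2)] by (simp add: Fs)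
    then show ?thesis
      unfolding H_def using q(2)[OF ay(1) sc[OF rF[OF ay(2)]]] by (simp add: regular_simps)
  qed
  \<comment> \<open>Normality moves f to the other side in every coordinate, which exhibits
    \<open>f ?z\<close> as the value of \<open>r\<close> at the vector of the
    \<open>w i\<close>.\<close>
  have "\<exists>w\<in>carrier A. f \<otimes> ?z i = w \<otimes> f" for i by (rule normal_left[OF zc])
  then obtain w where w: "\<And>i. w i \<in> carrier A" "\<And>i. f \<otimes> ?z i = w i \<otimes> f" by metis
  let ?w = "\<lambda>i. if i \<in> J0 then w i else \<zero>"
  have wG: "?w \<in> carrier G0" using w(1) by (simp add: G0_def free_simps)
  have rw: "r ?w = f \<odot>\<^bsub>G0\<^esub> ?z"
  proof
    fix i show "r ?w i = (f \<odot>\<^bsub>G0\<^esub> ?z) i"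
      using zG w(2)[of i, symmetric] by (simp add: r_def G0_def free_simps)
  qed
  \<comment> \<open>\<open>r (fbasis A i)\<close> lies in \<open>f G0\<close>, hence so does its
    image under \<open>h s\<close>. This means that \<open>s\<close> sends it into
    \<open>F1\<close>, on which \<open>q\<close> takes values in \<open>I\<close>.\<close>
  have HI: "H (fbasis A i) \<in> I" if i: "i \<in> J0" for i
  proof -
    have eG: "fbasis A i \<in> carrier G0" unfolding G0_def by (rule fbasis_carrier[OF i])
    let ?y = "r (fbasis A i)"
    have y: "?y \<in> F0" by (rule rF[OF eG])
    have yI: "?y k \<in> I" for k
      using free_coord_closed[OF eG[unfolded G0_def], of k] unfolding r_def I_right by blast
    have hs: "h (s ?y) \<in> carrier G0" by (rule hc[OF sc[OF y]])
    have "h (s ?y) k \<in> I" if "k \<in> J0" for k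
    proof -
      have yG: "?y \<in> carrier G0" using y F0(2) by blast
      have "(h (s ?y) \<ominus>\<^bsub>G0\<^esub> ?y) k \<in> I" using s(2)[OF y] that unfolding ideal_coords_def by blast
      then have "h (s ?y) k \<ominus> ?y k \<in> I"
        using free_minus[OF hs[unfolded G0_def] yG[unfolded G0_def], of k] by (simp add: G0_def)
      then have "h (s ?y) k \<ominus> ?y k \<oplus> ?y k \<in> I" using yI[of k] I.a_closed by simp
      moreover have "h (s ?y) k \<in> carrier A" by (rule free_coord_closed[OF hs[unfolded G0_def]])
      ultimately show ?thesis using minus_add_cancel[of "h (s ?y) k" "?y k"] I.a_Hcarr[OF yI[of k]] by simp
    qed
    then have "s ?y \<in> F1" unfolding F1 ideal_coords_def using sc[OF y] by simp
    then show ?thesis unfolding H_def by (rule q(3))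
  qed
  have "\<exists>c\<in>carrier A. H (fbasis A i) = f \<otimes> c" if "i \<in> J0" for i using HI[OF that] I_left by blast
  then obtain c where c: "\<And>i. i \<in> J0 \<Longrightarrow> c i \<in> carrier A" "\<And>i. i \<in> J0 \<Longrightarrow> H (fbasis A i) = f \<otimes> c i"
    by metis
  have pz: "?z i \<otimes> c i \<in> pos_part A" if "i \<in> J0" for i
    by (rule pos_mult_right[OF c(1)[OF that] F0pos[OF z that]])
  let ?t = "\<Oplus>i\<in>J0. ?z i \<otimes> c i"
  have tpos: "?t \<in> pos_part A" by (rule pos_finsum[OF pz])
  \<comment> \<open>With \<open>H (fbasis A i) = f \<otimes> c i\<close> the factors
    \<open>w i \<otimes> f\<close> turn back into \<open>f \<otimes> ?z i\<close>, so f stands on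
    the left of every term and can be cancelled. What remains is a combination of the coordinates of
    \<open>?z\<close>, which are in \<open>A\<^sub>+\<close>.\<close>
  have "f \<otimes> q (s ?z) = q (f \<odot>\<^bsub>G1\<^esub> s ?z)" by (rule q(2)[OF f_closed sc[OF z], symmetric])
  also have "\<dots> = q (s (f \<odot>\<^bsub>?F\<^esub> ?z))"
    using gmod_hom_smult[OF s(1) f_closed, of ?z] z by (simp add: Fs)
  also have "\<dots> = H ?w" by (simp add: Fs H_def rw)
  also have "\<dots> = lincomb (regular_module A) J0 (\<lambda>i. H (fbasis A i)) ?w"
    by (rule hom_free_eq_lincomb[OF J0 regular_abelian_group H[unfolded G0_def] Hsm[unfolded G0_def]
      wG[unfolded G0_def]])
  also have "\<dots> = (\<Oplus>i\<in>J0. ?w i \<otimes> H (fbasis A i))"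
    unfolding lincomb_def regular_simps
    by (rule regular_finsum[OF J0]) (use w(1) HI I.a_Hcarr in auto)
  also have "\<dots> = (\<Oplus>i\<in>J0. f \<otimes> (?z i \<otimes> c i))"
  proof (rule finsum_cong')
    fix i assume i: "i \<in> J0"
    have "?w i \<otimes> H (fbasis A i) = (w i \<otimes> f) \<otimes> c i" using i c w(1) by (simp add: m_assoc)
    also have "\<dots> = f \<otimes> (?z i \<otimes> c i)" unfolding w(2)[symmetric] using i c zc by (simp add: m_assoc)
    finally show "?w i \<otimes> H (fbasis A i) = f \<otimes> (?z i \<otimes> c i)" .
  qed (use c zc in auto)
  also have "\<dots> = f \<otimes> ?t"
    by (rule finsum_rdistr[OF J0 f_closed, symmetric]) (use c zc in auto)
  finally have "q (s ?z) = ?t"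
    by (rule f_left_cancel[OF qc[OF sc[OF z]] pos_carrier[OF tpos]])
  then have 1: "q (s ?z) \<in> pos_part A" using tpos by simp
  interpret Pos: additive_subgroup "pos_part A" A by (rule pos_additive_subgroup)
  have "q (s ?z) \<oplus> \<ominus> (q (s ?z) \<ominus> q u) \<in> pos_part A"
    by (rule Pos.a_closed[OF 1 Pos.a_inv_closed[OF dpos]])
  also have "q (s ?z) \<oplus> \<ominus> (q (s ?z) \<ominus> q u) = q u"
    using qc[OF u] qc[OF sc[OF z]] by (simp add: a_minus_def minus_add r_neg2)
  finally show ?thesis .
qed

text \<open>Only \<open>\<tau>\<close> needs an argument. By a f = f \<sigma>(a), the twisted action
  is the one for which multiplication by f becomes linear, and the shift by -n in
  \<open>twist\<close> compensates the degree of f.\<close>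

lemma inclusion_factorization:
  fixes e :: "'i \<Rightarrow> int"
  assumes J: "finite J"
  defines "G \<equiv> free_gmod A J e"
  assumes F: "graded_free A (sub_gmodule G F)" "finitely_generated A (sub_gmodule G F)"
    and sub: "F \<subseteq> carrier G" and fG: "\<And>y. y \<in> carrier G \<Longrightarrow> f \<odot>\<^bsub>G\<^esub> y \<in> F"
  shows "twisted_matrix_factorization A f
    \<lparr> fac_F = sub_gmodule G F, fac_G = G, fac_phi = \<lambda>x. x, fac_tau = \<lambda>x. f \<odot>\<^bsub>G\<^esub> x \<rparr>"
proof -
  interpret G: graded_left_module A G unfolding G_def by (rule free_graded[OF J])
  note gmod_hom_ident[of A G]
  moreover have "bij_betw (\<lambda>x. x) (carrier G) (carrier G)" by (simp add: bij_betw_def)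
  ultimately have free: "graded_free A G" "finitely_generated A G"
    using free_iso_imp_graded_free[OF J G.graded_left_module_axioms] unfolding G_def by blast+
  have phi: "(\<lambda>x. x) \<in> gmod_hom A (sub_gmodule G F) G"
    by (rule gmod_homI) (use sub in \<open>auto simp: sub_gmodule_def\<close>)
  have tw: "carrier (twist A f G) = carrier G" "add (twist A f G) = add G"
    "smult (twist A f G) = (\<lambda>a x. normalizing_aut A f a \<odot>\<^bsub>G\<^esub> x)"
    "grade (twist A f G) = (\<lambda>i. grade G (i - n))"
    by (simp_all add: twist_def shift_def hdeg_f)
  have tau: "(\<lambda>x. f \<odot>\<^bsub>G\<^esub> x) \<in> gmod_hom A (twist A f G) (sub_gmodule G F)"
  proof (rule gmod_homI)
    fix a x assume a: "a \<in> carrier A" and x: "x \<in> carrier (twist A f G)"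
    have "f \<odot>\<^bsub>G\<^esub> (normalizing_aut A f a \<odot>\<^bsub>G\<^esub> x) = (f \<otimes> normalizing_aut A f a) \<odot>\<^bsub>G\<^esub> x"
      using normalizing_aut(1)[OF a] x by (simp add: tw G.smult_assoc)
    also have "\<dots> = a \<odot>\<^bsub>G\<^esub> (f \<odot>\<^bsub>G\<^esub> x)"
      using normalizing_aut(2)[OF a, symmetric] a x by (simp add: tw G.smult_assoc)
    finally show "f \<odot>\<^bsub>G\<^esub> (a \<odot>\<^bsub>twist A f G\<^esub> x) = a \<odot>\<^bsub>sub_gmodule G F\<^esub> (f \<odot>\<^bsub>G\<^esub> x)"
      by (simp add: tw sub_gmodule_def)
  next
    fix x i assume x: "x \<in> grade (twist A f G) i"
    then have "f \<odot>\<^bsub>G\<^esub> x \<in> grade G (n + (i - n))"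
      unfolding tw by (rule G.smult_grade[OF f_grade])
    moreover have "f \<odot>\<^bsub>G\<^esub> x \<in> F" using x G.GM.g_carrier unfolding tw by (intro fG) blast
    ultimately show "f \<odot>\<^bsub>G\<^esub> x \<in> grade (sub_gmodule G F) i" by (simp add: sub_gmodule_def)
  qed (use fG in \<open>auto simp: sub_gmodule_def tw G.smult_r_distr\<close>)
  show ?thesis
    unfolding twisted_matrix_factorization_def
    using F free phi tau by (simp add: sub_gmodule_def)
qed

lemma sum_gmodule_simps:
  "carrier (sum_gmodule M N) = carrier M \<times> carrier N"
  "x \<oplus>\<^bsub>sum_gmodule M N\<^esub> y = (fst x \<oplus>\<^bsub>M\<^esub> fst y, snd x \<oplus>\<^bsub>N\<^esub> snd y)"
  "a \<odot>\<^bsub>sum_gmodule M N\<^esub> x = (a \<odot>\<^bsub>M\<^esub> fst x, a \<odot>\<^bsub>N\<^esub> snd x)"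
  by (simp_all add: sum_gmodule_def case_prod_unfold)

text \<open>Projecting \<open>G1\<close> to the rank one module of a trivial summand gives a
  functional \<open>q\<close>, and for either form of the summand some vector has value 1. The
  contradiction is that \<open>q\<close> takes values in \<open>A\<^sub>+\<close>: on all of
  \<open>G1\<close> by \<open>functional_pos\<close> for (f, id), and on \<open>F1\<close> by
  \<open>linear_functional_pos\<close> for (id, f).\<close>

lemma reduced_inclusion_factorization:
  fixes e1 :: "nat \<Rightarrow> int" and e0 :: "'i \<Rightarrow> int"
  assumes J1: "finite J1" and J0: "finite J0"
  defines "G1 \<equiv> free_gmod A J1 e1" and "G0 \<equiv> free_gmod A J0 e0"
  assumes h: "h \<in> gmod_hom A G1 G0"
    and F1: "F1 = {x \<in> carrier G1. ideal_coords J0 (h x)}"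
      "graded_free A (sub_gmodule G1 F1)" "finitely_generated A (sub_gmodule G1 F1)"
    and F0: "graded_left_module A (sub_gmodule G0 F0)" "F0 \<subseteq> carrier G0"
    and F0h: "\<And>x. x \<in> carrier G1 \<Longrightarrow> h x \<in> F0"
    and F0f: "\<And>y. y \<in> carrier G0 \<Longrightarrow> ideal_coords J0 y \<Longrightarrow> y \<in> F0"
    and s: "s \<in> gmod_hom A (sub_gmodule G0 F0) G1"
      "\<And>z. z \<in> F0 \<Longrightarrow> ideal_coords J0 (h (s z) \<ominus>\<^bsub>G0\<^esub> z)"
    and F0pos: "\<And>z i. z \<in> F0 \<Longrightarrow> i \<in> J0 \<Longrightarrow> z i \<in> pos_part A"
    and F1pos: "\<And>z i. z \<in> F1 \<Longrightarrow> i \<in> J1 \<Longrightarrow> z i \<in> pos_part A"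
  shows "reduced_factorization A f
    \<lparr> fac_F = sub_gmodule G1 F1, fac_G = G1, fac_phi = \<lambda>x. x, fac_tau = \<lambda>x. f \<odot>\<^bsub>G1\<^esub> x \<rparr>"
    (is "reduced_factorization A f ?X")
proof -
  interpret G1: graded_left_module A G1 unfolding G1_def by (rule free_graded[OF J1])
  have F1sub: "F1 \<subseteq> carrier G1" by (auto simp: F1(1))
  have fF1: "f \<odot>\<^bsub>G1\<^esub> y \<in> F1" if y: "y \<in> carrier G1" for y
  proof -
    have hy: "h y \<in> carrier G0" by (rule gmod_hom_closed[OF h y])
    have "h (f \<odot>\<^bsub>G1\<^esub> y) i = f \<otimes> h y i" for i
      using gmod_hom_smult[OF h f_closed y] by (simp add: G0_def free_simps(4))
    moreover have "f \<otimes> h y i \<in> I" for i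
      using free_coord_closed[OF hy[unfolded G0_def], of i] unfolding I_left by blast
    ultimately show ?thesis
      unfolding F1(1) ideal_coords_def using G1.smult_closed[OF f_closed y] by simp
  qed
  have X: "twisted_matrix_factorization A f ?X"
    using inclusion_factorization[OF J1 F1(2,3)[unfolded G1_def] F1sub[unfolded G1_def] fF1[unfolded G1_def]]
    by (simp add: G1_def)
  have False if Y: "twisted_matrix_factorization A f Y" and T: "trivial_factorization A f T"
    and iso: "factorization_isomorphic A ?X (sum_factorization Y T)" for Y :: "('a, nat \<Rightarrow> 'a) factorization" and T
  proof -
    obtain \<Psi>G \<Psi>F where \<Psi>G: "\<Psi>G \<in> gmod_iso A G1 (sum_gmodule (fac_G Y) (fac_G T))"
      and \<Psi>F: "\<Psi>F \<in> gmod_iso A (sub_gmodule G1 F1) (sum_gmodule (fac_F Y) (fac_F T))"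
      and comm: "\<And>x. x \<in> F1 \<Longrightarrow> \<Psi>G x = map_prod (fac_phi Y) (fac_phi T) (\<Psi>F x)"
      using iso unfolding factorization_isomorphic_def sum_factorization_def
      by (auto simp: sub_gmodule_def)
    have \<Psi>Gh: "\<Psi>G \<in> gmod_hom A G1 (sum_gmodule (fac_G Y) (fac_G T))"
      and \<Psi>Gb: "\<Psi>G ` carrier G1 = carrier (fac_G Y) \<times> carrier (fac_G T)"
      using \<Psi>G by (auto simp: gmod_iso_def bij_betw_def sum_gmodule_simps)
    have \<Psi>Fb: "\<Psi>F ` F1 = carrier (fac_F Y) \<times> carrier (fac_F T)"
      using \<Psi>F by (auto simp: gmod_iso_def bij_betw_def sum_gmodule_simps sub_gmodule_def)
    obtain m where m: "(fac_F T = twist A f (shift (regular_module A) m) \<and> fac_G T = shift (regular_module A) m \<and>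
         (\<forall>x \<in> carrier A. fac_phi T x = f \<otimes> x)) \<or>
       (fac_F T = shift (regular_module A) m \<and> fac_G T = shift (regular_module A) m \<and>
         (\<forall>x \<in> carrier A. fac_tau T x = f \<otimes> x))"
      using T unfolding trivial_factorization_def Let_def by (auto simp: shift_def regular_simps)
    have GT: "carrier (fac_G T) = carrier A" "add (fac_G T) = add A" "smult (fac_G T) = mult A"
      and FT: "carrier (fac_F T) = carrier A"
      using m by (auto simp: shift_def regular_simps twist_def)
    have YG: "graded_left_module A (fac_G Y)" and YF: "graded_left_module A (fac_F Y)"
      using Y by (auto simp: twisted_matrix_factorization_def graded_free_def)
    interpret YG: graded_left_module A "fac_G Y" by fact
    interpret YF: graded_left_module A "fac_F Y" by fact
    define q where "q x = snd (\<Psi>G x)" for x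
    have q: "q \<in> hom (add_monoid G1) (add_monoid A)"
      using gmod_hom_closed[OF \<Psi>Gh] gmod_hom_add[OF \<Psi>Gh]
      by (auto simp: hom_def q_def sum_gmodule_simps GT mem_Times_iff)
    have qsm: "q (a \<odot>\<^bsub>G1\<^esub> x) = a \<otimes> q x" if "a \<in> carrier A" "x \<in> carrier G1" for a x
      using gmod_hom_smult[OF \<Psi>Gh that] by (simp add: q_def sum_gmodule_simps GT)
    from m show False
    proof
      assume a: "fac_F T = twist A f (shift (regular_module A) m) \<and> fac_G T = shift (regular_module A) m \<and>
         (\<forall>x \<in> carrier A. fac_phi T x = f \<otimes> x)"
      \<comment> \<open>The commuting square of the isomorphism identifies \<open>q\<close> on
        \<open>F1\<close> with the second component of the map \<open>\<phi>\<close> of the sum,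
        which is multiplication by f in this case.\<close>
      have qI: "q x \<in> I" if "x \<in> F1" for x
      proof -
        have "\<Psi>F x \<in> carrier (fac_F Y) \<times> carrier (fac_F T)" using \<Psi>Fb that by blast
        then have "snd (\<Psi>F x) \<in> carrier A" using FT by (simp add: mem_Times_iff)
        moreover have "q x = fac_phi T (snd (\<Psi>F x))" using comm[OF that] by (simp add: q_def)
        ultimately show ?thesis using a unfolding I_left by auto
      qed
      have "(\<zero>\<^bsub>fac_G Y\<^esub>, \<one>) \<in> \<Psi>G ` carrier G1" unfolding \<Psi>Gb by (simp add: GT)
      then obtain u where u: "u \<in> carrier G1" "\<Psi>G u = (\<zero>\<^bsub>fac_G Y\<^esub>, \<one>)" by auto
      have "q u \<in> pos_part A"
        by (rule functional_pos[where ?F0.0 = F0 and ?F1.0 = F1 and h = h and s = s and q = q and u = u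
              and ?J1.0 = J1 and ?J0.0 = J0 and ?e1.0 = e1 and ?e0.0 = e0])
          (fact J1 J0 h[unfolded G1_def G0_def] F1(1)[unfolded G1_def G0_def]
            F0[unfolded G0_def] F0h[unfolded G1_def] F0f[unfolded G0_def] s[unfolded G1_def G0_def]
            F0pos q[unfolded G1_def] qsm[unfolded G1_def] qI u(1)[unfolded G1_def])+
      then show False using one_not_pos by (simp add: q_def u(2))
    next
      assume b: "fac_F T = shift (regular_module A) m \<and> fac_G T = shift (regular_module A) m \<and>
         (\<forall>x \<in> carrier A. fac_tau T x = f \<otimes> x)"
      have tmT: "twisted_matrix_factorization A f T" using T by (simp add: trivial_factorization_def)
      then have phiT: "fac_phi T \<in> gmod_hom A (fac_F T) (fac_G T)"
        "fac_tau T (fac_phi T \<one>) = f \<odot>\<^bsub>fac_F T\<^esub> \<one>"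
        using FT by (auto simp: twisted_matrix_factorization_def)
      have p1: "fac_phi T \<one> \<in> carrier A" using gmod_hom_closed[OF phiT(1), of \<one>] FT GT by simp
      \<comment> \<open>Only \<open>\<tau>\<close> is prescribed in this case. From
        \<open>\<tau> \<phi>\<close> being multiplication by f, cancelling f gives that
        \<open>\<phi>\<close> fixes 1.\<close>
      have "f \<otimes> fac_phi T \<one> = f \<otimes> \<one>"
        using phiT(2) b p1 by (simp add: shift_def regular_simps)
      then have p: "fac_phi T \<one> = \<one>" using f_left_cancel[OF p1, of \<one>] by simp
      have "(\<zero>\<^bsub>fac_F Y\<^esub>, \<one>) \<in> \<Psi>F ` F1" unfolding \<Psi>Fb by (simp add: FT)
      then obtain u where u: "u \<in> F1" "\<Psi>F u = (\<zero>\<^bsub>fac_F Y\<^esub>, \<one>)" by auto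
      have "q u = \<one>" using comm[OF u(1)] by (simp add: q_def u(2) p)
      moreover have "q u \<in> pos_part A"
        by (rule linear_functional_pos[OF J1 q[unfolded G1_def] qsm[unfolded G1_def]])
          (use u(1) F1sub F1pos[OF u(1)] in \<open>auto simp: G1_def\<close>)
      ultimately show False using one_not_pos by simp
    qed
  qed
  then show ?thesis unfolding reduced_factorization_def using X by blast
qed

end

section \<open>Modules over the quotient by a normal regular element\<close>

text \<open>Coordinates with respect to a basis that may be infinite. They are used to prove that
  the bases of the \<open>Q i\<close> are finite, before coordinates indexed by numbers are
  available.\<close>

definition basis_coeff :: "'a gring \<Rightarrow> ('a, 'm) gmodule \<Rightarrow> 'm set \<Rightarrow> 'm \<Rightarrow> 'm \<Rightarrow> 'a" where
  "basis_coeff A M S m = (THE c. c \<in> S \<rightarrow>\<^sub>E carrier A \<and> finite {s \<in> S. c s \<noteq> \<zero>\<^bsub>A\<^esub>} \<and>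
     m = (\<Oplus>\<^bsub>M\<^esub>s \<in> {s \<in> S. c s \<noteq> \<zero>\<^bsub>A\<^esub>}. c s \<odot>\<^bsub>M\<^esub> s))"

locale based_module = graded_left_module A M for A :: "'a gring" and M :: "('a, 'm) gmodule" (structure) +
  fixes S :: "'m set"
  assumes basis: "homogeneous_basis A M S"
begin

abbreviation "cf \<equiv> basis_coeff A M S"

lemma basis_carrier: "s \<in> S \<Longrightarrow> s \<in> carrier M"
  using basis GM.g_carrier unfolding homogeneous_basis_def by blast

lemma basis_ex1:
  assumes "m \<in> carrier M"
  shows "\<exists>!c. c \<in> S \<rightarrow>\<^sub>E carrier A \<and> finite {s \<in> S. c s \<noteq> \<zero>\<^bsub>A\<^esub>} \<and>
     m = (\<Oplus>\<^bsub>M\<^esub>s \<in> {s \<in> S. c s \<noteq> \<zero>\<^bsub>A\<^esub>}. c s \<odot>\<^bsub>M\<^esub> s)"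
  using basis assms unfolding homogeneous_basis_def by blast

lemma coeff_props:
  assumes "m \<in> carrier M"
  shows coeff_PiE: "cf m \<in> S \<rightarrow>\<^sub>E carrier A" and coeff_finite: "finite {s \<in> S. cf m s \<noteq> \<zero>\<^bsub>A\<^esub>}"
    and coeff_sum: "(\<Oplus>\<^bsub>M\<^esub>s \<in> {s \<in> S. cf m s \<noteq> \<zero>\<^bsub>A\<^esub>}. cf m s \<odot>\<^bsub>M\<^esub> s) = m"
proof -
  from theI'[OF basis_ex1[OF assms], folded basis_coeff_def]
  show "cf m \<in> S \<rightarrow>\<^sub>E carrier A" "finite {s \<in> S. cf m s \<noteq> \<zero>\<^bsub>A\<^esub>}"
    "(\<Oplus>\<^bsub>M\<^esub>s \<in> {s \<in> S. cf m s \<noteq> \<zero>\<^bsub>A\<^esub>}. cf m s \<odot>\<^bsub>M\<^esub> s) = m" by simp_all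
qed

lemma coeff_closed: "m \<in> carrier M \<Longrightarrow> s \<in> S \<Longrightarrow> cf m s \<in> carrier A"
  using PiE_mem[OF coeff_PiE] .

lemma coeff_unique:
  assumes L: "finite L" "L \<subseteq> S" and c: "\<And>s. s \<in> L \<Longrightarrow> c s \<in> carrier A"
    and m: "m = (\<Oplus>\<^bsub>M\<^esub>s\<in>L. c s \<odot>\<^bsub>M\<^esub> s)" and s: "s \<in> S"
  shows "cf m s = (if s \<in> L then c s else \<zero>\<^bsub>A\<^esub>)"
proof -
  let ?c = "\<lambda>s\<in>S. if s \<in> L then c s else \<zero>\<^bsub>A\<^esub>"
  have cs: "c s \<odot>\<^bsub>M\<^esub> s \<in> carrier M" if "s \<in> L" for s
    using smult_closed[OF c basis_carrier] that L(2) by blast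
  have mc: "m \<in> carrier M" unfolding m using cs by (intro M.finsum_closed) auto
  have T: "{s \<in> S. ?c s \<noteq> \<zero>\<^bsub>A\<^esub>} = {s \<in> L. c s \<noteq> \<zero>\<^bsub>A\<^esub>}" using L(2) by auto
  have "(\<Oplus>\<^bsub>M\<^esub>s\<in>{s \<in> S. ?c s \<noteq> \<zero>\<^bsub>A\<^esub>}. ?c s \<odot>\<^bsub>M\<^esub> s) = (\<Oplus>\<^bsub>M\<^esub>s\<in>{s \<in> L. c s \<noteq> \<zero>\<^bsub>A\<^esub>}. c s \<odot>\<^bsub>M\<^esub> s)"
    unfolding T by (rule M.finsum_cong') (use cs L(2) in auto)
  also have "\<dots> = m"
    unfolding m
  proof (rule M.finsum_neutral[OF L(1)])
    show "c s \<odot>\<^bsub>M\<^esub> s = \<zero>\<^bsub>M\<^esub>" if "s \<in> L - {s \<in> L. c s \<noteq> \<zero>\<^bsub>A\<^esub>}" for s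
      using that zero_smult[OF basis_carrier] L(2) by auto
  qed (use cs in auto)
  finally have sum: "m = (\<Oplus>\<^bsub>M\<^esub>s\<in>{s \<in> S. ?c s \<noteq> \<zero>\<^bsub>A\<^esub>}. ?c s \<odot>\<^bsub>M\<^esub> s)" by simp
  have "finite {s \<in> S. ?c s \<noteq> \<zero>\<^bsub>A\<^esub>}" unfolding T using L(1) by simp
  moreover have "?c \<in> S \<rightarrow>\<^sub>E carrier A" using c by auto
  ultimately have "cf m = ?c"
    unfolding basis_coeff_def using sum by (intro the1_equality[OF basis_ex1[OF mc]]) blast
  then show ?thesis using s by simp
qed

lemma coeff_sum_superset:
  assumes m: "m \<in> carrier M" and L: "finite L" "L \<subseteq> S" "\<And>s. s \<in> S \<Longrightarrow> cf m s \<noteq> \<zero>\<^bsub>A\<^esub> \<Longrightarrow> s \<in> L"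
  shows "(\<Oplus>\<^bsub>M\<^esub>s\<in>L. cf m s \<odot>\<^bsub>M\<^esub> s) = m"
proof -
  have "(\<Oplus>\<^bsub>M\<^esub>s\<in>{s \<in> S. cf m s \<noteq> \<zero>\<^bsub>A\<^esub>}. cf m s \<odot>\<^bsub>M\<^esub> s) = (\<Oplus>\<^bsub>M\<^esub>s\<in>L. cf m s \<odot>\<^bsub>M\<^esub> s)"
  proof (rule M.finsum_neutral[OF L(1)])
    show "cf m s \<odot>\<^bsub>M\<^esub> s = \<zero>\<^bsub>M\<^esub>" if "s \<in> L - {s \<in> S. cf m s \<noteq> \<zero>\<^bsub>A\<^esub>}" for s
      using that zero_smult[OF basis_carrier] L(2) by auto
  qed (use L(3) smult_closed[OF coeff_closed[OF m] basis_carrier] in auto)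
  then show ?thesis using coeff_sum[OF m] by simp
qed

lemma coeff_add:
  assumes m: "m \<in> carrier M" "m' \<in> carrier M" and s: "s \<in> S"
  shows "cf (m \<oplus>\<^bsub>M\<^esub> m') s = cf m s \<oplus>\<^bsub>A\<^esub> cf m' s"
proof -
  let ?L = "{s \<in> S. cf m s \<noteq> \<zero>\<^bsub>A\<^esub>} \<union> {s \<in> S. cf m' s \<noteq> \<zero>\<^bsub>A\<^esub>}"
  have L: "finite ?L" "?L \<subseteq> S" using coeff_finite[OF m(1)] coeff_finite[OF m(2)] by auto
  have c: "cf m s \<in> carrier A" "cf m' s \<in> carrier A" "cf m s \<odot>\<^bsub>M\<^esub> s \<in> carrier M" "cf m' s \<odot>\<^bsub>M\<^esub> s \<in> carrier M"
    if "s \<in> S" for s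
    using coeff_closed[OF m(1) that] coeff_closed[OF m(2) that] smult_closed basis_carrier[OF that] by blast+
  have "(\<Oplus>\<^bsub>M\<^esub>s\<in>?L. (cf m s \<oplus>\<^bsub>A\<^esub> cf m' s) \<odot>\<^bsub>M\<^esub> s) = (\<Oplus>\<^bsub>M\<^esub>s\<in>?L. cf m s \<odot>\<^bsub>M\<^esub> s \<oplus>\<^bsub>M\<^esub> cf m' s \<odot>\<^bsub>M\<^esub> s)"
    by (rule M.finsum_cong') (use c smult_l_distr basis_carrier in auto)
  also have "\<dots> = (\<Oplus>\<^bsub>M\<^esub>s\<in>?L. cf m s \<odot>\<^bsub>M\<^esub> s) \<oplus>\<^bsub>M\<^esub> (\<Oplus>\<^bsub>M\<^esub>s\<in>?L. cf m' s \<odot>\<^bsub>M\<^esub> s)"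
    by (rule M.finsum_addf) (use c in auto)
  also have "(\<Oplus>\<^bsub>M\<^esub>s\<in>?L. cf m s \<odot>\<^bsub>M\<^esub> s) = m" by (rule coeff_sum_superset[OF m(1) L]) auto
  also have "(\<Oplus>\<^bsub>M\<^esub>s\<in>?L. cf m' s \<odot>\<^bsub>M\<^esub> s) = m'" by (rule coeff_sum_superset[OF m(2) L]) auto
  finally have eq: "m \<oplus>\<^bsub>M\<^esub> m' = (\<Oplus>\<^bsub>M\<^esub>s\<in>?L. (cf m s \<oplus>\<^bsub>A\<^esub> cf m' s) \<odot>\<^bsub>M\<^esub> s)" by simp
  have "cf (m \<oplus>\<^bsub>M\<^esub> m') s = (if s \<in> ?L then cf m s \<oplus>\<^bsub>A\<^esub> cf m' s else \<zero>\<^bsub>A\<^esub>)"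
    by (rule coeff_unique[OF L _ eq s]) (use c in auto)
  then show ?thesis using s by (auto split: if_splits)
qed

lemma coeff_smult:
  assumes a: "a \<in> carrier A" and m: "m \<in> carrier M" and s: "s \<in> S"
  shows "cf (a \<odot>\<^bsub>M\<^esub> m) s = a \<otimes>\<^bsub>A\<^esub> cf m s"
proof -
  let ?L = "{s \<in> S. cf m s \<noteq> \<zero>\<^bsub>A\<^esub>}"
  have L: "finite ?L" "?L \<subseteq> S" using coeff_finite[OF m] by auto
  have c: "cf m s \<in> carrier A" "cf m s \<odot>\<^bsub>M\<^esub> s \<in> carrier M" if "s \<in> S" for s
    using coeff_closed[OF m that] smult_closed basis_carrier[OF that] by blast+
  have "a \<odot>\<^bsub>M\<^esub> m = a \<odot>\<^bsub>M\<^esub> (\<Oplus>\<^bsub>M\<^esub>s\<in>?L. cf m s \<odot>\<^bsub>M\<^esub> s)" using coeff_sum[OF m] by simp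
  also have "\<dots> = (\<Oplus>\<^bsub>M\<^esub>s\<in>?L. a \<odot>\<^bsub>M\<^esub> (cf m s \<odot>\<^bsub>M\<^esub> s))" by (rule smult_finsum[OF a L(1)]) (use c in auto)
  also have "\<dots> = (\<Oplus>\<^bsub>M\<^esub>s\<in>?L. (a \<otimes>\<^bsub>A\<^esub> cf m s) \<odot>\<^bsub>M\<^esub> s)"
    by (rule M.finsum_cong') (use c a smult_assoc basis_carrier smult_closed in auto)
  finally have eq: "a \<odot>\<^bsub>M\<^esub> m = (\<Oplus>\<^bsub>M\<^esub>s\<in>?L. (a \<otimes>\<^bsub>A\<^esub> cf m s) \<odot>\<^bsub>M\<^esub> s)" .
  have "cf (a \<odot>\<^bsub>M\<^esub> m) s = (if s \<in> ?L then a \<otimes>\<^bsub>A\<^esub> cf m s else \<zero>\<^bsub>A\<^esub>)"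
    by (rule coeff_unique[OF L _ eq s]) (use a c in auto)
  then show ?thesis using a s by (auto split: if_splits)
qed

lemma coeff_zero: "s \<in> S \<Longrightarrow> cf \<zero>\<^bsub>M\<^esub> s = \<zero>\<^bsub>A\<^esub>"
  using coeff_unique[of "{}" "\<lambda>_. \<zero>\<^bsub>A\<^esub>" "\<zero>\<^bsub>M\<^esub>" s] by simp

lemma coeff_basis: "s \<in> S \<Longrightarrow> cf s s = \<one>\<^bsub>A\<^esub>"
  using coeff_unique[of "{s}" "\<lambda>_. \<one>\<^bsub>A\<^esub>" s s] by (simp add: smult_one basis_carrier)

lemma coeff_hom: "s \<in> S \<Longrightarrow> (\<lambda>m. cf m s) \<in> hom (add_monoid M) (add_monoid A)"
  by (simp add: hom_def coeff_closed coeff_add)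

end

text \<open>Needed for records of different types with the same additive structure: \<open>B\<close>
  and \<open>A Quot I\<close>, or a module before and after restriction of scalars.\<close>

lemma direct_grading_transfer:
  fixes M :: "('m, 'x) ring_scheme" and N :: "('m, 'y) ring_scheme"
  assumes M: "abelian_group M" and eq: "carrier N = carrier M" "add N = add M" "zero N = zero M"
  shows "abelian_group N" and "direct_grading M g \<Longrightarrow> direct_grading N g"
proof -
  interpret M: abelian_group M by fact
  show N: "abelian_group N"
    by (rule abelian_groupI) (auto simp: eq M.a_assoc intro: M.a_comm intro!: bexI[of _ "\<ominus>\<^bsub>M\<^esub> _"] M.l_neg)
  interpret N: abelian_group N by fact
  have id: "(\<lambda>x. x) \<in> hom (add_monoid M) (add_monoid N)" by (simp add: hom_def eq)
  show "direct_grading N g" if "direct_grading M g"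
  proof (rule direct_gradingI[where pr = "hcomp M g", OF N])
    interpret M: graded_group M g by unfold_locales fact
    show "additive_subgroup (g i) N" for i
    proof (rule additive_subgroupI, rule N.add.subgroupI)
      fix x assume x: "x \<in> g i"
      have "\<ominus>\<^bsub>N\<^esub> x = \<ominus>\<^bsub>M\<^esub> x"
        using add_hom_a_inv[OF M N id M.g_carrier[OF x]] by simp
      then show "\<ominus>\<^bsub>N\<^esub> x \<in> g i" using M.g_inv[OF x] by simp
    next
      show "g i \<noteq> {}" using M.g_zero by blast
    qed (auto simp: eq M.g_add M.g_carrier)
    show "(\<lambda>x. hcomp M g x i) \<in> hom (add_monoid N) (add_monoid N)" for i
      by (simp add: hom_def eq M.hcomp_add)
    show "hcomp M g x i = (if i = j then x else \<zero>\<^bsub>N\<^esub>)" if "x \<in> g j" for i j x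
      using M.hcomp_homogeneous[OF that] by (simp add: eq)
    fix m assume "m \<in> carrier N"
    then have m: "m \<in> carrier M" by (simp add: eq)
    let ?S = "{i. hcomp M g m i \<noteq> \<zero>\<^bsub>M\<^esub>}"
    have "m = (\<Oplus>\<^bsub>N\<^esub>i\<in>?S. hcomp M g m i)"
      using add_hom_finsum[OF M N id M.hcomp_finite[OF m], of "hcomp M g m"] M.hcomp_sum[OF m] m by simp
    then show "\<exists>J c. finite J \<and> (\<forall>i\<in>J. c i \<in> g i) \<and> m = (\<Oplus>\<^bsub>N\<^esub>i\<in>J. c i)"
      using M.hcomp_finite[OF m] M.hcomp_grade[OF m]
      by (intro exI[of _ ?S] exI[of _ "hcomp M g m"]) simp
  qed
qed

locale hypersurface = normal_regular K A f n for K and A :: "'a gring" (structure) and f :: 'a and n +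
  fixes B :: "'a set gring"
  assumes B_def: "B = quot_gring A (Idl {f})"
begin

sublocale I: ideal I A by (rule I_ideal)

section \<open>The quotient ring, its ideal of positive degree, and restriction of scalars\<close>

abbreviation proj :: "'a \<Rightarrow> 'a set" where "proj a \<equiv> I +> a"

lemma B_simps:
  "carrier B = carrier (A Quot I)" "mult B = mult (A Quot I)" "one B = one (A Quot I)"
  "zero B = zero (A Quot I)" "add B = add (A Quot I)" "rgrade B i = proj ` rgrade A i"
  by (auto simp: B_def quot_gring_def ring.defs)

lemma proj_closed: "a \<in> carrier A \<Longrightarrow> proj a \<in> carrier B"
  using ring_hom_closed[OF I.rcos_ring_hom] by (simp add: B_simps)

lemma proj_surj: "b \<in> carrier B \<Longrightarrow> \<exists>a\<in>carrier A. b = proj a"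
  unfolding B_simps FactRing_def A_RCOSETS_def' by auto

lemma proj_add: "a \<in> carrier A \<Longrightarrow> b \<in> carrier A \<Longrightarrow> proj (a \<oplus> b) = proj a \<oplus>\<^bsub>B\<^esub> proj b"
  using ring_hom_add[OF I.rcos_ring_hom] by (simp add: B_simps)

lemma proj_mult: "a \<in> carrier A \<Longrightarrow> b \<in> carrier A \<Longrightarrow> proj (a \<otimes> b) = proj a \<otimes>\<^bsub>B\<^esub> proj b"
  using ring_hom_mult[OF I.rcos_ring_hom] by (simp add: B_simps)

lemma proj_one: "proj \<one> = \<one>\<^bsub>B\<^esub>"
  using ring_hom_one[OF I.rcos_ring_hom] by (simp add: B_simps)

lemma B_one_closed: "\<one>\<^bsub>B\<^esub> \<in> carrier B"
  unfolding proj_one[symmetric] by (rule proj_closed) simp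

lemma proj_eq_iff: "a \<in> carrier A \<Longrightarrow> b \<in> carrier A \<Longrightarrow> proj a = proj b \<longleftrightarrow> a \<ominus> b \<in> I"
  using quotient_eq_iff_same_a_r_cos[OF I_ideal] by simp

lemma proj_hom: "proj \<in> hom (add_monoid A) (add_monoid B)"
  by (simp add: hom_def proj_closed proj_add)

lemma B_ring: "ring B"
proof -
  interpret Q: ring "A Quot I" by (rule I.quotient_is_ring)
  show ?thesis
  proof (intro ring.intro ring_axioms.intro)
    show "abelian_group B" by (rule direct_grading_transfer(1)[OF Q.abelian_group_axioms]) (simp_all add: B_simps)
    show "monoid B" by (rule monoidI) (auto simp: B_simps Q.m_assoc)
  qed (auto simp: B_simps Q.l_distr Q.r_distr)
qed

lemma B_abelian_group: "abelian_group B"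
  by (rule ring.is_abelian_group[OF B_ring])

lemma proj_zero: "proj \<zero> = \<zero>\<^bsub>B\<^esub>"
  by (rule add_hom_zero[OF abelian_group_axioms B_abelian_group proj_hom])

lemma proj_eq_zero_iff: "a \<in> carrier A \<Longrightarrow> proj a = \<zero>\<^bsub>B\<^esub> \<longleftrightarrow> a \<in> I"
  unfolding proj_zero[symmetric] by (simp add: proj_eq_iff minus_zero_right)

text \<open>This is \<open>B\<^sub>+\<close>, taken as the image of \<open>A\<^sub>+\<close>.
  Because \<open>I\<close> is contained in \<open>A\<^sub>+\<close>, membership can be tested on any
  representative. It contains \<open>augmentation B\<close>, and through this inclusion the
  minimality of the resolution is used.\<close>

definition BP :: "'a set set" where "BP = proj ` pos_part A"

lemma proj_BP: "a \<in> carrier A \<Longrightarrow> proj a \<in> BP \<Longrightarrow> a \<in> pos_part A"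
proof -
  assume a: "a \<in> carrier A" and "proj a \<in> BP"
  then obtain b where b: "b \<in> pos_part A" "proj a = proj b" unfolding BP_def by blast
  then have "a \<ominus> b \<in> pos_part A" using I_pos proj_eq_iff[OF a pos_carrier[OF b(1)]] by simp
  from additive_subgroup.a_closed[OF pos_additive_subgroup this b(1)]
  show "a \<in> pos_part A" using a pos_carrier[OF b(1)] by (simp add: minus_add_cancel)
qed

lemma BP_subgroup: "additive_subgroup BP B"
proof (rule additive_subgroupI)
  interpret Bg: ring B by (rule B_ring)
  interpret Pos: additive_subgroup "pos_part A" A by (rule pos_additive_subgroup)
  show "subgroup BP (add_monoid B)"
  proof (rule Bg.add.subgroupI)
    show "BP \<subseteq> carrier B" using proj_closed pos_carrier by (auto simp: BP_def)
    show "BP \<noteq> {}" unfolding BP_def using Pos.zero_closed by blast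
    fix x assume "x \<in> BP"
    then obtain a where a: "a \<in> pos_part A" "x = proj a" by (auto simp: BP_def)
    have "\<ominus>\<^bsub>B\<^esub> x = proj (\<ominus> a)"
      using add_hom_a_inv[OF abelian_group_axioms B_abelian_group proj_hom pos_carrier[OF a(1)]] a(2)
      by simp
    then show "\<ominus>\<^bsub>B\<^esub> x \<in> BP" using Pos.a_inv_closed[OF a(1)] by (simp add: BP_def)
    fix y assume "y \<in> BP"
    then obtain b where b: "b \<in> pos_part A" "y = proj b" by (auto simp: BP_def)
    have "x \<oplus>\<^bsub>B\<^esub> y = proj (a \<oplus> b)"
      using proj_add[OF pos_carrier[OF a(1)] pos_carrier[OF b(1)]] a(2) b(2) by simp
    then show "x \<oplus>\<^bsub>B\<^esub> y \<in> BP" using Pos.a_closed[OF a(1) b(1)] by (simp add: BP_def)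
  qed
qed

lemma BP_mult:
  assumes "b \<in> carrier B" "x \<in> BP"
  shows "b \<otimes>\<^bsub>B\<^esub> x \<in> BP" "x \<otimes>\<^bsub>B\<^esub> b \<in> BP"
proof -
  obtain a where a: "a \<in> carrier A" "b = proj a" using proj_surj[OF assms(1)] by blast
  obtain c where c: "c \<in> pos_part A" "x = proj c" using assms(2) by (auto simp: BP_def)
  show "b \<otimes>\<^bsub>B\<^esub> x \<in> BP"
    using pos_mult_left[OF a(1) c(1)] proj_mult[OF a(1) pos_carrier[OF c(1)]] a(2) c(2) by (auto simp: BP_def)
  show "x \<otimes>\<^bsub>B\<^esub> b \<in> BP"
    using pos_mult_right[OF a(1) c(1)] proj_mult[OF pos_carrier[OF c(1)] a(1)] a(2) c(2) by (auto simp: BP_def)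
qed

lemma augmentation_BP: "augmentation B \<subseteq> BP"
proof -
  interpret Bg: ring B by (rule B_ring)
  have "(\<Union>k\<in>{0<..}. rgrade B k) \<subseteq> BP"
    using homogeneous_pos by (auto simp: B_simps BP_def)
  then show ?thesis
    unfolding augmentation_def
    by (rule Bg.add.generate_subgroup_incl) (rule additive_subgroup.a_subgroup[OF BP_subgroup])
qed

text \<open>The \<open>Q i\<close> are modules over \<open>B\<close>, while the comparison of
  resolutions takes place over \<open>A\<close>. As the elements of \<open>B\<close> are cosets, the
  two kinds of modules have different types and the passage has to be made explicit.\<close>

definition restrict_scalars :: "('a set, 'm) gmodule \<Rightarrow> ('a, 'm) gmodule" where
  "restrict_scalars M = \<lparr> carrier = carrier M, mult = undefined, one = undefined,
     zero = \<zero>\<^bsub>M\<^esub>, add = add M, smult = (\<lambda>a x. proj a \<odot>\<^bsub>M\<^esub> x), grade = grade M \<rparr>"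

lemma restrict_scalars_simps:
  "carrier (restrict_scalars M) = carrier M" "zero (restrict_scalars M) = zero M" "add (restrict_scalars M) = add M"
  "a \<odot>\<^bsub>restrict_scalars M\<^esub> x = proj a \<odot>\<^bsub>M\<^esub> x" "grade (restrict_scalars M) = grade M"
  by (simp_all add: restrict_scalars_def)

lemma restrict_scalars_graded:
  assumes "graded_left_module B M"
  shows "graded_left_module A (restrict_scalars M)"
proof -
  interpret M: graded_left_module B M by fact
  note tr = direct_grading_transfer[OF M.M.abelian_group_axioms restrict_scalars_simps(1,3,2)]
  show ?thesis
  proof (intro graded_left_module.intro left_module.intro left_module_axioms.intro
      graded_left_module_axioms.intro)
    show "direct_grading (restrict_scalars M) (grade (restrict_scalars M))" unfolding restrict_scalars_simps by (rule tr(2)[OF M.module_grading])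
    show "a \<odot>\<^bsub>restrict_scalars M\<^esub> x \<in> grade (restrict_scalars M) (i + j)" if "a \<in> rgrade A i" "x \<in> grade (restrict_scalars M) j" for a x i j
      unfolding restrict_scalars_simps by (rule M.smult_grade) (use that in \<open>auto simp: B_simps restrict_scalars_simps\<close>)
  qed (use tr(1) in \<open>auto simp: restrict_scalars_simps proj_closed M.smult_closed proj_add M.smult_l_distr
    M.smult_r_distr proj_mult M.smult_assoc proj_one M.smult_one graded_ring_axioms ring_axioms\<close>)
qed

lemma restrict_scalars_hom: "h \<in> gmod_hom B M N \<Longrightarrow> h \<in> gmod_hom A (restrict_scalars M) (restrict_scalars N)"
  by (rule gmod_homI) (auto simp: restrict_scalars_simps proj_closed gmod_homD)

lemma restrict_scalars_finsum:
  assumes "graded_left_module B M" "finite J" "\<And>i. i \<in> J \<Longrightarrow> c i \<in> carrier M"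
  shows "finsum (restrict_scalars M) c J = finsum M c J"
proof -
  interpret M: graded_left_module B M by fact
  interpret R: graded_left_module A "restrict_scalars M" by (rule restrict_scalars_graded) fact
  have "(\<lambda>x. x) \<in> hom (add_monoid M) (add_monoid (restrict_scalars M))" by (simp add: hom_def restrict_scalars_simps)
  from add_hom_finsum[OF M.M.abelian_group_axioms R.M.abelian_group_axioms this assms(2,3)]
  show ?thesis by simp
qed

text \<open>Minimality read in coordinates: taking a coordinate is linear, and
  \<open>B\<^sub>+\<close> is also closed under multiplication from the right.\<close>

lemma coeff_augmentation:
  assumes Q: "based_module B Q S" and m: "m \<in> set_smult Q (augmentation B) (carrier Q)" and s: "s \<in> S"
  shows "basis_coeff B Q S m s \<in> BP"
proof -
  interpret Q: based_module B Q S by fact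
  interpret BP: additive_subgroup BP B by (rule BP_subgroup)
  have "subgroup {m \<in> carrier Q. Q.cf m s \<in> BP} (add_monoid Q)"
  proof (rule Q.M.add.subgroupI)
    show "{m \<in> carrier Q. Q.cf m s \<in> BP} \<noteq> {}" using Q.coeff_zero[OF s] BP.zero_closed by fastforce
    fix m assume "m \<in> {m \<in> carrier Q. Q.cf m s \<in> BP}"
    then show "\<ominus>\<^bsub>Q\<^esub> m \<in> {m \<in> carrier Q. Q.cf m s \<in> BP}"
      using add_hom_a_inv[OF Q.M.abelian_group_axioms B_abelian_group Q.coeff_hom[OF s], of m]
        BP.a_inv_closed by simp
  qed (auto simp: Q.coeff_add[OF _ _ s])
  moreover have "{a \<odot>\<^bsub>Q\<^esub> x |a x. a \<in> augmentation B \<and> x \<in> carrier Q} \<subseteq> {m \<in> carrier Q. Q.cf m s \<in> BP}"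
  proof (clarify, intro conjI)
    fix a x assume "a \<in> augmentation B" and x: "x \<in> carrier Q"
    then have a: "a \<in> BP" "a \<in> carrier B" using augmentation_BP BP.a_subset by blast+
    show "a \<odot>\<^bsub>Q\<^esub> x \<in> carrier Q" by (rule Q.smult_closed[OF a(2) x])
    show "Q.cf (a \<odot>\<^bsub>Q\<^esub> x) s \<in> BP"
      unfolding Q.coeff_smult[OF a(2) x s] by (rule BP_mult(2)[OF Q.coeff_closed[OF x s] a(1)])
  qed
  ultimately have "set_smult Q (augmentation B) (carrier Q) \<subseteq> {m \<in> carrier Q. Q.cf m s \<in> BP}"
    unfolding set_smult_def by (intro Q.M.add.generate_subgroup_incl)
  with m show ?thesis by blast
qed

text \<open>Submodules, where closure under negation comes from the scalar -1. With
  \<open>fg_sub\<close>, finite generation of a submodule becomes a property of all submodules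
  containing the generators, which passes along maps by taking preimages.\<close>

definition closed_sub :: "('a set, 'm) gmodule \<Rightarrow> 'm set \<Rightarrow> bool" where
  "closed_sub T V \<longleftrightarrow> V \<subseteq> carrier T \<and> \<zero>\<^bsub>T\<^esub> \<in> V \<and> (\<forall>x\<in>V. \<forall>y\<in>V. x \<oplus>\<^bsub>T\<^esub> y \<in> V) \<and>
     (\<forall>b\<in>carrier B. \<forall>x\<in>V. b \<odot>\<^bsub>T\<^esub> x \<in> V)"

definition fg_sub :: "('a set, 'm) gmodule \<Rightarrow> 'm set \<Rightarrow> bool" where
  "fg_sub T Z \<longleftrightarrow> (\<exists>Y. finite Y \<and> Y \<subseteq> Z \<and> (\<forall>V. closed_sub T V \<longrightarrow> Y \<subseteq> V \<longrightarrow> Z \<subseteq> V))"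

lemma finitely_generated_fg_sub:
  assumes M: "graded_left_module B M" and fg: "finitely_generated B M"
  shows "fg_sub M (carrier M)"
proof -
  interpret M: graded_left_module B M by fact
  obtain S where S: "finite S" "S \<subseteq> carrier M" "carrier M = set_smult M (carrier B) S"
    using fg unfolding finitely_generated_def by (elim exE conjE)
  have "carrier M \<subseteq> V" if V: "closed_sub M V" and SV: "S \<subseteq> V" for V
  proof -
    have "submodule V B M"
    proof (intro submodule.intro submodule_axioms.intro M.M.add.subgroupI)
      show "V \<subseteq> carrier M" "V \<noteq> {}" using V by (auto simp: closed_sub_def)
      fix x assume x: "x \<in> V"
      have xc: "x \<in> carrier M" using x V by (auto simp: closed_sub_def)
      have "(\<ominus>\<^bsub>B\<^esub> \<one>\<^bsub>B\<^esub>) \<odot>\<^bsub>M\<^esub> x = \<ominus>\<^bsub>M\<^esub> x"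
        using add_hom_a_inv[OF B_abelian_group M.M.abelian_group_axioms M.scalar_hom[OF xc], of "\<one>\<^bsub>B\<^esub>"]
          M.smult_one[OF xc] B_one_closed by simp
      moreover have "(\<ominus>\<^bsub>B\<^esub> \<one>\<^bsub>B\<^esub>) \<odot>\<^bsub>M\<^esub> x \<in> V" using V x by (simp add: closed_sub_def)
      ultimately show "\<ominus>\<^bsub>M\<^esub> x \<in> V" by simp
    qed (use V in \<open>auto simp: closed_sub_def\<close>)
    from set_smult_subset[OF M.left_module_axioms this SV subset_refl] show ?thesis using S(3) by simp
  qed
  with S(1,2) show ?thesis unfolding fg_sub_def by blast
qed

end

lemma kernel_graded_left_module:
  assumes X: "graded_left_module A X" and Y: "graded_left_module A Y" and k: "k \<in> gmod_hom A X Y"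
  shows "graded_left_module A (sub_gmodule X {x \<in> carrier X. k x = \<zero>\<^bsub>Y\<^esub>})"
proof (rule sub_graded_left_module[OF X])
  interpret X: graded_left_module A X by fact
  interpret Y: graded_left_module A Y by fact
  have k0: "k \<zero>\<^bsub>X\<^esub> = \<zero>\<^bsub>Y\<^esub>"
    by (rule add_hom_zero[OF X.M.abelian_group_axioms Y.M.abelian_group_axioms gmod_hom_hom[OF k]])
  show "additive_subgroup {x \<in> carrier X. k x = \<zero>\<^bsub>Y\<^esub>} X"
  proof (rule additive_subgroupI, rule X.M.add.subgroupI)
    show "{x \<in> carrier X. k x = \<zero>\<^bsub>Y\<^esub>} \<noteq> {}" using k0 X.M.zero_closed by blast
    show "\<ominus>\<^bsub>X\<^esub> x \<in> {x \<in> carrier X. k x = \<zero>\<^bsub>Y\<^esub>}" if "x \<in> {x \<in> carrier X. k x = \<zero>\<^bsub>Y\<^esub>}" for x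
      using that add_hom_a_inv[OF X.M.abelian_group_axioms Y.M.abelian_group_axioms gmod_hom_hom[OF k], of x]
      by simp
  qed (auto simp: gmod_hom_add[OF k])
  show "a \<odot>\<^bsub>X\<^esub> x \<in> {x \<in> carrier X. k x = \<zero>\<^bsub>Y\<^esub>}"
    if "a \<in> carrier A" "x \<in> {x \<in> carrier X. k x = \<zero>\<^bsub>Y\<^esub>}" for a x
    using that by (simp add: X.smult_closed gmod_hom_smult[OF k] Y.smult_zero)
  show "hcomp X (grade X) x i \<in> {x \<in> carrier X. k x = \<zero>\<^bsub>Y\<^esub>}"
    if "x \<in> {x \<in> carrier X. k x = \<zero>\<^bsub>Y\<^esub>}" for x i
    using that gmod_hom_hcomp[OF X Y k, of x i] Y.GM.hcomp_homogeneous[OF Y.GM.g_zero] by simp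
qed

section \<open>Right division by f on the ideal that it generates\<close>

context normal_regular
begin

text \<open>The inverse of the bijection from A to \<open>I\<close> given by multiplication with f
  on the right. That side is chosen because the bijection is then left linear.\<close>

definition divf :: "'a \<Rightarrow> 'a" where
  "divf a = (THE b. b \<in> carrier A \<and> a = b \<otimes> f)"

lemma divf_eq: "b \<in> carrier A \<Longrightarrow> a = b \<otimes> f \<Longrightarrow> divf a = b"
  unfolding divf_def using f_right_cancel by (intro the_equality) auto

lemma divf: assumes "a \<in> I" shows "divf a \<in> carrier A" "divf a \<otimes> f = a"
proof -
  obtain b where "b \<in> carrier A" "a = b \<otimes> f" using assms unfolding I_right by blast
  then show "divf a \<in> carrier A" "divf a \<otimes> f = a" using divf_eq by simp_all
qed

lemma divf_add:
  assumes "a \<in> I" "b \<in> I" shows "divf (a \<oplus> b) = divf a \<oplus> divf b"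
  by (rule divf_eq) (use divf[OF assms(1)] divf[OF assms(2)] in \<open>simp_all add: l_distr\<close>)

lemma divf_mult:
  assumes "c \<in> carrier A" "a \<in> I" shows "divf (c \<otimes> a) = c \<otimes> divf a"
  by (rule divf_eq) (use divf[OF assms(2)] assms(1) in \<open>simp_all add: m_assoc\<close>)

lemma divf_zero: "divf \<zero> = \<zero>" by (rule divf_eq) simp_all

text \<open>The degree m component of b f is the degree m - n component of b, multiplied by f. If b
  f is homogeneous of degree m, cancelling f shows that b equals that component.\<close>

lemma divf_grade:
  assumes a: "a \<in> I" "a \<in> rgrade A m" shows "divf a \<in> rgrade A (m - n)"
proof -
  let ?b = "divf a"
  note b = divf[OF a(1)]
  have "hcomp A (rgrade A) (?b \<otimes> f) (m - n + n) = hcomp A (rgrade A) ?b (m - n) \<otimes> f"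
    by (rule hcomp_hom[OF G.graded_group_axioms G.graded_group_axioms _ _ b(1)])
      (auto simp: hom_def l_distr intro: mult_grade[OF _ f_grade])
  then have "?b \<otimes> f = hcomp A (rgrade A) ?b (m - n) \<otimes> f"
    using G.hcomp_homogeneous[OF a(2), of m] b(2) by simp
  then have "?b = hcomp A (rgrade A) ?b (m - n)"
    by (rule f_right_cancel[OF b(1) G.hcomp_carrier[OF b(1)]])
  then show ?thesis using G.hcomp_grade[OF b(1), of "m - n"] by simp
qed

end

section \<open>Finite rank of the terms of the resolution, their covers over \<open>A\<close>, and
  cokernels\<close>

context hypersurface
begin

lemma finite_basis:
  assumes Q: "based_module B Q S" and T: "graded_left_module B T" and D: "D \<in> gmod_hom B Q T"
    and fg: "fg_sub T (D ` carrier Q)"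
    and ker: "\<And>m. m \<in> carrier Q \<Longrightarrow> D m = \<zero>\<^bsub>T\<^esub> \<Longrightarrow> m \<in> set_smult Q (augmentation B) (carrier Q)"
  shows "finite S"
proof -
  interpret Q: based_module B Q S by fact
  interpret T: graded_left_module B T by fact
  interpret BP: additive_subgroup BP B by (rule BP_subgroup)
  obtain Y where Y: "finite Y" "Y \<subseteq> D ` carrier Q"
    "\<And>V. closed_sub T V \<Longrightarrow> Y \<subseteq> V \<Longrightarrow> D ` carrier Q \<subseteq> V"
    using fg unfolding fg_sub_def by (elim exE conjE) simp
  have "\<forall>y\<in>Y. \<exists>m. m \<in> carrier Q \<and> D m = y" using Y(2) by auto
  from bchoice[OF this] obtain g where g: "\<forall>y\<in>Y. g y \<in> carrier Q \<and> D (g y) = y" ..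
  let ?S0 = "\<Union>y\<in>Y. {s \<in> S. Q.cf (g y) s \<noteq> \<zero>\<^bsub>B\<^esub>}"
  have fin: "finite ?S0" using Y(1) Q.coeff_finite g by simp
  have "S \<subseteq> ?S0"
  proof (rule ccontr)
    assume "\<not> S \<subseteq> ?S0"
    then obtain s where s0: "s \<in> S" "s \<notin> ?S0" by blast
    have "Q.cf (g y) s = \<zero>\<^bsub>B\<^esub>" if "y \<in> Y" for y using s0 that by simp
    note s = s0(1) this
    define W where "W = {m \<in> carrier Q. Q.cf m s \<in> BP}"
    have "closed_sub T (D ` W)"
      unfolding closed_sub_def
    proof (intro conjI ballI subsetI)
      show "x \<in> carrier T" if "x \<in> D ` W" for x
        using that gmod_hom_closed[OF D] by (auto simp: W_def)
      have "\<zero>\<^bsub>Q\<^esub> \<in> W" using Q.coeff_zero[OF s(1)] by (simp add: W_def)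
      moreover have "D \<zero>\<^bsub>Q\<^esub> = \<zero>\<^bsub>T\<^esub>"
        by (rule add_hom_zero[OF Q.M.abelian_group_axioms T.M.abelian_group_axioms gmod_hom_hom[OF D]])
      ultimately show "\<zero>\<^bsub>T\<^esub> \<in> D ` W" by force
      show "x \<oplus>\<^bsub>T\<^esub> y \<in> D ` W" if "x \<in> D ` W" "y \<in> D ` W" for x y
      proof -
        from that obtain v w where vw: "v \<in> W" "w \<in> W" "x = D v" "y = D w" by auto
        then have "v \<oplus>\<^bsub>Q\<^esub> w \<in> W" by (simp add: W_def Q.coeff_add[OF _ _ s(1)])
        moreover have "x \<oplus>\<^bsub>T\<^esub> y = D (v \<oplus>\<^bsub>Q\<^esub> w)" using vw gmod_hom_add[OF D, of v w] by (simp add: W_def)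
        ultimately show ?thesis by simp
      qed
      show "b \<odot>\<^bsub>T\<^esub> x \<in> D ` W" if "b \<in> carrier B" "x \<in> D ` W" for b x
      proof -
        from that obtain v where v: "v \<in> W" "x = D v" by auto
        then have "b \<odot>\<^bsub>Q\<^esub> v \<in> W"
          using BP_mult(1)[OF that(1)] by (simp add: W_def Q.coeff_smult[OF that(1) _ s(1)] Q.smult_closed[OF that(1)])
        moreover have "b \<odot>\<^bsub>T\<^esub> x = D (b \<odot>\<^bsub>Q\<^esub> v)" using v gmod_hom_smult[OF D that(1), of v] by (simp add: W_def)
        ultimately show ?thesis by simp
      qed
    qed
    moreover have "Y \<subseteq> D ` W"
    proof
      fix y assume y: "y \<in> Y"
      then have "g y \<in> W" using g s(2)[OF y] by (simp add: W_def)
      then show "y \<in> D ` W" using g y by (metis imageI)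
    qed
    ultimately have "D s \<in> D ` W" using Y(3) Q.basis_carrier[OF s(1)] by blast
    then obtain w where w: "w \<in> carrier Q" "Q.cf w s \<in> BP" "D s = D w" by (auto simp: W_def)
    note sc = Q.basis_carrier[OF s(1)]
    have "D (s \<ominus>\<^bsub>Q\<^esub> w) = D s \<ominus>\<^bsub>T\<^esub> D w"
      by (rule add_hom_minus[OF Q.M.abelian_group_axioms T.M.abelian_group_axioms gmod_hom_hom[OF D] sc w(1)])
    then have "D (s \<ominus>\<^bsub>Q\<^esub> w) = \<zero>\<^bsub>T\<^esub>" using w(3) gmod_hom_closed[OF D w(1)] by (simp add: T.M.minus_zero_iff)
    from coeff_augmentation[OF Q ker[OF _ this] s(1)] have "Q.cf (s \<ominus>\<^bsub>Q\<^esub> w) s \<in> BP" using sc w(1) by simp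
    from BP.a_closed[OF this w(2)] have "Q.cf (s \<ominus>\<^bsub>Q\<^esub> w \<oplus>\<^bsub>Q\<^esub> w) s \<in> BP"
      using sc w(1) by (simp add: Q.coeff_add[OF _ _ s(1)])
    then have "Q.cf s s \<in> BP" using sc w(1) by (simp add: Q.M.minus_add_cancel)
    then have "proj \<one> \<in> BP" by (simp add: Q.coeff_basis[OF s(1)] proj_one)
    from proj_BP[OF _ this] one_not_pos show False by simp
  qed
  with fin show ?thesis by (rule rev_finite_subset)
qed

text \<open>The cover is the free \<open>A\<close>-module on the given basis of \<open>Q\<close>.
  The coordinates of \<open>p x\<close> are the classes of the coordinates of \<open>x\<close>, so
  its kernel is described by \<open>I\<close>, and the condition on \<open>A\<^sub>+\<close> follows
  from that on \<open>B\<^sub>+\<close>.\<close>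

lemma free_cover:
  assumes Q: "based_module B Q S" and S: "finite S"
  shows "\<exists>N e p. p \<in> gmod_hom A (free_gmod A {..<N::nat} e) (restrict_scalars Q) \<and>
    p ` carrier (free_gmod A {..<N} e) = carrier Q \<and>
    (\<forall>x\<in>carrier (free_gmod A {..<N} e). (p x = \<zero>\<^bsub>Q\<^esub> \<longleftrightarrow> ideal_coords {..<N} x) \<and>
      (p x \<in> set_smult Q (augmentation B) (carrier Q) \<longrightarrow> (\<forall>i\<in>{..<N}. x i \<in> pos_part A)))"
proof -
  interpret Q: based_module B Q S by fact
  have RQ: "graded_left_module A (restrict_scalars Q)" by (rule restrict_scalars_graded[OF Q.graded_left_module_axioms])
  define N where "N = card S"
  obtain b where b: "bij_betw b {..<N} S" using ex_bij_betw_nat_finite[OF S] N_def lessThan_atLeast0 by metis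
  have binj: "inj_on b {..<N}" and bim: "b ` {..<N} = S" using b by (auto simp: bij_betw_def)
  have bS: "b i \<in> S" if "i \<in> {..<N}" for i using bim that by blast
  have "\<forall>i\<in>{..<N}. \<exists>k. b i \<in> grade Q k"
    using bS Q.basis unfolding homogeneous_basis_def by blast
  from bchoice[OF this] obtain e where e: "\<forall>i\<in>{..<N}. b i \<in> grade Q (e i)" ..
  let ?G = "free_gmod A {..<N} e"
  define p where "p = lincomb (restrict_scalars Q) {..<N} b"
  have p: "p \<in> gmod_hom A ?G (restrict_scalars Q)"
    unfolding p_def by (rule lincomb_hom[OF finite_lessThan RQ]) (use e in \<open>simp add: restrict_scalars_simps\<close>)
  have xc: "proj (x i) \<in> carrier B" if "x \<in> carrier ?G" for x i
    by (rule proj_closed[OF free_coord_closed[OF that]])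
  \<comment> \<open>The sum is reindexed by the basis itself, since the uniqueness of coordinates is
    stated for sums over subsets of \<open>S\<close>.\<close>
  have psum: "p x = (\<Oplus>\<^bsub>Q\<^esub>s\<in>S. proj (x (the_inv_into {..<N} b s)) \<odot>\<^bsub>Q\<^esub> s)" if x: "x \<in> carrier ?G" for x
  proof -
    have c: "proj (x i) \<odot>\<^bsub>Q\<^esub> b i \<in> carrier Q" if "i \<in> {..<N}" for i
      by (rule Q.smult_closed[OF xc[OF x] Q.basis_carrier[OF bS[OF that]]])
    have "p x = (\<Oplus>\<^bsub>Q\<^esub>i\<in>{..<N}. proj (x i) \<odot>\<^bsub>Q\<^esub> b i)"
      unfolding p_def lincomb_def restrict_scalars_simps
      by (rule restrict_scalars_finsum[OF Q.graded_left_module_axioms finite_lessThan c])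
    also have "\<dots> = (\<Oplus>\<^bsub>Q\<^esub>i\<in>{..<N}. proj (x (the_inv_into {..<N} b (b i))) \<odot>\<^bsub>Q\<^esub> b i)"
      by (rule Q.M.finsum_cong') (use c the_inv_into_f_f[OF binj] in auto)
    also have "\<dots> = (\<Oplus>\<^bsub>Q\<^esub>s\<in>b ` {..<N}. proj (x (the_inv_into {..<N} b s)) \<odot>\<^bsub>Q\<^esub> s)"
      by (rule Q.M.finsum_reindex[OF _ binj, symmetric])
        (use bim Q.smult_closed[OF xc[OF x] Q.basis_carrier] in auto)
    finally show ?thesis unfolding bim .
  qed
  have coeff: "Q.cf (p x) (b i) = proj (x i)" if x: "x \<in> carrier ?G" and i: "i \<in> {..<N}" for x i
    using Q.coeff_unique[OF S subset_refl _ psum[OF x] bS[OF i]] xc[OF x] bS[OF i] the_inv_into_f_f[OF binj i]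
    by simp
  have surj: "p ` carrier ?G = carrier Q"
  proof
    show "p ` carrier ?G \<subseteq> carrier Q" using gmod_hom_closed[OF p] by (auto simp: restrict_scalars_simps)
    show "carrier Q \<subseteq> p ` carrier ?G"
    proof
      fix m assume m: "m \<in> carrier Q"
      have "\<forall>i\<in>{..<N}. \<exists>a. a \<in> carrier A \<and> Q.cf m (b i) = proj a"
        using proj_surj[OF Q.coeff_closed[OF m bS]] by blast
      from bchoice[OF this] obtain a where a: "\<forall>i\<in>{..<N}. a i \<in> carrier A \<and> Q.cf m (b i) = proj (a i)" ..
      let ?x = "\<lambda>i. if i \<in> {..<N} then a i else \<zero>"
      have x: "?x \<in> carrier ?G" using a by (simp add: free_simps)
      have inv: "the_inv_into {..<N} b s \<in> {..<N}" "b (the_inv_into {..<N} b s) = s" if "s \<in> S" for s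
        using the_inv_into_into[OF binj _ subset_refl, of s] f_the_inv_into_f[OF binj, of s] that bim by auto
      have "p ?x = (\<Oplus>\<^bsub>Q\<^esub>s\<in>S. Q.cf m s \<odot>\<^bsub>Q\<^esub> s)"
        unfolding psum[OF x]
      proof (rule Q.M.finsum_cong'[OF refl])
        show "(\<lambda>s. Q.cf m s \<odot>\<^bsub>Q\<^esub> s) \<in> S \<rightarrow> carrier Q"
          using Q.smult_closed[OF Q.coeff_closed[OF m] Q.basis_carrier] by blast
        fix s assume s: "s \<in> S"
        have "proj (a (the_inv_into {..<N} b s)) = Q.cf m s"
          using a[rule_format, OF inv(1)[OF s]] inv(2)[OF s] by simp
        then show "proj (?x (the_inv_into {..<N} b s)) \<odot>\<^bsub>Q\<^esub> s = Q.cf m s \<odot>\<^bsub>Q\<^esub> s" using inv(1)[OF s] by simp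
      qed
      also have "\<dots> = m" by (rule Q.coeff_sum_superset[OF m S subset_refl])
      finally have "m = p ?x" by (rule sym)
      then show "m \<in> p ` carrier ?G" using x by (rule image_eqI)
    qed
  qed
  have "p x = \<zero>\<^bsub>Q\<^esub> \<longleftrightarrow> ideal_coords {..<N} x" if x: "x \<in> carrier ?G" for x
  proof
    assume 0: "p x = \<zero>\<^bsub>Q\<^esub>"
    show "ideal_coords {..<N} x"
      unfolding ideal_coords_def
    proof
      fix i assume i: "i \<in> {..<N}"
      have "proj (x i) = \<zero>\<^bsub>B\<^esub>" using coeff[OF x i] 0 Q.coeff_zero[OF bS[OF i]] by simp
      then show "x i \<in> I" using proj_eq_zero_iff[OF free_coord_closed[OF x]] by simp
    qed
  next
    assume ic: "ideal_coords {..<N} x"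
    show "p x = \<zero>\<^bsub>Q\<^esub>"
      unfolding psum[OF x]
    proof (rule Q.M.finsum_zero')
      fix s assume s: "s \<in> S"
      then have "the_inv_into {..<N} b s \<in> {..<N}" using the_inv_into_into[OF binj _ subset_refl, of s] bim by auto
      then have "proj (x (the_inv_into {..<N} b s)) = \<zero>\<^bsub>B\<^esub>"
        using ic proj_eq_zero_iff[OF free_coord_closed[OF x]] by (simp add: ideal_coords_def)
      then show "proj (x (the_inv_into {..<N} b s)) \<odot>\<^bsub>Q\<^esub> s = \<zero>\<^bsub>Q\<^esub>"
        using Q.zero_smult[OF Q.basis_carrier[OF s]] by simp
    qed
  qed
  moreover have "x i \<in> pos_part A"
    if x: "x \<in> carrier ?G" and "p x \<in> set_smult Q (augmentation B) (carrier Q)" and i: "i \<in> {..<N}" for x i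
    using coeff_augmentation[OF Q that(2) bS[OF i]] coeff[OF x i] proj_BP[OF free_coord_closed[OF x]] by simp
  ultimately show ?thesis
    by (intro exI[of _ N] exI[of _ e] exI[of _ p]) (simp add: p surj)
qed

text \<open>Submodules of \<open>Q\<close> pull back along \<open>p\<close> to submodules of a
  finite free \<open>A\<close>-module, to which noetherianity of \<open>A\<close> applies directly.
  The images of generators of the pullback generate the kernel.\<close>

lemma fg_kernel:
  assumes noeth: "left_noetherian A" and J: "finite J"
    and Q: "graded_left_module B Q" and T: "graded_left_module B T" and D: "D \<in> gmod_hom B Q T"
    and p: "p \<in> gmod_hom A (free_gmod A J e) (restrict_scalars Q)" "p ` carrier (free_gmod A J e) = carrier Q"
  shows "fg_sub Q {m \<in> carrier Q. D m = \<zero>\<^bsub>T\<^esub>}"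
proof -
  interpret Q: graded_left_module B Q by fact
  interpret T: graded_left_module B T by fact
  let ?G = "free_gmod A J e"
  interpret G: graded_left_module A ?G by (rule free_graded[OF J])
  interpret RQ: graded_left_module A "restrict_scalars Q" by (rule restrict_scalars_graded[OF Q])
  have p0: "p (\<lambda>_. \<zero>) = \<zero>\<^bsub>Q\<^esub>"
    using add_hom_zero[OF G.M.abelian_group_axioms RQ.M.abelian_group_axioms gmod_hom_hom[OF p(1)]]
    by (simp add: free_simps(2) restrict_scalars_simps)
  have sub: "coord_submodule A J {x \<in> carrier ?G. p x \<in> V}" if V: "closed_sub Q V" for V
    unfolding coord_submodule_def
  proof (intro conjI ballI subsetI)
    show "(\<lambda>_. \<zero>) \<in> {x \<in> carrier ?G. p x \<in> V}" using V p0 by (simp add: closed_sub_def free_simps)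
    show "(\<lambda>i. x i \<oplus> y i) \<in> {x \<in> carrier ?G. p x \<in> V}"
      if "x \<in> {x \<in> carrier ?G. p x \<in> V}" "y \<in> {x \<in> carrier ?G. p x \<in> V}" for x y
    proof -
      have xy: "x \<in> carrier ?G" "y \<in> carrier ?G" "p x \<in> V" "p y \<in> V" using that by auto
      have "p x \<oplus>\<^bsub>Q\<^esub> p y \<in> V" using V xy(3,4) unfolding closed_sub_def by blast
      then have "p (x \<oplus>\<^bsub>?G\<^esub> y) \<in> V" using gmod_hom_add[OF p(1) xy(1,2)] by (simp add: restrict_scalars_simps)
      with G.M.a_closed[OF xy(1,2)] have "x \<oplus>\<^bsub>?G\<^esub> y \<in> {x \<in> carrier ?G. p x \<in> V}" by simp
      then show ?thesis by (simp only: free_simps(3))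
    qed
    show "(\<lambda>i. a \<otimes> x i) \<in> {x \<in> carrier ?G. p x \<in> V}"
      if a: "a \<in> carrier A" and "x \<in> {x \<in> carrier ?G. p x \<in> V}" for a x
    proof -
      have x: "x \<in> carrier ?G" "p x \<in> V" using that by auto
      have "proj a \<odot>\<^bsub>Q\<^esub> p x \<in> V" using V x(2) proj_closed[OF a] unfolding closed_sub_def by blast
      then have "p (a \<odot>\<^bsub>?G\<^esub> x) \<in> V" using gmod_hom_smult[OF p(1) a x(1)] by (simp add: restrict_scalars_simps)
      with G.smult_closed[OF a x(1)] have "a \<odot>\<^bsub>?G\<^esub> x \<in> {x \<in> carrier ?G. p x \<in> V}" by simp
      then show ?thesis by (simp only: free_simps(4))
    qed
  qed (auto simp: free_simps)
  let ?Z = "{m \<in> carrier Q. D m = \<zero>\<^bsub>T\<^esub>}"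
  have D0: "D \<zero>\<^bsub>Q\<^esub> = \<zero>\<^bsub>T\<^esub>"
    by (rule add_hom_zero[OF Q.M.abelian_group_axioms T.M.abelian_group_axioms gmod_hom_hom[OF D]])
  have "closed_sub Q ?Z"
    unfolding closed_sub_def using D0
    by (auto simp: gmod_hom_add[OF D] gmod_hom_smult[OF D] Q.smult_closed T.smult_zero)
  from noetherian_coord_submodule[OF noeth J sub[OF this]]
  obtain S where S: "finite S" "S \<subseteq> {x \<in> carrier ?G. p x \<in> ?Z}"
    "\<forall>V. coord_submodule A J V \<longrightarrow> S \<subseteq> V \<longrightarrow> {x \<in> carrier ?G. p x \<in> ?Z} \<subseteq> V" by (elim exE conjE)
  have "?Z \<subseteq> V" if V: "closed_sub Q V" and SV: "p ` S \<subseteq> V" for V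
  proof -
    have "S \<subseteq> {x \<in> carrier ?G. p x \<in> V}" using S(2) SV by blast
    then have *: "{x \<in> carrier ?G. p x \<in> ?Z} \<subseteq> {x \<in> carrier ?G. p x \<in> V}" using S(3) sub[OF V] by simp
    show ?thesis
    proof
      fix m assume m: "m \<in> ?Z"
      then have "m \<in> p ` carrier ?G" using p(2) by simp
      then obtain x where "x \<in> carrier ?G" "m = p x" by blast
      with m * show "m \<in> V" by blast
    qed
  qed
  moreover have "finite (p ` S)" "p ` S \<subseteq> ?Z" using S(1,2) by auto
  ultimately show ?thesis unfolding fg_sub_def by (intro exI[of _ "p ` S"]) simp
qed

text \<open>The isomorphism goes from the image to the cokernel and sends an element to its fibre
  under \<open>\<theta>\<close>. The fibre is a coset of the kernel, so no representative has to be
  chosen.\<close>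

lemma coker_isomorphic_image:
  assumes G: "graded_left_module A G" and Q: "graded_left_module B Q"
    and \<theta>: "\<theta> \<in> gmod_hom A G (restrict_scalars Q)"
  shows "gmod_isomorphic B (sub_gmodule Q (\<theta> ` carrier G))
    (induced_module (quot_gmodule G {x \<in> carrier G. \<theta> x = \<zero>\<^bsub>Q\<^esub>}))"
proof -
  interpret G: graded_left_module A G by fact
  interpret Q: graded_left_module B Q by fact
  interpret RQ: graded_left_module A "restrict_scalars Q" by (rule restrict_scalars_graded[OF Q])
  define F where "F = {x \<in> carrier G. \<theta> x = \<zero>\<^bsub>Q\<^esub>}"
  have Fmem: "x \<in> F \<longleftrightarrow> x \<in> carrier G \<and> \<theta> x = \<zero>\<^bsub>Q\<^esub>" for x by (simp add: F_def)
  have \<theta>c: "\<theta> x \<in> carrier Q" if "x \<in> carrier G" for x using gmod_hom_closed[OF \<theta> that] by (simp add: restrict_scalars_simps)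
  have \<theta>add: "\<theta> (x \<oplus>\<^bsub>G\<^esub> y) = \<theta> x \<oplus>\<^bsub>Q\<^esub> \<theta> y" if "x \<in> carrier G" "y \<in> carrier G" for x y
    using gmod_hom_add[OF \<theta> that] by (simp add: restrict_scalars_simps)
  have \<theta>sm: "\<theta> (a \<odot>\<^bsub>G\<^esub> x) = proj a \<odot>\<^bsub>Q\<^esub> \<theta> x" if "a \<in> carrier A" "x \<in> carrier G" for a x
    using gmod_hom_smult[OF \<theta> that] by (simp add: restrict_scalars_simps)
  have \<theta>minus: "\<theta> (x \<ominus>\<^bsub>G\<^esub> y) = \<theta> x \<ominus>\<^bsub>Q\<^esub> \<theta> y" if "x \<in> carrier G" "y \<in> carrier G" for x y
  proof -
    have "\<theta> \<in> hom (add_monoid G) (add_monoid Q)" using \<theta>c \<theta>add by (simp add: hom_def)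
    then show ?thesis by (rule add_hom_minus[OF G.M.abelian_group_axioms Q.M.abelian_group_axioms _ that])
  qed
  have Fsub: "additive_subgroup F G"
  proof (rule additive_subgroupI, rule G.M.add.subgroupI)
    have "\<theta> (\<zero>\<^bsub>G\<^esub> \<ominus>\<^bsub>G\<^esub> \<zero>\<^bsub>G\<^esub>) = \<zero>\<^bsub>Q\<^esub>" using \<theta>c[OF G.M.zero_closed] by (subst \<theta>minus) (simp_all add: Q.M.minus_zero_iff)
    then have t0: "\<theta> \<zero>\<^bsub>G\<^esub> = \<zero>\<^bsub>Q\<^esub>" by (simp add: G.M.minus_zero_right)
    then show "F \<noteq> {}" using G.M.zero_closed Fmem by blast
    fix x assume x: "x \<in> F"
    then have "\<theta> (\<zero>\<^bsub>G\<^esub> \<ominus>\<^bsub>G\<^esub> x) = \<zero>\<^bsub>Q\<^esub>" using t0 by (subst \<theta>minus) (simp_all add: Fmem Q.M.minus_zero_iff)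
    then show "\<ominus>\<^bsub>G\<^esub> x \<in> F" using x by (simp add: a_minus_def Fmem)
  qed (auto simp: \<theta>add Fmem)
  interpret F: abelian_subgroup F G
    by (rule abelian_subgroupI3[OF Fsub G.M.abelian_group_axioms])
  define \<Phi> where "\<Phi> z = {x \<in> carrier G. \<theta> x = z}" for z
  have \<Phi>: "\<Phi> (\<theta> x) = F +>\<^bsub>G\<^esub> x" if x: "x \<in> carrier G" for x
  proof
    show "\<Phi> (\<theta> x) \<subseteq> F +>\<^bsub>G\<^esub> x"
    proof
      fix y assume "y \<in> \<Phi> (\<theta> x)"
      then have y: "y \<in> carrier G" "\<theta> y = \<theta> x" by (auto simp: \<Phi>_def)
      then have "y \<ominus>\<^bsub>G\<^esub> x \<in> F" using x \<theta>c[OF x] by (simp add: Fmem \<theta>minus Q.M.minus_zero_iff)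
      moreover have "y = y \<ominus>\<^bsub>G\<^esub> x \<oplus>\<^bsub>G\<^esub> x" using y x by (simp add: G.M.minus_add_cancel)
      ultimately show "y \<in> F +>\<^bsub>G\<^esub> x" unfolding a_r_coset_def' by blast
    qed
    show "F +>\<^bsub>G\<^esub> x \<subseteq> \<Phi> (\<theta> x)"
    proof
      fix y assume "y \<in> F +>\<^bsub>G\<^esub> x"
      then obtain z where z: "z \<in> carrier G" "\<theta> z = \<zero>\<^bsub>Q\<^esub>" "y = z \<oplus>\<^bsub>G\<^esub> x"
        unfolding a_r_coset_def' using Fmem by blast
      then show "y \<in> \<Phi> (\<theta> x)" using x \<theta>c[OF x] by (simp add: \<Phi>_def \<theta>add)
    qed
  qed
  let ?Z = "\<theta> ` carrier G"
  let ?S = "sub_gmodule Q ?Z" and ?C = "quot_gmodule G F"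
  have rc: "a \<odot>\<^bsub>?C\<^esub> \<Phi> z = \<Phi> (proj a \<odot>\<^bsub>Q\<^esub> z)" if a: "a \<in> carrier A" and z: "z \<in> ?Z" for a z
  proof -
    have "F +>\<^bsub>G\<^esub> (a \<odot>\<^bsub>G\<^esub> x) = \<Phi> (proj a \<odot>\<^bsub>Q\<^esub> z)" if "x \<in> \<Phi> z" for x
      using that \<Phi>[OF G.smult_closed[OF a, of x]] \<theta>sm[OF a, of x] by (simp add: \<Phi>_def)
    moreover have "\<Phi> z \<noteq> {}" using z by (auto simp: \<Phi>_def)
    ultimately show ?thesis by (simp add: quot_gmodule_def)
  qed
  have hom: "\<Phi> \<in> gmod_hom B ?S (induced_module ?C)"
  proof (rule gmod_homI)
    fix z assume "z \<in> carrier ?S"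
    then obtain x where "x \<in> carrier G" "z = \<theta> x" by (auto simp: sub_gmodule_def)
    then show "\<Phi> z \<in> carrier (induced_module ?C)"
      using G.M.a_rcosetsI[OF F.a_subset] \<Phi> by (simp add: induced_module_def quot_gmodule_def)
  next
    fix z w assume "z \<in> carrier ?S" "w \<in> carrier ?S"
    then obtain x y where xy: "x \<in> carrier G" "z = \<theta> x" "y \<in> carrier G" "w = \<theta> y" by (auto simp: sub_gmodule_def)
    have "\<Phi> (z \<oplus>\<^bsub>Q\<^esub> w) = F +>\<^bsub>G\<^esub> (x \<oplus>\<^bsub>G\<^esub> y)" using \<Phi>[of "x \<oplus>\<^bsub>G\<^esub> y"] xy by (simp add: \<theta>add)
    also have "\<dots> = \<Phi> z <+>\<^bsub>G\<^esub> \<Phi> w" using F.a_rcos_sum[OF xy(1,3)] \<Phi> xy by simp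
    finally show "\<Phi> (z \<oplus>\<^bsub>?S\<^esub> w) = \<Phi> z \<oplus>\<^bsub>induced_module ?C\<^esub> \<Phi> w"
      by (simp add: sub_gmodule_def induced_module_def quot_gmodule_def)
  next
    fix b z assume b: "b \<in> carrier B" and "z \<in> carrier ?S"
    then have z: "z \<in> ?Z" by (simp add: sub_gmodule_def)
    obtain a0 where a0: "a0 \<in> carrier A" "b = proj a0" using proj_surj[OF b] by blast
    have ab: "a \<in> carrier A \<and> proj a = b" if "a \<in> b" for a
    proof -
      from that obtain i where i: "i \<in> I" "a = i \<oplus> a0" unfolding a0(2) a_r_coset_def' by blast
      have ic: "i \<in> carrier A" by (rule I.a_Hcarr[OF i(1)])
      then have "a \<ominus> a0 = i" unfolding i(2) using a0(1) by (subst minus_eq_iff) simp_all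
      then show ?thesis using proj_eq_iff[of a a0] i ic a0 by simp
    qed
    have "a0 \<in> b" using a0 I.a_rcos_self by simp
    have "(THE y. \<exists>a\<in>b. y = a \<odot>\<^bsub>?C\<^esub> \<Phi> z) = \<Phi> (b \<odot>\<^bsub>Q\<^esub> z)"
    proof (rule the_equality)
      show "\<exists>a\<in>b. \<Phi> (b \<odot>\<^bsub>Q\<^esub> z) = a \<odot>\<^bsub>?C\<^esub> \<Phi> z"
        using rc[OF a0(1) z] a0(2) \<open>a0 \<in> b\<close> by (intro bexI[of _ a0]) simp_all
      show "y = \<Phi> (b \<odot>\<^bsub>Q\<^esub> z)" if "\<exists>a\<in>b. y = a \<odot>\<^bsub>?C\<^esub> \<Phi> z" for y
        using that rc[OF _ z] ab by auto
    qed
    then show "\<Phi> (b \<odot>\<^bsub>?S\<^esub> z) = b \<odot>\<^bsub>induced_module ?C\<^esub> \<Phi> z"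
      by (simp add: sub_gmodule_def induced_module_def)
  next
    fix z i assume "z \<in> grade ?S i"
    then have z: "z \<in> grade (restrict_scalars Q) i" "z \<in> ?Z" by (simp_all add: sub_gmodule_def restrict_scalars_simps)
    obtain x where x: "x \<in> grade G i" "\<theta> x = z"
      using gmod_hom_homogeneous_preimage[OF G RQ.graded_left_module_axioms \<theta> z] by blast
    have "\<Phi> z = F +>\<^bsub>G\<^esub> x" using \<Phi>[OF G.GM.g_carrier[OF x(1)]] x(2) by simp
    then show "\<Phi> z \<in> grade (induced_module ?C) i"
      using x(1) by (auto simp: induced_module_def quot_gmodule_def)
  qed
  have "bij_betw \<Phi> (carrier ?S) (carrier (induced_module ?C))"
  proof (rule bij_betw_imageI)
    show "inj_on \<Phi> (carrier ?S)"
    proof (rule inj_onI)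
      fix z w assume zw: "z \<in> carrier ?S" "\<Phi> z = \<Phi> w"
      then obtain x where "x \<in> \<Phi> z" by (auto simp: sub_gmodule_def \<Phi>_def)
      with zw(2) show "z = w" by (auto simp: \<Phi>_def)
    qed
    show "\<Phi> ` carrier ?S = carrier (induced_module ?C)"
      using \<Phi> by (auto simp: sub_gmodule_def induced_module_def quot_gmodule_def A_RCOSETS_def' image_image)
  qed
  with hom show ?thesis unfolding gmod_isomorphic_def gmod_iso_def F_def[symmetric] by blast
qed

end

section \<open>The syzygies as cokernels\<close>

lemma Inf_enat_mem: "E \<noteq> {} \<Longrightarrow> Inf E \<in> (E :: enat set)"
  by (auto simp: Inf_enat_def intro: LeastI)

text \<open>\<open>proj_dim\<close> is an infimum of extended natural numbers. It is bounded by d,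
  hence the set is not empty and the infimum is attained by an actual resolution.\<close>

lemma ex_short_projective_resolution:
  fixes N :: "('a, 'a univ) gmodule"
  assumes "gl_dim A = enat d" "graded_left_module A N"
  shows "\<exists>P \<delta> \<epsilon>. graded_projective_resolution A P \<delta> \<epsilon> N \<and> (\<forall>i>d. carrier (P i) = {\<zero>\<^bsub>P i\<^esub>})"
proof -
  let ?E = "{enat n |n. \<exists>P \<delta> \<epsilon>. graded_projective_resolution A P \<delta> \<epsilon> N \<and>
    (\<forall>i>n. carrier (P i) = {\<zero>\<^bsub>P i\<^esub>})}"
  have "proj_dim A N \<le> gl_dim A"
    unfolding gl_dim_def by (rule SUP_upper) (use assms(2) in simp)
  then have le: "Inf ?E \<le> enat d" using assms(1) by (simp add: proj_dim_def)
  have ne: "?E \<noteq> {}"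
  proof
    assume "?E = {}"
    then have "Inf ?E = (\<infinity>::enat)" by (simp only: Inf_empty top_enat_def)
    with le show False by simp
  qed
  then have "Inf ?E \<in> ?E" by (rule Inf_enat_mem)
  then obtain n P \<delta> \<epsilon> where n: "Inf ?E = enat n" and P: "graded_projective_resolution A P \<delta> \<epsilon> N"
    "\<forall>i>n. carrier (P i) = {\<zero>\<^bsub>P i\<^esub>}" by blast
  from le n have "n \<le> d" by simp
  with P(2) have "\<forall>i>d. carrier (P i) = {\<zero>\<^bsub>P i\<^esub>}" by simp
  with P(1) show ?thesis by blast
qed

context hypersurface
begin

text \<open>\<open>F0\<close> and \<open>F1\<close> are the preimages in \<open>G0\<close> and \<open>G1\<close> of consecutive syzygies over \<open>B\<close>. The second
  summand of the cover \<open>L = G1 \<oplus> G0\<close> of \<open>F0\<close> maps onto \<open>f G0\<close>, and \<open>\<iota>\<close> identifies the kernel with \<open>F1\<close>.\<close>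

lemma cover_by_next:
  fixes e1 e0 :: "nat \<Rightarrow> int" and J1 J0 :: "nat set"
  assumes J1: "finite J1" and J0: "finite J0"
  defines "G1 \<equiv> free_gmod A J1 e1" and "G0 \<equiv> free_gmod A J0 e0"
    and "L \<equiv> free_gmod A (J1 <+> J0) (case_sum e1 (\<lambda>i. e0 i + n))"
  assumes h: "h \<in> gmod_hom A G1 G0"
    and F1: "F1 = {x \<in> carrier G1. ideal_coords J0 (h x)}" "graded_left_module A (sub_gmodule G1 F1)"
    and F0: "graded_left_module A (sub_gmodule G0 F0)" "F0 \<subseteq> carrier G0"
    and F0h: "\<And>x. x \<in> carrier G1 \<Longrightarrow> h x \<in> F0"
    and F0f: "\<And>y. y \<in> carrier G0 \<Longrightarrow> ideal_coords J0 y \<Longrightarrow> y \<in> F0"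
    and F0s: "\<And>y. y \<in> F0 \<Longrightarrow> \<exists>x\<in>carrier G1. ideal_coords J0 (y \<ominus>\<^bsub>G0\<^esub> h x)"
  defines "\<pi> \<equiv> \<lambda>z. h (\<lambda>i. z (Inl i)) \<oplus>\<^bsub>G0\<^esub> (\<lambda>i. z (Inr i) \<otimes> f)"
    and "\<iota> \<equiv> \<lambda>x. case_sum x (\<lambda>i. \<ominus> divf (h x i))"
  shows "\<pi> \<in> gmod_hom A L (sub_gmodule G0 F0)" "\<pi> ` carrier L = F0"
    and "\<iota> \<in> gmod_hom A (sub_gmodule G1 F1) L" "inj_on \<iota> F1" "\<iota> ` F1 = {z \<in> carrier L. \<pi> z = \<zero>\<^bsub>G0\<^esub>}"
    and "(\<lambda>z i. z (Inl i)) \<in> gmod_hom A L G1"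
    and "\<And>z. z \<in> carrier L \<Longrightarrow> ideal_coords J0 (h (\<lambda>i. z (Inl i)) \<ominus>\<^bsub>G0\<^esub> \<pi> z)"
proof -
  interpret G1: graded_left_module A G1 unfolding G1_def by (rule free_graded[OF J1])
  interpret G0: graded_left_module A G0 unfolding G0_def by (rule free_graded[OF J0])
  interpret F0: graded_left_module A "sub_gmodule G0 F0" by (rule F0(1))
  have Fs: "carrier (sub_gmodule G0 F0) = F0" "add (sub_gmodule G0 F0) = add G0"
    "smult (sub_gmodule G0 F0) = smult G0" "grade (sub_gmodule G0 F0) = (\<lambda>i. grade G0 i \<inter> F0)"
    "carrier (sub_gmodule G1 F1) = F1" "add (sub_gmodule G1 F1) = add G1"
    "smult (sub_gmodule G1 F1) = smult G1" "grade (sub_gmodule G1 F1) = (\<lambda>i. grade G1 i \<inter> F1)"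
    by (simp_all add: sub_gmodule_def)
  have Lmem: "z \<in> carrier L \<longleftrightarrow> (\<forall>i\<in>J1. z (Inl i) \<in> carrier A) \<and> (\<forall>i\<in>J0. z (Inr i) \<in> carrier A) \<and>
      (\<forall>i. i \<notin> J1 \<longrightarrow> z (Inl i) = \<zero>) \<and> (\<forall>i. i \<notin> J0 \<longrightarrow> z (Inr i) = \<zero>)"
    "z \<in> grade L k \<longleftrightarrow> (\<forall>i\<in>J1. z (Inl i) \<in> rgrade A (k - e1 i)) \<and>
      (\<forall>i\<in>J0. z (Inr i) \<in> rgrade A (k - (e0 i + n))) \<and>
      (\<forall>i. i \<notin> J1 \<longrightarrow> z (Inl i) = \<zero>) \<and> (\<forall>i. i \<notin> J0 \<longrightarrow> z (Inr i) = \<zero>)" for z k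
    unfolding L_def free_simps Ball_def split_sum_all by (auto simp: Plus_def)
  \<comment> \<open>Outside \<open>J0\<close> the coordinates are 0, which is in \<open>I\<close>.
    So \<open>divf\<close> can be applied to all coordinates without distinguishing indices, as in
    \<open>\<iota>\<close>.\<close>
  have all_coords: "ideal_coords J0 y \<Longrightarrow> y \<in> carrier G0 \<Longrightarrow> y i \<in> I" for y i
    by (cases "i \<in> J0") (simp_all add: ideal_coords_def G0_def free_simps)
  have Lc: "z k \<in> carrier A" if "z \<in> carrier L" for z k by (rule free_coord_closed[OF that[unfolded L_def]])
  have l: "(\<lambda>i. z (Inl i)) \<in> carrier G1" if "z \<in> carrier L" for z
    using that by (simp add: Lmem G1_def free_simps)
  have r: "(\<lambda>i. z (Inr i) \<otimes> f) \<in> carrier G0" "ideal_coords J0 (\<lambda>i. z (Inr i) \<otimes> f)" if "z \<in> carrier L" for z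
  proof -
    show "(\<lambda>i. z (Inr i) \<otimes> f) \<in> carrier G0" using that by (simp add: Lmem G0_def free_simps)
    show "ideal_coords J0 (\<lambda>i. z (Inr i) \<otimes> f)"
      unfolding ideal_coords_def I_right using Lc[OF that] by blast
  qed
  have hl: "h (\<lambda>i. z (Inl i)) \<in> carrier G0" if "z \<in> carrier L" for z by (rule gmod_hom_closed[OF h l[OF that]])
  have hc: "h x i \<in> carrier A" if "x \<in> carrier G1" for x i
    by (rule free_coord_closed[OF gmod_hom_closed[OF h that, unfolded G0_def]])
  have \<pi>F: "\<pi> z \<in> F0" if z: "z \<in> carrier L" for z
    unfolding \<pi>_def using F0.M.a_closed[unfolded Fs] F0h[OF l[OF z]] F0f[OF r[OF z]] by simp
  show "(\<lambda>z i. z (Inl i)) \<in> gmod_hom A L G1"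
  proof (rule gmod_homI)
    show "(\<lambda>i. z (Inl i)) \<in> grade G1 k" if "z \<in> grade L k" for z k
      using that by (simp add: Lmem G1_def free_simps)
  qed (auto simp: l, simp_all add: L_def G1_def free_simps)
  show "\<pi> \<in> gmod_hom A L (sub_gmodule G0 F0)"
  proof (rule gmod_homI)
    show "\<pi> z \<in> carrier (sub_gmodule G0 F0)" if "z \<in> carrier L" for z using \<pi>F[OF that] by (simp add: Fs)
  next
    fix z w assume z: "z \<in> carrier L" and w: "w \<in> carrier L"
    have 1: "h (\<lambda>i. (z \<oplus>\<^bsub>L\<^esub> w) (Inl i)) = h (\<lambda>i. z (Inl i)) \<oplus>\<^bsub>G0\<^esub> h (\<lambda>i. w (Inl i))"
      using gmod_hom_add[OF h l[OF z] l[OF w]] by (simp add: L_def G1_def free_simps(3))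
    have 2: "(\<lambda>i. (z \<oplus>\<^bsub>L\<^esub> w) (Inr i) \<otimes> f) = (\<lambda>i. z (Inr i) \<otimes> f) \<oplus>\<^bsub>G0\<^esub> (\<lambda>i. w (Inr i) \<otimes> f)"
      using Lc[OF z] Lc[OF w] by (simp add: L_def G0_def free_simps(3) l_distr)
    show "\<pi> (z \<oplus>\<^bsub>L\<^esub> w) = \<pi> z \<oplus>\<^bsub>sub_gmodule G0 F0\<^esub> \<pi> w"
      unfolding \<pi>_def 1 2 Fs using hl[OF z] hl[OF w] r(1)[OF z] r(1)[OF w]
      by (simp add: G0.M.a_assoc G0.M.a_lcomm)
  next
    fix a z assume a: "a \<in> carrier A" and z: "z \<in> carrier L"
    have 1: "h (\<lambda>i. (a \<odot>\<^bsub>L\<^esub> z) (Inl i)) = a \<odot>\<^bsub>G0\<^esub> h (\<lambda>i. z (Inl i))"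
      using gmod_hom_smult[OF h a l[OF z]] by (simp add: L_def G1_def free_simps(4))
    have 2: "(\<lambda>i. (a \<odot>\<^bsub>L\<^esub> z) (Inr i) \<otimes> f) = a \<odot>\<^bsub>G0\<^esub> (\<lambda>i. z (Inr i) \<otimes> f)"
      using Lc[OF z] a by (simp add: L_def G0_def free_simps(4) m_assoc)
    show "\<pi> (a \<odot>\<^bsub>L\<^esub> z) = a \<odot>\<^bsub>sub_gmodule G0 F0\<^esub> \<pi> z"
      unfolding \<pi>_def 1 2 Fs using hl[OF z] r(1)[OF z] a by (simp add: G0.smult_r_distr)
  next
    fix z k assume z: "z \<in> grade L k"
    interpret L: graded_left_module A L unfolding L_def by (rule free_graded) (use J1 J0 in simp)
    have zc: "z \<in> carrier L" by (rule L.GM.g_carrier[OF z])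
    have "(\<lambda>i. z (Inl i)) \<in> grade G1 k" using z by (simp add: Lmem G1_def free_simps)
    then have 1: "h (\<lambda>i. z (Inl i)) \<in> grade G0 k" by (rule gmod_hom_grade[OF h])
    \<comment> \<open>Here the degrees \<open>e0 i + n\<close> of the second summand of
      \<open>L\<close> are used: right multiplication by f raises degrees by n.\<close>
    have 2: "(\<lambda>i. z (Inr i) \<otimes> f) \<in> grade G0 k"
      unfolding G0_def free_simps
    proof (intro conjI ballI allI impI)
      fix i assume "i \<in> J0"
      then have "z (Inr i) \<in> rgrade A (k - (e0 i + n))" using z by (simp add: Lmem)
      from mult_grade[OF this f_grade] show "z (Inr i) \<otimes> f \<in> rgrade A (k - e0 i)" by simp
    next
      fix i assume "i \<notin> J0"
      then have "z (Inr i) = \<zero>" using z by (simp add: Lmem)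
      then show "z (Inr i) \<otimes> f = \<zero>" by simp
    qed
    show "\<pi> z \<in> grade (sub_gmodule G0 F0) k"
      unfolding Fs using \<pi>F[OF zc] G0.GM.g_add[OF 1 2] by (simp add: \<pi>_def)
  qed
  show "ideal_coords J0 (h (\<lambda>i. z (Inl i)) \<ominus>\<^bsub>G0\<^esub> \<pi> z)" if z: "z \<in> carrier L" for z
    unfolding ideal_coords_def
  proof
    fix i
    have \<pi>c: "\<pi> z \<in> carrier G0" using \<pi>F[OF z] F0(2) by blast
    let ?a = "h (\<lambda>i. z (Inl i)) i" and ?b = "z (Inr i) \<otimes> f"
    have c: "?a \<in> carrier A" "?b \<in> carrier A" using hc[OF l[OF z]] Lc[OF z] by simp_all
    have "(h (\<lambda>i. z (Inl i)) \<ominus>\<^bsub>G0\<^esub> \<pi> z) i = ?a \<ominus> (?a \<oplus> ?b)"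
      using free_minus[OF hl[OF z, unfolded G0_def] \<pi>c[unfolded G0_def]] by (simp add: \<pi>_def G0_def free_simps(3))
    also have "\<dots> = \<ominus> ?b" using c by (simp add: a_minus_def minus_add r_neg2)
    also have "\<dots> \<in> I" using all_coords[OF r(2)[OF z] r(1)[OF z], of i] by simp
    finally show "(h (\<lambda>i. z (Inl i)) \<ominus>\<^bsub>G0\<^esub> \<pi> z) i \<in> I" .
  qed
  have F1c: "x \<in> carrier G1" "h x i \<in> I" if "x \<in> F1" for x i
    using that all_coords[OF _ gmod_hom_closed[OF h, of x]] by (auto simp: F1(1))
  have \<iota>L: "\<iota> x \<in> carrier L" if x: "x \<in> F1" for x
    using free_coord_closed[OF F1c(1)[OF x, unfolded G1_def]] F1c(1)[OF x] divf(1)[OF F1c(2)[OF x]]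
      gmod_hom_closed[OF h F1c(1)[OF x]]
    by (simp add: \<iota>_def Lmem G1_def G0_def free_simps divf_zero)
  show "\<iota> \<in> gmod_hom A (sub_gmodule G1 F1) L"
  proof (rule gmod_homI)
    show "\<iota> x \<in> carrier L" if "x \<in> carrier (sub_gmodule G1 F1)" for x using that \<iota>L by (simp add: Fs)
  next
    fix x y assume "x \<in> carrier (sub_gmodule G1 F1)" "y \<in> carrier (sub_gmodule G1 F1)"
    then have xy: "x \<in> F1" "y \<in> F1" by (simp_all add: Fs)
    have "h (x \<oplus>\<^bsub>G1\<^esub> y) i = h x i \<oplus> h y i" for i
      using gmod_hom_add[OF h F1c(1)[OF xy(1)] F1c(1)[OF xy(2)]] by (simp add: G0_def free_simps(3))
    then have "\<ominus> divf (h (x \<oplus>\<^bsub>G1\<^esub> y) i) = \<ominus> divf (h x i) \<oplus> \<ominus> divf (h y i)" for i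
      using divf_add[OF F1c(2)[OF xy(1)] F1c(2)[OF xy(2)]] divf(1)[OF F1c(2)[OF xy(1)]] divf(1)[OF F1c(2)[OF xy(2)]]
      by (simp add: minus_add)
    moreover have "(x \<oplus>\<^bsub>G1\<^esub> y) i = x i \<oplus> y i" for i by (simp add: G1_def free_simps(3))
    ultimately show "\<iota> (x \<oplus>\<^bsub>sub_gmodule G1 F1\<^esub> y) = \<iota> x \<oplus>\<^bsub>L\<^esub> \<iota> y"
      unfolding Fs by (simp add: \<iota>_def L_def free_simps(3) fun_eq_iff split: sum.split)
  next
    fix a x assume a: "a \<in> carrier A" and "x \<in> carrier (sub_gmodule G1 F1)"
    then have x: "x \<in> F1" by (simp add: Fs)
    have "h (a \<odot>\<^bsub>G1\<^esub> x) i = a \<otimes> h x i" for i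
      using gmod_hom_smult[OF h a F1c(1)[OF x]] by (simp add: G0_def free_simps(4))
    then have "\<ominus> divf (h (a \<odot>\<^bsub>G1\<^esub> x) i) = a \<otimes> \<ominus> divf (h x i)" for i
      using divf_mult[OF a F1c(2)[OF x]] divf(1)[OF F1c(2)[OF x]] a by (simp add: r_minus)
    moreover have "(a \<odot>\<^bsub>G1\<^esub> x) i = a \<otimes> x i" for i by (simp add: G1_def free_simps(4))
    ultimately show "\<iota> (a \<odot>\<^bsub>sub_gmodule G1 F1\<^esub> x) = a \<odot>\<^bsub>L\<^esub> \<iota> x"
      unfolding Fs by (simp add: \<iota>_def L_def free_simps(4) fun_eq_iff split: sum.split)
  next
    fix x k assume "x \<in> grade (sub_gmodule G1 F1) k"
    then have x: "x \<in> grade G1 k" "x \<in> F1" by (simp_all add: Fs)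
    have hx: "h x \<in> grade G0 k" by (rule gmod_hom_grade[OF h x(1)])
    have 1: "\<ominus> divf (h x i) \<in> rgrade A (k - (e0 i + n))" if "i \<in> J0" for i
    proof -
      have "h x i \<in> rgrade A (k - e0 i)" using hx that by (simp add: G0_def free_simps)
      from G.g_inv[OF divf_grade[OF F1c(2)[OF x(2)] this]] show ?thesis by (simp add: algebra_simps)
    qed
    have 2: "\<ominus> divf (h x i) = \<zero>" if "i \<notin> J0" for i
      using hx that by (simp add: G0_def free_simps divf_zero)
    show "\<iota> x \<in> grade L k"
      using x(1) 1 2 by (simp add: \<iota>_def Lmem G1_def free_simps)
  qed
  show "inj_on \<iota> F1"
  proof (rule inj_onI)
    fix x y assume "\<iota> x = \<iota> y"
    then have "\<iota> x (Inl i) = \<iota> y (Inl i)" for i by simp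
    then show "x = y" by (simp add: \<iota>_def fun_eq_iff)
  qed
  show "\<iota> ` F1 = {z \<in> carrier L. \<pi> z = \<zero>\<^bsub>G0\<^esub>}"
  proof (intro equalityI subsetI)
    fix z assume "z \<in> \<iota> ` F1"
    then obtain x where x: "x \<in> F1" "z = \<iota> x" by blast
    have "h x i \<oplus> (\<ominus> divf (h x i)) \<otimes> f = \<zero>" for i
      using divf[OF F1c(2)[OF x(1), of i]] hc[OF F1c(1)[OF x(1)], of i] by (simp add: l_minus r_neg)
    then have "\<pi> z = \<zero>\<^bsub>G0\<^esub>" by (simp add: x(2) \<pi>_def \<iota>_def G0_def free_simps)
    then show "z \<in> {z \<in> carrier L. \<pi> z = \<zero>\<^bsub>G0\<^esub>}" using \<iota>L[OF x(1)] x(2) by simp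
  next
    fix z assume "z \<in> {z \<in> carrier L. \<pi> z = \<zero>\<^bsub>G0\<^esub>}"
    then have z: "z \<in> carrier L" "\<pi> z = \<zero>\<^bsub>G0\<^esub>" by simp_all
    let ?x = "\<lambda>i. z (Inl i)"
    \<comment> \<open>The kernel relation says that the first component is sent by \<open>h\<close>
      to minus the second component times f. This puts it into \<open>F1\<close> and accounts for
      the sign in \<open>\<iota>\<close>.\<close>
    have eq: "h ?x i = (\<ominus> z (Inr i)) \<otimes> f" for i
    proof -
      have "h ?x i \<oplus> z (Inr i) \<otimes> f = \<zero>" using fun_cong[OF z(2), of i] by (simp add: \<pi>_def G0_def free_simps)
      then show ?thesis using hc[OF l[OF z(1)]] Lc[OF z(1)] by (simp add: l_minus minus_equality)
    qed
    have x: "?x \<in> F1"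
      unfolding F1(1) ideal_coords_def using l[OF z(1)] eq Lc[OF z(1)] by (auto simp: I_right intro!: bexI[of _ "\<ominus> _"])
    have "divf (h ?x i) = \<ominus> z (Inr i)" for i by (rule divf_eq[OF _ eq]) (use Lc[OF z(1)] in simp)
    then have "\<iota> ?x = z" using Lc[OF z(1)] by (simp add: \<iota>_def fun_eq_iff split: sum.split)
    then show "z \<in> \<iota> ` F1" using x by (metis imageI)
  qed
  show "\<pi> ` carrier L = F0"
  proof (intro equalityI subsetI)
    fix y assume y: "y \<in> F0"
    obtain x where x: "x \<in> carrier G1" "ideal_coords J0 (y \<ominus>\<^bsub>G0\<^esub> h x)" using F0s[OF y] by blast
    have yc: "y \<in> carrier G0" using y F0(2) by blast
    have hx: "h x \<in> carrier G0" by (rule gmod_hom_closed[OF h x(1)])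
    have dc: "y \<ominus>\<^bsub>G0\<^esub> h x \<in> carrier G0" using yc hx by simp
    let ?d = "y \<ominus>\<^bsub>G0\<^esub> h x"
    \<comment> \<open>\<open>y\<close> differs from \<open>h x\<close> by an element of
      \<open>f G0\<close>; dividing that difference by f gives the second component of a
      preimage.\<close>
    let ?z = "case_sum x (\<lambda>i. divf (?d i))"
    have dI: "?d i \<in> I" for i by (rule all_coords[OF x(2) dc])
    have "divf (?d i) = \<zero>" if "i \<notin> J0" for i using dc that by (simp add: G0_def free_simps divf_zero)
    then have zL: "?z \<in> carrier L"
      using free_coord_closed[OF x(1)[unfolded G1_def]] x(1) divf(1)[OF dI]
      by (simp add: Lmem G1_def free_simps)
    have "\<pi> ?z = h x \<oplus>\<^bsub>G0\<^esub> ?d" using divf(2)[OF dI] by (simp add: \<pi>_def)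
    also have "\<dots> = y" using hx dc yc G0.M.minus_add_cancel[OF yc hx] by (simp add: G0.M.a_comm)
    finally have "y = \<pi> ?z" by (rule sym)
    then show "y \<in> \<pi> ` carrier L" using zL by (rule image_eqI)
  qed (use \<pi>F in auto)
qed

text \<open>Finite ranks propagate along the resolution: a finite basis of \<open>Q i\<close> gives
  a finite free cover over \<open>A\<close>, hence \<open>ker i\<close> is finitely generated by
  noetherianity, and by minimality the basis of \<open>Q (Suc i)\<close>, which maps onto
  \<open>ker i\<close>, is finite. Finite generation of \<open>M\<close> starts the induction.
  Letting \<open>ker 0\<close> be the kernel of \<open>\<epsilon>\<close> gives all degrees the same
  form.\<close>

lemma resolution_free_covers:
  fixes Q :: "nat \<Rightarrow> ('a set, 'q) gmodule" and M :: "('a set, 'm) gmodule"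
  assumes noeth: "left_noetherian A" and fg: "finitely_generated B M"
    and res: "minimal_graded_free_resolution B Q \<delta> \<epsilon> M"
  defines "ker \<equiv> \<lambda>i. case i of 0 \<Rightarrow> {q \<in> carrier (Q 0). \<epsilon> q = \<zero>\<^bsub>M\<^esub>}
      | Suc k \<Rightarrow> {q \<in> carrier (Q (Suc k)). \<delta> (Suc k) q = \<zero>\<^bsub>Q k\<^esub>}"
  shows "\<And>i. \<delta> (Suc i) ` carrier (Q (Suc i)) = ker i"
    and "\<exists>N e p. \<forall>i. p i \<in> gmod_hom A (free_gmod A {..<N i::nat} (e i)) (restrict_scalars (Q i)) \<and>
      p i ` carrier (free_gmod A {..<N i} (e i)) = carrier (Q i) \<and>
      (\<forall>x\<in>carrier (free_gmod A {..<N i} (e i)). (p i x = \<zero>\<^bsub>Q i\<^esub> \<longleftrightarrow> ideal_coords {..<N i} x) \<and>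
        (p i x \<in> ker i \<longrightarrow> (\<forall>j\<in>{..<N i}. x j \<in> pos_part A)))"
proof -
  have Q: "graded_left_module B (Q i)" and M: "graded_left_module B M"
    and \<epsilon>: "\<epsilon> \<in> gmod_hom B (Q 0) M" "\<epsilon> ` carrier (Q 0) = carrier M"
    and \<delta>: "\<delta> (Suc i) \<in> gmod_hom B (Q (Suc i)) (Q i)"
    and im: "\<delta> (Suc i) ` carrier (Q (Suc i)) = ker i"
    and free: "graded_free B (Q i)"
    and min: "\<delta> (Suc i) ` carrier (Q (Suc i)) \<subseteq> set_smult (Q i) (augmentation B) (carrier (Q i))" for i
    using res unfolding minimal_graded_free_resolution_def graded_resolution_def
    by (simp_all add: ker_def a_kernel_def' split: nat.split)
  show "\<delta> (Suc i) ` carrier (Q (Suc i)) = ker i" for i by (rule im)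
  have "\<forall>i. \<exists>S. homogeneous_basis B (Q i) S" using free by (simp add: graded_free_def)
  from choice[OF this] obtain S where S: "\<forall>i. homogeneous_basis B (Q i) (S i)" ..
  have bas: "based_module B (Q i) (S i)" for i
    by (intro based_module.intro based_module_axioms.intro Q S[rule_format])
  have aug: "q \<in> set_smult (Q i) (augmentation B) (carrier (Q i))" if "q \<in> ker i" for q i
    using min[of i] that unfolding im by blast
  have fgk: "fg_sub (Q i) (ker i)" if fin: "finite (S i)" for i
  proof -
    obtain N e p where p: "p \<in> gmod_hom A (free_gmod A {..<N::nat} e) (restrict_scalars (Q i))"
      "p ` carrier (free_gmod A {..<N} e) = carrier (Q i)"
      using free_cover[OF bas[of i] fin] by (elim exE conjE)
    show ?thesis
    proof (cases i)
      case 0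
      show ?thesis using fg_kernel[OF noeth finite_lessThan Q M \<epsilon>(1) p[unfolded 0]] by (simp add: 0 ker_def)
    next
      case (Suc k)
      show ?thesis using fg_kernel[OF noeth finite_lessThan Q Q \<delta> p[unfolded Suc]] by (simp add: Suc ker_def)
    qed
  qed
  have fin: "finite (S i)" for i
  proof (induction i)
    case 0
    show ?case
    proof (rule finite_basis[OF bas M \<epsilon>(1)])
      show "fg_sub M (\<epsilon> ` carrier (Q 0))" unfolding \<epsilon>(2) by (rule finitely_generated_fg_sub[OF M fg])
    qed (use aug[of _ 0] in \<open>simp add: ker_def\<close>)
  next
    case (Suc i)
    show ?case
    proof (rule finite_basis[OF bas Q \<delta>])
      show "fg_sub (Q i) (\<delta> (Suc i) ` carrier (Q (Suc i)))" unfolding im by (rule fgk[OF Suc])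
    qed (use aug[of _ "Suc i"] in \<open>simp add: ker_def\<close>)
  qed
  let ?P = "\<lambda>i N e p. p \<in> gmod_hom A (free_gmod A {..<N::nat} e) (restrict_scalars (Q i)) \<and>
      p ` carrier (free_gmod A {..<N} e) = carrier (Q i) \<and>
      (\<forall>x\<in>carrier (free_gmod A {..<N} e). (p x = \<zero>\<^bsub>Q i\<^esub> \<longleftrightarrow> ideal_coords {..<N} x) \<and>
        (p x \<in> ker i \<longrightarrow> (\<forall>j\<in>{..<N}. x j \<in> pos_part A)))"
  have ex: "\<exists>N e p. ?P i N e p" for i
  proof -
    obtain N e p where p: "p \<in> gmod_hom A (free_gmod A {..<N::nat} e) (restrict_scalars (Q i))"
      "p ` carrier (free_gmod A {..<N} e) = carrier (Q i)"
      "\<forall>x\<in>carrier (free_gmod A {..<N} e). (p x = \<zero>\<^bsub>Q i\<^esub> \<longleftrightarrow> ideal_coords {..<N} x) \<and>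
        (p x \<in> set_smult (Q i) (augmentation B) (carrier (Q i)) \<longrightarrow> (\<forall>j\<in>{..<N}. x j \<in> pos_part A))"
      using free_cover[OF bas[of i] fin[of i]] by (elim exE conjE)
    show ?thesis
      by (rule exI[of _ N], rule exI[of _ e], rule exI[of _ p]) (use p aug in simp)
  qed
  have "\<forall>i. \<exists>N e p. ?P i N e p" using ex by (intro allI)
  from choice[OF this] obtain N where "\<forall>i. \<exists>e p. ?P i (N i) e p" ..
  from choice[OF this] obtain e where "\<forall>i. \<exists>p. ?P i (N i) (e i) p" ..
  from choice[OF this] obtain p where "\<forall>i. ?P i (N i) (e i) (p i)" ..
  then show "\<exists>N e p. \<forall>i. ?P i (N i) (e i) (p i)" by (intro exI)
qed

lemma syzygy_factorization:
  fixes Q :: "nat \<Rightarrow> ('a set, 'q) gmodule" and M :: "('a set, 'm) gmodule"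
  assumes noeth: "left_noetherian A" and gl: "gl_dim A = enat d" and fg: "finitely_generated B M"
    and res: "minimal_graded_free_resolution B Q \<delta> \<epsilon> M"
  shows "\<exists>X :: ('a, nat \<Rightarrow> 'a) factorization. reduced_factorization A f X \<and>
    gmod_isomorphic B (syzygy Q \<delta> (d + 1)) (induced_module (coker X))"
proof -
  have Q: "graded_left_module B (Q i)" and M: "graded_left_module B M"
    and \<epsilon>: "\<epsilon> \<in> gmod_hom B (Q 0) M" "\<epsilon> ` carrier (Q 0) = carrier M"
    and \<delta>: "\<delta> (Suc i) \<in> gmod_hom B (Q (Suc i)) (Q i)" for i
    using res unfolding minimal_graded_free_resolution_def graded_resolution_def by simp_all
  define ker where "ker i = (case i of 0 \<Rightarrow> {q \<in> carrier (Q 0). \<epsilon> q = \<zero>\<^bsub>M\<^esub>}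
      | Suc k \<Rightarrow> {q \<in> carrier (Q (Suc k)). \<delta> (Suc k) q = \<zero>\<^bsub>Q k\<^esub>})" for i
  have im: "\<delta> (Suc i) ` carrier (Q (Suc i)) = ker i" for i
    unfolding ker_def by (rule resolution_free_covers(1)[OF noeth fg res])
  obtain N e p where all: "\<forall>i. p i \<in> gmod_hom A (free_gmod A {..<N i::nat} (e i)) (restrict_scalars (Q i)) \<and>
      p i ` carrier (free_gmod A {..<N i} (e i)) = carrier (Q i) \<and>
      (\<forall>x\<in>carrier (free_gmod A {..<N i} (e i)). (p i x = \<zero>\<^bsub>Q i\<^esub> \<longleftrightarrow> ideal_coords {..<N i} x) \<and>
        (p i x \<in> ker i \<longrightarrow> (\<forall>j\<in>{..<N i}. x j \<in> pos_part A)))"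
    using resolution_free_covers(2)[OF noeth fg res] unfolding ker_def by (elim exE)
  define G where "G i = free_gmod A {..<N i} (e i)" for i
  have p: "p i \<in> gmod_hom A (G i) (restrict_scalars (Q i))" "p i ` carrier (G i) = carrier (Q i)" for i
    using all unfolding G_def by simp_all
  have p0: "p i x = \<zero>\<^bsub>Q i\<^esub> \<longleftrightarrow> ideal_coords {..<N i} x"
    and ppos: "p i x \<in> ker i \<Longrightarrow> j \<in> {..<N i} \<Longrightarrow> x j \<in> pos_part A" if "x \<in> carrier (G i)" for i x j
    using all that unfolding G_def by simp_all
  have Gm: "graded_left_module A (G i)" for i unfolding G_def by (rule free_graded) simp
  have RQ: "graded_left_module A (restrict_scalars (Q i))" for i by (rule restrict_scalars_graded[OF Q])
  have RM: "graded_left_module A (restrict_scalars M)" by (rule restrict_scalars_graded[OF M])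
  have Gab: "abelian_group (G i)" for i
  proof -
    interpret G: graded_left_module A "G i" by (rule Gm)
    show ?thesis by (rule G.M.abelian_group_axioms)
  qed
  have Rab: "abelian_group (restrict_scalars (Q i))" for i
  proof -
    interpret R: graded_left_module A "restrict_scalars (Q i)" by (rule RQ)
    show ?thesis by (rule R.M.abelian_group_axioms)
  qed
  have pc: "p i x \<in> carrier (Q i)" if "x \<in> carrier (G i)" for i x
    using gmod_hom_closed[OF p(1) that] by (simp add: restrict_scalars_simps)
  have \<delta>c: "\<delta> (Suc i) q \<in> carrier (Q i)" if "q \<in> carrier (Q (Suc i))" for i q by (rule gmod_hom_closed[OF \<delta> that])
  have \<delta>p: "(\<lambda>x. \<delta> (Suc i) (p (Suc i) x)) \<in> gmod_hom A (G (Suc i)) (restrict_scalars (Q i))" for i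
    by (rule gmod_hom_comp[OF p(1) restrict_scalars_hom[OF \<delta>]])
  \<comment> \<open>The differential is lifted to the covers over \<open>A\<close>. The lifts need
    not form a complex: a composite of two consecutive ones is only known to map into
    \<open>f G i\<close>.\<close>
  have "\<exists>h. h \<in> gmod_hom A (G (Suc i)) (G i) \<and>
      (\<forall>x\<in>carrier (G (Suc i)). p i (h x) = \<delta> (Suc i) (p (Suc i) x))" for i
  proof -
    have "\<delta> (Suc i) (p (Suc i) (fbasis A j)) \<in> p i ` carrier (G i)" if "j \<in> {..<N (Suc i)}" for j
    proof -
      have "fbasis A j \<in> carrier (G (Suc i))" unfolding G_def by (rule fbasis_carrier[OF that])
      then show ?thesis unfolding p(2) by (intro \<delta>c pc)
    qed
    from free_lift[OF finite_lessThan Gm[of i] RQ[of i] \<delta>p[of i, unfolded G_def[of "Suc i"]] p(1)[of i] this]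
    show ?thesis unfolding G_def[of "Suc i"] by blast
  qed
  then have "\<forall>i. \<exists>h. h \<in> gmod_hom A (G (Suc i)) (G i) \<and>
      (\<forall>x\<in>carrier (G (Suc i)). p i (h x) = \<delta> (Suc i) (p (Suc i) x))" by (intro allI)
  from choice[OF this] obtain h where "\<forall>i. h i \<in> gmod_hom A (G (Suc i)) (G i) \<and>
      (\<forall>x\<in>carrier (G (Suc i)). p i (h i x) = \<delta> (Suc i) (p (Suc i) x))" ..
  then have h: "h i \<in> gmod_hom A (G (Suc i)) (G i)"
    and ph: "x \<in> carrier (G (Suc i)) \<Longrightarrow> p i (h i x) = \<delta> (Suc i) (p (Suc i) x)" for i x by simp_all
  have hc: "h i x \<in> carrier (G i)" if "x \<in> carrier (G (Suc i))" for i x by (rule gmod_hom_closed[OF h that])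

  define F where "F i = {x \<in> carrier (G i). p i x \<in> ker i}" for i
  have FG: "F i \<subseteq> carrier (G i)" for i by (auto simp: F_def)
  have F_0: "F 0 = {x \<in> carrier (G 0). \<epsilon> (p 0 x) = \<zero>\<^bsub>restrict_scalars M\<^esub>}"
    using pc by (auto simp: F_def ker_def restrict_scalars_simps)
  have F_Suc: "F (Suc i) = {x \<in> carrier (G (Suc i)). \<delta> (Suc i) (p (Suc i) x) = \<zero>\<^bsub>restrict_scalars (Q i)\<^esub>}" for i
    using pc by (auto simp: F_def ker_def restrict_scalars_simps)
  have \<epsilon>p: "(\<lambda>x. \<epsilon> (p 0 x)) \<in> gmod_hom A (G 0) (restrict_scalars M)" by (rule gmod_hom_comp[OF p(1) restrict_scalars_hom[OF \<epsilon>(1)]])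
  have Fm: "graded_left_module A (sub_gmodule (G i) (F i))" for i
  proof (cases i)
    case 0
    show ?thesis unfolding 0 F_0 by (rule kernel_graded_left_module[OF Gm RM \<epsilon>p])
  next
    case (Suc k)
    show ?thesis unfolding Suc F_Suc by (rule kernel_graded_left_module[OF Gm RQ \<delta>p])
  qed
  \<comment> \<open>The kernel of \<open>p i\<close> is \<open>f G i\<close>, so membership of
    \<open>\<delta> (Suc i) (p (Suc i) x) = p i (h i x)\<close> in the zero module becomes a
    condition on the coordinates of \<open>h i x\<close>.\<close>
  have F_h: "F (Suc i) = {x \<in> carrier (G (Suc i)). ideal_coords {..<N i} (h i x)}" for i
    using p0[OF hc] ph unfolding F_Suc by (auto simp: restrict_scalars_simps)
  have hF: "h i x \<in> F i" if "x \<in> carrier (G (Suc i))" for i x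
    using hc[OF that] ph[OF that] im[of i] pc[OF that] unfolding F_def by auto
  have ker0: "\<zero>\<^bsub>Q i\<^esub> \<in> ker i" for i
  proof -
    have "\<delta> (Suc i) \<zero>\<^bsub>restrict_scalars (Q (Suc i))\<^esub> = \<zero>\<^bsub>restrict_scalars (Q i)\<^esub>"
      by (rule add_hom_zero[OF Rab Rab gmod_hom_hom[OF restrict_scalars_hom[OF \<delta>]]])
    then have "\<zero>\<^bsub>Q i\<^esub> = \<delta> (Suc i) \<zero>\<^bsub>Q (Suc i)\<^esub>" by (simp add: restrict_scalars_simps)
    moreover have "\<zero>\<^bsub>Q (Suc i)\<^esub> \<in> carrier (Q (Suc i))"
      using abelian_group.axioms(1)[OF Rab[of "Suc i"]] abelian_monoid.zero_closed by (fastforce simp: restrict_scalars_simps)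
    ultimately show ?thesis unfolding im[symmetric] by (rule image_eqI)
  qed
  have fF: "y \<in> F i" if "y \<in> carrier (G i)" "ideal_coords {..<N i} y" for i y
    using p0[OF that(1)] that ker0[of i] by (simp add: F_def)
  have Fs: "\<exists>x\<in>carrier (G (Suc i)). ideal_coords {..<N i} (y \<ominus>\<^bsub>G i\<^esub> h i x)" if y: "y \<in> F i" for i y
  proof -
    have yG: "y \<in> carrier (G i)" using y FG by blast
    have "p i y \<in> \<delta> (Suc i) ` carrier (Q (Suc i))" using y im[of i] by (simp add: F_def)
    then obtain q where q: "q \<in> carrier (Q (Suc i))" "p i y = \<delta> (Suc i) q" by blast
    obtain x where x: "x \<in> carrier (G (Suc i))" "q = p (Suc i) x" using q(1) p(2)[of "Suc i"] by blast
    have eq: "p i y = p i (h i x)" using ph[OF x(1)] q(2) x(2) by simp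
    have "p i (y \<ominus>\<^bsub>G i\<^esub> h i x) = p i y \<ominus>\<^bsub>restrict_scalars (Q i)\<^esub> p i (h i x)"
      by (rule add_hom_minus[OF Gab Rab gmod_hom_hom[OF p(1)] yG hc[OF x(1)]])
    also have "\<dots> = \<zero>\<^bsub>Q i\<^esub>"
      using abelian_group.minus_zero_iff[OF Rab, of "p i (h i x)" i "p i (h i x)"] pc[OF hc[OF x(1)]] eq
      by (simp add: restrict_scalars_simps)
    finally have "p i (y \<ominus>\<^bsub>G i\<^esub> h i x) = \<zero>\<^bsub>Q i\<^esub>" .
    then have "ideal_coords {..<N i} (y \<ominus>\<^bsub>G i\<^esub> h i x)"
      using p0[of "y \<ominus>\<^bsub>G i\<^esub> h i x" i] abelian_group.minus_closed[OF Gab yG hc[OF x(1)]] by simp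
    with x(1) show ?thesis by blast
  qed

  define J where "J k = {..<N (Suc k)} <+> {..<N k}" for k
  define eL where "eL k = case_sum (e (Suc k)) (\<lambda>i. e k i + n)" for k
  define \<pi> where "\<pi> k = (\<lambda>z :: nat + nat \<Rightarrow> 'a.
    h k (\<lambda>i. z (Inl i)) \<oplus>\<^bsub>G k\<^esub> (\<lambda>i. z (Inr i) \<otimes> f))" for k
  define \<iota> where "\<iota> k = (\<lambda>x :: nat \<Rightarrow> 'a. case_sum x (\<lambda>i. \<ominus> divf (h k x i)))" for k
  define FM where "FM k = sub_gmodule (G k) (F k)" for k
  have FMc: "carrier (FM k) = F k" "zero (FM k) = zero (G k)" for k by (simp_all add: FM_def sub_gmodule_def)
  note cov = cover_by_next[where ?J1.0 = "{..<N (Suc k)}" and ?J0.0 = "{..<N k}" and ?e1.0 = "e (Suc k)"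
      and ?e0.0 = "e k" and h = "h k" and ?F1.0 = "F (Suc k)" and ?F0.0 = "F k" for k,
    OF finite_lessThan finite_lessThan, folded G_def J_def eL_def,
    OF h F_h Fm Fm FG hF fF Fs, folded \<pi>_def \<iota>_def FM_def]
  define L where "L k = free_gmod A (J k) (eL k)" for k
  note cov' = cov[folded L_def]
  have \<pi>h: "\<pi> k \<in> gmod_hom A (L k) (FM k)" for k by (rule cov'(1))
  have \<iota>h: "\<iota> k \<in> gmod_hom A (FM (Suc k)) (L k)" for k by (rule cov'(3))
  have Inlh: "(\<lambda>z i. z (Inl i)) \<in> gmod_hom A (L k) (G (Suc k))" for k by (rule cov'(6))
  have Jfin: "finite (J k)" for k by (simp add: J_def)
  have FMm: "graded_left_module A (FM k)" for k unfolding FM_def by (rule Fm)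
  have \<pi>surj: "\<pi> k ` carrier (L k) = carrier (FM k)" for k unfolding FMc by (rule cov'(2))
  have \<iota>inj: "inj_on (\<iota> k) (carrier (FM (Suc k)))" for k unfolding FMc by (rule cov'(4))
  have \<iota>im: "\<iota> k ` carrier (FM (Suc k)) = {z \<in> carrier (L k). \<pi> k z = \<zero>\<^bsub>FM k\<^esub>}" for k
    unfolding FMc \<pi>_def by (rule cov'(5))

  have split: "\<exists>\<sigma>\<in>gmod_hom A (FM k) (L k). \<forall>y\<in>carrier (FM k). \<pi> k (\<sigma> y) = y" if k: "k \<ge> d" for k
  proof -
    \<comment> \<open>The type \<open>'m\<close> need not embed into \<open>'a univ\<close>, but the finitely generated module \<open>M\<close> does.\<close>
    define j :: "'m \<Rightarrow> 'a univ" where "j m = {x \<in> carrier (G 0). \<epsilon> (p 0 x) = m}" for m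
    have \<epsilon>psurj: "(\<lambda>x. \<epsilon> (p 0 x)) ` carrier (G 0) = carrier (restrict_scalars M)"
      using image_image[of \<epsilon> "p 0" "carrier (G 0)"] p(2) \<epsilon>(2) by (simp add: restrict_scalars_simps)
    \<comment> \<open>\<open>j m\<close> is the fibre over \<open>m\<close>, a set of functions from
      \<open>nat\<close> to \<open>'a\<close>, as \<open>'a univ\<close> requires. Fibres over
      elements of the module are nonempty because \<open>\<epsilon>\<close> and \<open>p 0\<close>
      are onto, so distinct elements have distinct fibres.\<close>
    have j: "inj_on j (carrier (restrict_scalars M))"
    proof (rule inj_onI)
      fix m m' assume m: "m \<in> carrier (restrict_scalars M)" "j m = j m'"
      then obtain x where x: "x \<in> carrier (G 0)" "m = \<epsilon> (p 0 x)" using \<epsilon>psurj by blast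
      then have "x \<in> j m" unfolding j_def by simp
      then have "x \<in> j m'" by (simp only: m(2))
      then have "\<epsilon> (p 0 x) = m'" unfolding j_def by simp
      then show "m = m'" by (simp only: x(2))
    qed
    define C where "C = copy_gmodule j (restrict_scalars M)"
    have C: "graded_left_module A C" unfolding C_def by (rule copy_graded_left_module[OF RM j])
    let ?k = "the_inv_into (carrier (restrict_scalars M)) j"
    have jC: "j \<in> gmod_hom A (restrict_scalars M) C" and kC: "?k \<in> gmod_hom A C (restrict_scalars M)"
      unfolding C_def by (rule copy_hom[OF RM j], rule copy_inv_hom[OF RM j])
    have kj: "?k (j m) = m" if "m \<in> carrier (restrict_scalars M)" for m by (rule the_inv_into_f_f[OF j that])
    obtain P \<delta>' \<epsilon>' where P: "graded_projective_resolution A P \<delta>' \<epsilon>' C"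
      and P0: "\<forall>i>d. carrier (P i) = {\<zero>\<^bsub>P i\<^esub>}"
      using ex_short_projective_resolution[OF gl C] by (elim exE conjE)
    have Pp: "graded_projective A (P i)" and \<epsilon>': "\<epsilon>' \<in> gmod_hom A (P 0) C" "\<epsilon>' ` carrier (P 0) = carrier C"
      and \<delta>': "\<delta>' (Suc i) \<in> gmod_hom A (P (Suc i)) (P i)"
      and ex0: "\<delta>' (Suc 0) ` carrier (P (Suc 0)) = {x \<in> carrier (P 0). \<epsilon>' x = \<zero>\<^bsub>C\<^esub>}"
      and ex: "\<delta>' (Suc (Suc i)) ` carrier (P (Suc (Suc i))) =
        {x \<in> carrier (P (Suc i)). \<delta>' (Suc i) x = \<zero>\<^bsub>P i\<^esub>}" for i
      using P unfolding graded_projective_resolution_def graded_resolution_def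
      by (simp_all add: a_kernel_def')
    have Pm: "graded_left_module A (P i)" for i using Pp by (simp add: graded_projective_def)
    interpret G0: graded_left_module A "G 0" by (rule Gm)
    interpret RM: graded_left_module A "restrict_scalars M" by (rule RM)
    interpret C: graded_left_module A C by (rule C)
    \<comment> \<open>The comparison before any syzygy is taken: \<open>M\<close> is isomorphic to
      the module \<open>C\<close> that \<open>P\<close> resolves, so the maps are \<open>j\<close>
      and its inverse after \<open>\<epsilon>'\<close>, and the homotopy is 0.\<close>
    have st0: "stable_retract A (restrict_scalars M) (G 0) (\<lambda>x. \<epsilon> (p 0 x)) C (P 0) \<epsilon>'"
      unfolding stable_retract_def
    proof (rule bexI[OF _ jC], rule bexI[OF _ gmod_hom_comp[OF \<epsilon>'(1) kC]], rule bexI)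
      show "(\<lambda>_. \<zero>\<^bsub>G 0\<^esub>) \<in> gmod_hom A (restrict_scalars M) (G 0)"
        by (rule gmod_homI) (simp_all add: G0.smult_zero G0.GM.g_zero)
      have k0: "?k \<zero>\<^bsub>C\<^esub> = \<zero>\<^bsub>restrict_scalars M\<^esub>"
        by (rule add_hom_zero[OF C.M.abelian_group_axioms RM.M.abelian_group_axioms gmod_hom_hom[OF kC]])
      have e0: "\<epsilon> (p 0 \<zero>\<^bsub>G 0\<^esub>) = \<zero>\<^bsub>restrict_scalars M\<^esub>"
        by (rule add_hom_zero[OF G0.M.abelian_group_axioms RM.M.abelian_group_axioms gmod_hom_hom[OF \<epsilon>p]])
      have 1: "j y \<in> \<epsilon>' ` carrier (P 0)" if "y \<in> carrier (restrict_scalars M)" for y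
        unfolding \<epsilon>'(2) by (rule gmod_hom_closed[OF jC that])
      have 2: "y \<ominus>\<^bsub>restrict_scalars M\<^esub> ?k (\<epsilon>' q) = \<zero>\<^bsub>restrict_scalars M\<^esub>" if "y \<in> carrier (restrict_scalars M)" "\<epsilon>' q = j y" for y q
        using that by (simp add: kj RM.M.minus_zero_iff)
      show "(\<forall>y\<in>carrier (restrict_scalars M). j y \<in> \<epsilon>' ` carrier (P 0)) \<and>
        (\<forall>q\<in>carrier (P 0). \<epsilon>' q = \<zero>\<^bsub>C\<^esub> \<longrightarrow> ?k (\<epsilon>' q) = \<zero>\<^bsub>restrict_scalars M\<^esub>) \<and>
        (\<forall>y\<in>carrier (restrict_scalars M). \<forall>q\<in>carrier (P 0). \<epsilon>' q = j y \<longrightarrow>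
           y \<ominus>\<^bsub>restrict_scalars M\<^esub> ?k (\<epsilon>' q) = \<epsilon> (p 0 \<zero>\<^bsub>G 0\<^esub>))"
        unfolding e0 using 1 2 k0 by simp
    qed
    have \<iota>0: "(\<lambda>x. x) \<in> gmod_hom A (FM 0) (G 0)" "inj_on (\<lambda>x. x) (carrier (FM 0))"
      "(\<lambda>x. x) ` carrier (FM 0) = {x \<in> carrier (G 0). \<epsilon> (p 0 x) = \<zero>\<^bsub>restrict_scalars M\<^esub>}"
    proof -
      show "(\<lambda>x. x) \<in> gmod_hom A (FM 0) (G 0)"
        by (rule gmod_homI) (use FG[of 0] in \<open>auto simp: FM_def sub_gmodule_def\<close>)
      show "inj_on (\<lambda>x. x) (carrier (FM 0))" by simp
      show "(\<lambda>x. x) ` carrier (FM 0) = {x \<in> carrier (G 0). \<epsilon> (p 0 x) = \<zero>\<^bsub>restrict_scalars M\<^esub>}"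
        unfolding FMc F_0 by simp
    qed
    \<comment> \<open>Vectors indexed by \<open>nat\<close> embed into \<open>'a univ\<close> as
      singletons; those indexed by \<open>nat + nat\<close> do so after the index set is encoded in
      \<open>nat\<close>.\<close>
    have jG: "inj (\<lambda>x :: nat \<Rightarrow> 'a. {x})" by (simp add: inj_def)
    have jL: "inj (\<lambda>x :: nat + nat \<Rightarrow> 'a. {\<lambda>i. x (sum_decode i)})"
    proof (rule injI)
      fix x y :: "nat + nat \<Rightarrow> 'a"
      assume "{\<lambda>i. x (sum_decode i)} = {\<lambda>i. y (sum_decode i)}"
      then have eq: "x (sum_decode i) = y (sum_decode i)" for i by (simp add: fun_eq_iff)
      show "x = y"
      proof
        fix i show "x i = y i" using eq[of "sum_encode i"] by simp
      qed
    qed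
    \<comment> \<open>The step from \<open>M\<close> to its first syzygy over \<open>A\<close>, with
      the inclusion of \<open>F 0\<close> into \<open>G 0\<close> in the role of
      \<open>\<iota>\<close>.\<close>
    have st1: "stable_retract A (FM 0) (L 0) (\<pi> 0) (P 0) (P (Suc 0)) (\<delta>' (Suc 0))"
      unfolding L_def
      by (rule stable_retract_step[OF finite_lessThan RM FMm C \<epsilon>p[unfolded G_def] \<epsilon>psurj[unfolded G_def]
          \<iota>0[unfolded G_def] Jfin \<pi>h[unfolded L_def] \<pi>surj[unfolded L_def] Pp Pm \<epsilon>'(1) \<delta>' ex0
          inj_on_subset[OF jG subset_UNIV] j st0[unfolded G_def]])
    \<comment> \<open>From here on all modules \<open>F k\<close> and all their covers have the same
      types. For k \<ge> d the index \<open>Suc k\<close> exceeds d, so \<open>P (Suc k)\<close> is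
      zero.\<close>
    show ?thesis
      unfolding L_def
      by (rule eventually_split[where ?N = FM and ?J = J and ?P = P and \<pi> = \<pi> and \<iota> = \<iota> and \<delta> = \<delta>' and k = k,
          OF Jfin FMm \<pi>h[unfolded L_def] \<pi>surj[unfolded L_def] \<iota>h[unfolded L_def] \<iota>inj
          \<iota>im[unfolded L_def] Pp \<delta>' ex jL jG st1[unfolded L_def]])
        (rule P0[rule_format, of "Suc k", OF le_imp_less_Suc[OF k]])
  qed

  \<comment> \<open>Splitting is used at two indices: at d the section extends functionals to
    \<open>F d\<close>, and at d + 1 it makes the module \<open>F (Suc d)\<close> of the
    factorization free.\<close>
  obtain \<sigma> where \<sigma>: "\<sigma> \<in> gmod_hom A (FM d) (L d)" "\<And>y. y \<in> F d \<Longrightarrow> \<pi> d (\<sigma> y) = y"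
    using split[of d] unfolding FMc by blast
  obtain \<sigma>1 where \<sigma>1: "\<sigma>1 \<in> gmod_hom A (FM (Suc d)) (L (Suc d))"
    "\<And>y. y \<in> carrier (FM (Suc d)) \<Longrightarrow> \<pi> (Suc d) (\<sigma>1 y) = y"
    using split[of "Suc d"] by auto
  have F1free: "graded_free A (FM (Suc d))" "finitely_generated A (FM (Suc d))"
    using split_surjection_imp_graded_free[OF Jfin FMm \<pi>h[unfolded L_def] \<sigma>1[unfolded L_def]]
    by simp_all
  \<comment> \<open>Only the component in \<open>G (Suc d)\<close> of the section is kept. The other
    component contributes an element of \<open>f G d\<close> to \<open>z\<close>, so
    \<open>h d (s z)\<close> still agrees with \<open>z\<close> modulo \<open>f G d\<close>.\<close>
  define s where "s z = (\<lambda>i. \<sigma> z (Inl i))" for z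
  have s: "s \<in> gmod_hom A (FM d) (G (Suc d))"
    unfolding s_def by (rule gmod_hom_comp[OF \<sigma>(1) Inlh])
  have s2: "ideal_coords {..<N d} (h d (s z) \<ominus>\<^bsub>G d\<^esub> z)" if z: "z \<in> F d" for z
  proof -
    have "\<sigma> z \<in> carrier (L d)" by (rule gmod_hom_closed[OF \<sigma>(1)]) (simp add: FMc z)
    have "ideal_coords {..<N d} (h d (s z) \<ominus>\<^bsub>G d\<^esub> \<pi> d (\<sigma> z))"
      unfolding s_def \<pi>_def by (rule cov'(7)) (use \<open>\<sigma> z \<in> carrier (L d)\<close> in simp_all)
    then show ?thesis unfolding \<sigma>(2)[OF z] .
  qed
  have Fpos: "z i \<in> pos_part A" if "z \<in> F k" "i \<in> {..<N k}" for z i k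
    using ppos[of z k i] that by (simp add: F_def)
  let ?X = "\<lparr> fac_F = FM (Suc d), fac_G = G (Suc d), fac_phi = \<lambda>x. x,
    fac_tau = \<lambda>x. f \<odot>\<^bsub>G (Suc d)\<^esub> x \<rparr>"
  have "reduced_factorization A f ?X"
    unfolding FM_def G_def
    by (rule reduced_inclusion_factorization[where ?J0.0 = "{..<N d}" and ?e0.0 = "e d" and h = "h d"
        and ?F0.0 = "F d" and s = s])
      (fact finite_lessThan h[unfolded G_def] F_h[unfolded G_def] F1free[unfolded FM_def G_def]
        Fm[unfolded G_def] FG[unfolded G_def] hF[unfolded G_def] fF[unfolded G_def]
        s[unfolded FM_def G_def] s2[unfolded G_def] Fpos)+
  \<comment> \<open>The (d + 1)-st syzygy is a submodule of \<open>Q d\<close>. It is the image of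
    \<open>G (Suc d)\<close> under \<open>\<delta> (Suc d)\<close> after \<open>p (Suc d)\<close>,
    and the kernel of this composite is \<open>F (Suc d)\<close>, the image of the inclusion
    \<open>\<phi>\<close>.\<close>
  moreover have "gmod_isomorphic B (syzygy Q \<delta> (d + 1)) (induced_module (coker ?X))"
  proof -
    have "(\<lambda>x. \<delta> (Suc d) (p (Suc d) x)) ` carrier (G (Suc d)) = \<delta> (Suc d) ` carrier (Q (Suc d))"
      using image_image[of "\<delta> (Suc d)" "p (Suc d)" "carrier (G (Suc d))"] p(2) by simp
    with coker_isomorphic_image[OF Gm Q \<delta>p, of d] show ?thesis
      by (simp add: syzygy_def coker_def FMc F_Suc restrict_scalars_simps)
  qed
  ultimately show ?thesis by (intro exI[of _ ?X] conjI)
qed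

end

theorem theoremC:
  fixes K :: "'a set" and A :: "'a gring" and d :: nat and f :: 'a
    and B :: "'a set gring"
    and M :: "('a set, 'm) gmodule"
    and Q :: "nat \<Rightarrow> ('a set, 'q) gmodule"
    and \<delta> :: "nat \<Rightarrow> 'q \<Rightarrow> 'q" and \<epsilon> :: "'q \<Rightarrow> 'm"
  assumes "artin_schelter_regular K A d"
    and "left_noetherian A"
    and "\<exists>n > 0. f \<in> rgrade A n"
    and "normal_element A f"
    and "regular_element A f"
    and "B = quot_gring A (Idl\<^bsub>A\<^esub> {f})"
    and "graded_left_module B M"
    and "finitely_generated B M"
    and "minimal_graded_free_resolution B Q \<delta> \<epsilon> M"
  shows "\<exists>X :: ('a, nat \<Rightarrow> 'a) factorization.
    reduced_factorization A f X \<and>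
    gmod_isomorphic B (syzygy Q \<delta> (d + 1)) (induced_module (coker X))"
proof -
  obtain n where n: "n > 0" "f \<in> rgrade A n" using assms(3) by blast
  have "connected_graded_algebra K A" and gl: "gl_dim A = enat d"
    using assms(1) by (simp_all add: artin_schelter_regular_def)
  then interpret hypersurface K A f n B
    using n assms(4-6)
    by (intro hypersurface.intro hypersurface_axioms.intro normal_regular.intro normal_regular_axioms.intro)
  show ?thesis by (rule syzygy_factorization[OF assms(2) gl assms(8,9)])
qed

end
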